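(* Let $(\mathcal{B},\phi,\rho)$ be an expanding overlapping substitution in $\mathbb{R}^d$ and let $\mathcal{T}$ be a tiling of $\mathbb{R}^d$ by translates of elements of $\mathcal{B}$ which is a fixed point for $\rho$, i.e. $\rho^k(\mathcal{T})=\mathcal{T}$ for some integer $k>0$. Assume that $\mathcal{T}$ is repetitive. Then the patch frequencies converge uniformly. That is, for any van Hove sequence $(A_n)$ in $\mathbb{R}^d$, any elements $x_n\in\mathbb{R}^d$ and any patch $\mathcal{P}$, the limit $$\lim_{n\to\infty}\frac{\operatorname{card}\{x\in A_n+x_n\mid \mathcal{P}+x\subset\mathcal{T}\}}{\operatorname{vol}(A_n)}$$ converges and is independent of $(A_n)$ and $(x_n)$. Moreover, if $(A_n)$ and $\mathcal{P}$ are fixed, the convergence is uniform for $(x_n)$. In particular, the dynamical system corresponding to the repetitive fixed point $\mathcal{T}$ is uniquely ergodic.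
   Context: Tiles. A tile in $\mathbb{R}^d$ is either a nonempty compact set $S\subset\mathbb{R}^d$ with $S=\overline{S^\circ}$, or a pair $T=(S,l)$ of such a set with a label $l$ from a finite set; $\operatorname{supp}T=S$, $\operatorname{int}T=S^\circ$, and $T+x=(S+x,l)$. A pattern is a set of tiles; a patch is a pattern in which any two distinct tiles have disjoint interiors. The support of a patch is the union of the supports of its tiles; a tiling is a patch with support $\mathbb{R}^d$. $\mathcal{P}+x=\{T+x\mid T\in\mathcal{P}\}$. $\operatorname{vol}$ is Lebesgue measure. Overlapping substitutions. A pre-overlapping substitution is a triple $(\mathcal{B},\phi,\rho)$ where $\mathcal{B}=\{T_1,\dots,T_\kappa\}$ is a finite set of tiles in $\mathbb{R}^d$ (the proto-tiles), $\phi:\mathbb{R}^d\to\mathbb{R}^d$ is a linear map all of whose eigenvalues are greater than $1$ in modulus, and $\rho$ assigns to each $T_i$ a finite patch $\rho(T_i)$ consisting of translates of elements of $\mathcal{B}$. Put $\rho(T_i+x)=\rho(T_i)+\phi(x)$ and $\rho(\mathcal{P})=\bigcup_{T\in\mathcal{P}}\rho(T)$ for a pattern $\mathcal{P}$ of translates of proto-tiles. It is called an overlapping substitution (it is consistent) if $\rho^n(T_i)$ is a patch for all $n>0$ and all $i$. It is expanding if $\operatorname{supp}\rho(P)\supset\phi(\operatorname{supp}P)$ for every $P\in\mathcal{B}$. Repetitive: for any patch $\mathcal{P}$ of $\mathcal{T}$ there is $R>0$ such that any ball $B(x,R)$ contains a translate of $\mathcal{P}$ (occurring in $\mathcal{T}$).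 Van Hove sequence (standard notion): a sequence of bounded measurable sets $A_n\subset\mathbb{R}^d$ of positive volume such that for every $L>0$, $\operatorname{vol}(\partial^LA_n)/\operatorname{vol}(A_n)\to0$, where $\partial^LA=\{t\mid B(t,L)\cap A\neq\emptyset,\ B(t,L)\cap A^c\ne\emptyset\}$ and $B(t,L)$ is the ball of radius $L$ around $t$. "Uniform for $(x_n)$" means: for each $\varepsilon>0$ there is $N$ such that for all $n\ge N$ and all $x_n\in\mathbb{R}^d$ the quantity is within $\varepsilon$ of the limit. Corresponding dynamical system (standard notion): the translation action of $\mathbb{R}^d$ on the hull of $\mathcal{T}$, i.e. the closure of $\{\mathcal{T}+x\mid x\in\mathbb{R}^d\}$ in the usual local topology on tilings. Uniquely ergodic: there is exactly one translation-invariant Borel probability measure on the hull. *)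

theory Defs
  imports "HOL-Probability.Probability"
begin

datatype ('a, 'l) tile = Unlabelled (supp: "'a set") | Labelled (supp: "'a set") (label: 'l)

primrec shift_tile :: "'a::plus \<Rightarrow> ('a, 'l) tile \<Rightarrow> ('a, 'l) tile" where
  "shift_tile x (Unlabelled S) = Unlabelled ((\<lambda>s. s + x) ` S)"
| "shift_tile x (Labelled S l) = Labelled ((\<lambda>s. s + x) ` S) l"

definition shift_pattern :: "'a::plus \<Rightarrow> ('a, 'l) tile set \<Rightarrow> ('a, 'l) tile set" where
  "shift_pattern x P = shift_tile x ` P"

definition is_tile :: "(real ^ 'n, 'l) tile \<Rightarrow> bool" where
  "is_tile T \<longleftrightarrow> supp T \<noteq> {} \<and> compact (supp T) \<and> supp T = closure (interior (supp T))"

definition is_pattern :: "(real ^ 'n, 'l) tile set \<Rightarrow> bool" where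
  "is_pattern P \<longleftrightarrow> (\<forall>T\<in>P. is_tile T)"

definition is_patch :: "(real ^ 'n, 'l) tile set \<Rightarrow> bool" where
  "is_patch P \<longleftrightarrow> is_pattern P \<and>
     (\<forall>S\<in>P. \<forall>T\<in>P. S \<noteq> T \<longrightarrow> interior (supp S) \<inter> interior (supp T) = {})"

definition support :: "('a, 'l) tile set \<Rightarrow> 'a set" where
  "support P = (\<Union>T\<in>P. supp T)"

definition is_tiling :: "(real ^ 'n, 'l) tile set \<Rightarrow> bool" where
  "is_tiling P \<longleftrightarrow> is_patch P \<and> support P = UNIV"

definition translates :: "('a::plus, 'l) tile set \<Rightarrow> ('a, 'l) tile set" where
  "translates B = {shift_tile x T | x T. T \<in> B}"

text \<open>The eigenvalues of a real linear map are the complex ones, i.e. those of its matrix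
  regarded as a complex matrix.\<close>

definition complex_eigenvalue :: "(real ^ 'n \<Rightarrow> real ^ 'n) \<Rightarrow> complex \<Rightarrow> bool" where
  "complex_eigenvalue \<phi> \<mu> \<longleftrightarrow>
     (\<exists>v :: complex ^ 'n. v \<noteq> 0 \<and> (\<chi> i j. complex_of_real (matrix \<phi> $ i $ j)) *v v = \<mu> *s v)"

text \<open>The last clause is what makes the extension of \<open>\<rho>\<close> to translates of proto-tiles, given by
  \<open>\<rho> (T + x) = \<rho> T + \<phi> x\<close>, well defined. It holds trivially when no two distinct proto-tiles are
  translates of each other, since a bounded nonempty set has no nonzero translational period.\<close>

definition pre_overlapping_substitution ::
  "(real ^ 'n, 'l) tile set \<Rightarrow> (real ^ 'n \<Rightarrow> real ^ 'n) \<Rightarrow>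
   ((real ^ 'n, 'l) tile \<Rightarrow> (real ^ 'n, 'l) tile set) \<Rightarrow> bool" where
  "pre_overlapping_substitution B \<phi> \<rho> \<longleftrightarrow>
     finite B \<and> (\<forall>T\<in>B. is_tile T) \<and>
     linear \<phi> \<and> (\<forall>\<mu>. complex_eigenvalue \<phi> \<mu> \<longrightarrow> cmod \<mu> > 1) \<and>
     (\<forall>T\<in>B. finite (\<rho> T) \<and> is_patch (\<rho> T) \<and> \<rho> T \<subseteq> translates B) \<and>
     (\<forall>T\<in>B. \<forall>x. shift_tile x T \<in> B \<longrightarrow> \<rho> (shift_tile x T) = shift_pattern (\<phi> x) (\<rho> T))"

text \<open>\<open>subst B \<phi> \<rho> P\<close> is \<open>\<rho>(P)\<close> for a pattern \<open>P\<close> of translates of proto-tiles: the union of the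
  patches \<open>\<rho> T + \<phi> x\<close> over all members of \<open>P\<close>, each written as \<open>T + x\<close> with \<open>T \<in> B\<close>.\<close>

definition subst ::
  "(real ^ 'n, 'l) tile set \<Rightarrow> (real ^ 'n \<Rightarrow> real ^ 'n) \<Rightarrow>
   ((real ^ 'n, 'l) tile \<Rightarrow> (real ^ 'n, 'l) tile set) \<Rightarrow>
   (real ^ 'n, 'l) tile set \<Rightarrow> (real ^ 'n, 'l) tile set" where
  "subst B \<phi> \<rho> P = \<Union> {shift_pattern (\<phi> x) (\<rho> T) | T x. T \<in> B \<and> shift_tile x T \<in> P}"

definition overlapping_substitution ::
  "(real ^ 'n, 'l) tile set \<Rightarrow> (real ^ 'n \<Rightarrow> real ^ 'n) \<Rightarrow>
   ((real ^ 'n, 'l) tile \<Rightarrow> (real ^ 'n, 'l) tile set) \<Rightarrow> bool" where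
  "overlapping_substitution B \<phi> \<rho> \<longleftrightarrow>
     pre_overlapping_substitution B \<phi> \<rho> \<and>
     (\<forall>n>0. \<forall>T\<in>B. is_patch ((subst B \<phi> \<rho> ^^ n) {T}))"

definition expanding ::
  "(real ^ 'n, 'l) tile set \<Rightarrow> (real ^ 'n \<Rightarrow> real ^ 'n) \<Rightarrow>
   ((real ^ 'n, 'l) tile \<Rightarrow> (real ^ 'n, 'l) tile set) \<Rightarrow> bool" where
  "expanding B \<phi> \<rho> \<longleftrightarrow> (\<forall>T\<in>B. \<phi> ` supp T \<subseteq> support (\<rho> T))"

text \<open>Only finite patches are considered: a ball cannot contain a translate of an infinite patch
  such as the tiling itself.\<close>

definition repetitive :: "(real ^ 'n, 'l) tile set \<Rightarrow> bool" where
  "repetitive \<T> \<longleftrightarrow>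
     (\<forall>P. finite P \<and> P \<subseteq> \<T> \<longrightarrow>
       (\<exists>R>0. \<forall>x. \<exists>y. shift_pattern y P \<subseteq> \<T> \<and> support (shift_pattern y P) \<subseteq> ball x R))"

definition thick_boundary :: "real \<Rightarrow> (real ^ 'n) set \<Rightarrow> (real ^ 'n) set" where
  "thick_boundary L A = {t. ball t L \<inter> A \<noteq> {} \<and> ball t L \<inter> - A \<noteq> {}}"

definition van_hove :: "(nat \<Rightarrow> (real ^ 'n) set) \<Rightarrow> bool" where
  "van_hove A \<longleftrightarrow>
     (\<forall>n. bounded (A n) \<and> A n \<in> sets lebesgue \<and> measure lebesgue (A n) > 0) \<and>
     (\<forall>L>0. (\<lambda>n. measure lebesgue (thick_boundary L (A n)) / measure lebesgue (A n))
               \<longlonglongrightarrow> 0)"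

text \<open>Local topology: two tilings are close if, after a small translation of one of them, they have
  the same tiles meeting a large ball around the origin.\<close>

definition agree_on :: "'a set \<Rightarrow> ('a, 'l) tile set \<Rightarrow> ('a, 'l) tile set \<Rightarrow> bool" where
  "agree_on K P Q \<longleftrightarrow> {T \<in> P. supp T \<inter> K \<noteq> {}} = {T \<in> Q. supp T \<inter> K \<noteq> {}}"

definition locally_close ::
  "real \<Rightarrow> (real ^ 'n, 'l) tile set \<Rightarrow> (real ^ 'n, 'l) tile set \<Rightarrow> bool" where
  "locally_close e P Q \<longleftrightarrow> (\<exists>x. norm x < e \<and> agree_on (ball 0 (1 / e)) P (shift_pattern x Q))"

definition local_topology :: "(real ^ 'n, 'l) tile set topology" where
  "local_topology = topology (\<lambda>U. U \<subseteq> Collect is_tiling \<and>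
     (\<forall>P\<in>U. \<exists>e>0. \<forall>Q. is_tiling Q \<and> locally_close e P Q \<longrightarrow> Q \<in> U))"

lemma locally_close_mono:
  assumes "locally_close d P Q" "0 < d" "d \<le> e"
  shows "locally_close e P Q"
proof -
  obtain x where x: "norm x < d" "agree_on (ball 0 (1 / d)) P (shift_pattern x Q)"
    using assms(1) unfolding locally_close_def by blast
  have "1 / e \<le> 1 / d" using assms by (simp add: frac_le)
  then have "ball 0 (1 / e) \<subseteq> (ball 0 (1 / d) :: (real ^ 'a) set)"
    by (rule subset_ball)
  with x(2) have "agree_on (ball 0 (1 / e)) P (shift_pattern x Q)"
    unfolding agree_on_def set_eq_iff mem_Collect_eq by blast
  with x(1) assms(3) show ?thesis
    unfolding locally_close_def by (meson less_le_trans)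
qed

lemma openin_local_topology:
  "openin local_topology U \<longleftrightarrow> U \<subseteq> Collect is_tiling \<and>
     (\<forall>P\<in>U. \<exists>e>0. \<forall>Q. is_tiling Q \<and> locally_close e P Q \<longrightarrow> Q \<in> U)"
proof -
  let ?open = "\<lambda>U :: (real ^ 'a, 'b) tile set set. U \<subseteq> Collect is_tiling \<and>
     (\<forall>P\<in>U. \<exists>e>0. \<forall>Q. is_tiling Q \<and> locally_close e P Q \<longrightarrow> Q \<in> U)"
  have "istopology ?open"
    unfolding istopology_def
  proof (intro conjI allI impI)
    fix U V assume U: "?open U" and V: "?open V"
    show "U \<inter> V \<subseteq> Collect is_tiling" using U by blast
    show "\<forall>P\<in>U \<inter> V. \<exists>e>0. \<forall>Q. is_tiling Q \<and> locally_close e P Q \<longrightarrow> Q \<in> U \<inter> V"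
    proof
      fix P assume "P \<in> U \<inter> V"
      then obtain d e where "d > 0" "\<forall>Q. is_tiling Q \<and> locally_close d P Q \<longrightarrow> Q \<in> U"
        and "e > 0" "\<forall>Q. is_tiling Q \<and> locally_close e P Q \<longrightarrow> Q \<in> V"
        using U V by blast
      then show "\<exists>e>0. \<forall>Q. is_tiling Q \<and> locally_close e P Q \<longrightarrow> Q \<in> U \<inter> V"
        using locally_close_mono[of "min d e" P _ d] locally_close_mono[of "min d e" P _ e]
        by (intro exI[of _ "min d e"]) auto
    qed
  next
    fix \<K> assume \<K>: "\<forall>K\<in>\<K>. ?open K"
    show "\<Union>\<K> \<subseteq> Collect is_tiling" using \<K> by blast
    show "\<forall>P\<in>\<Union>\<K>. \<exists>e>0. \<forall>Q. is_tiling Q \<and> locally_close e P Q \<longrightarrow> Q \<in> \<Union>\<K>"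
      using \<K> by (meson Union_iff)
  qed
  then show ?thesis
    unfolding local_topology_def by (simp add: topology_inverse')
qed

definition tiling_hull :: "(real ^ 'n, 'l) tile set \<Rightarrow> (real ^ 'n, 'l) tile set set" where
  "tiling_hull \<T> = local_topology closure_of (range (\<lambda>x. shift_pattern x \<T>))"

definition borel_of :: "'a topology \<Rightarrow> 'a measure" where
  "borel_of X = sigma (topspace X) {U. openin X U}"

definition uniquely_ergodic_hull :: "(real ^ 'n, 'l) tile set \<Rightarrow> bool" where
  "uniquely_ergodic_hull \<T> \<longleftrightarrow>
     (\<exists>!M. prob_space M \<and>
        sets M = sets (borel_of (subtopology local_topology (tiling_hull \<T>))) \<and>
        (\<forall>x. distr M M (shift_pattern x) = M))"

end

theory Submission
  imports Defs "HOL-Computational_Algebra.Fundamental_Theorem_Algebra"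
    "HOL-Library.Diagonal_Subsequence"
begin

text \<open>
  Fix a tile \<open>t\<close> of the tiling, let \<open>\<psi>\<^sub>n\<close> be the powers of \<open>\<phi>\<^sup>k\<close>, and let \<open>q\<close> be a small ball inside \<open>t\<close>. By the
  expanding property, near \<open>\<psi>\<^sub>n (q + x)\<close> the tiling looks the same for all \<open>x\<close> such that \<open>t + x\<close> is a
  tile, because the supertile of \<open>t + x\<close> covers a large neighbourhood of that set. For a local
  quantity \<open>N\<close>, such as the number of occurrences of a patch, let \<open>l\<close> and \<open>u\<close> be the limits of the
  smallest and the largest average of \<open>N\<close> over translates of \<open>\<psi>\<^sub>n Q\<close>, for a cube \<open>Q\<close> all of whose
  translates contain some \<open>t + x\<close>. If the average over \<open>\<psi>\<^sub>n (Q + z)\<close> is close to \<open>l\<close>, then so is the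
  average over the part \<open>\<psi>\<^sub>n (q + x)\<close>, as the average over the remaining part cannot be much less than \<open>l\<close>;
  the same holds for \<open>u\<close>. But the average over \<open>\<psi>\<^sub>n (q + x)\<close> does not depend on \<open>x\<close>, so \<open>l = u\<close>.

  The argument also shows that every set of tilings that is determined by a bounded window has a
  uniform density along the orbit of the tiling. By Fubini's theorem each invariant measure agrees with the density
  on such sets, which gives uniqueness. For existence the density is extended by Caratheodory's
  theorem. Continuity at the empty set follows from inner regularity and a compactness argument;
  as the hull need not be compact, the latter rests on tightness: up to a set of small density,
  the origin lies deep inside a supertile of one of finitely many levels.
\<close>

section \<open>Powers of expanding linear maps\<close>

text \<open>Supertiles of an overlapping substitution may overlap one another, so the tiling is not
  partitioned into them and tile counts do not follow a substitution matrix. The proof therefore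
  marks a single tile and averages over copies of one cube: every cell of level \<open>n\<close>
  contains a marked set of the fixed proportion \<open>w\<close> whose contents are known, and no
  structure is asked of the rest. Repetitivity enters through the one-tile patch, as relative
  density of its copies. A mean comes with an error bounded by the volumes of the set and of a thick
  boundary, with constants valid for all bounded measurable sets; this yields arbitrary van Hove
  sequences and uniformity in the translations together. The assumptions provide no bound on the
  number of relative positions of neighbouring tiles, while closeness in the local topology permits
  only one small translation common to all tiles, so compactness of the hull is not at hand. The
  proportion \<open>w\<close> makes up for this: each suitable further level removes nearly that
  fraction of the density of the bad set.\<close>

lemma norm_smult_complex_vec: "norm (\<mu> *s (v :: complex ^ 'n)) = cmod \<mu> * norm v"
  by (simp add: norm_vec_def norm_mult L2_set_right_distrib)

text \<open>Once \<open>y\<close> stays below \<open>(1 - r) * (e / 2)\<close>, the recurrence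
  contracts towards \<open>e / 2\<close>, the fixed point of
  \<open>t -> r * t + (1 - r) * (e / 2)\<close>; only the excess \<open>r ^ k * x N\<close> is left,
  and it vanishes.\<close>

lemma contracting_recurrence_tendsto_0:
  fixes x y :: "nat \<Rightarrow> real"
  assumes r: "0 \<le> r" "r < 1" and x: "\<And>n. 0 \<le> x n"
    and rec: "\<And>n. x (Suc n) \<le> r * x n + y n" and y: "y \<longlonglongrightarrow> 0"
  shows "x \<longlonglongrightarrow> 0"
proof (rule LIMSEQ_I)
  fix e :: real assume e: "0 < e"
  then have "eventually (\<lambda>n. y n < (1 - r) * (e / 2)) sequentially"
    using y r by (intro order_tendstoD(2)[OF y]) auto
  then obtain N where N: "\<And>n. n \<ge> N \<Longrightarrow> y n < (1 - r) * (e / 2)"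
    by (auto simp: eventually_sequentially)
  have b: "x (N + k) \<le> r ^ k * x N + e / 2" for k
  proof (induction k)
    case 0 then show ?case using e by simp
  next
    case (Suc k)
    have "x (N + Suc k) \<le> r * x (N + k) + y (N + k)" using rec[of "N + k"] by simp
    also have "\<dots> \<le> r * (r ^ k * x N + e / 2) + (1 - r) * (e / 2)"
      using Suc r N[of "N + k"] by (intro add_mono mult_left_mono) auto
    also have "\<dots> = r ^ Suc k * x N + e / 2" by (simp add: field_simps)
    finally show ?case .
  qed
  have "(\<lambda>k. r ^ k * x N) \<longlonglongrightarrow> 0 * x N"
    using r by (intro tendsto_mult LIMSEQ_power_zero tendsto_const) auto
  then have "eventually (\<lambda>k. r ^ k * x N < e / 2) sequentially"
    using e by (intro order_tendstoD(2)) auto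
  then obtain K where K: "\<And>k. k \<ge> K \<Longrightarrow> r ^ k * x N < e / 2"
    by (auto simp: eventually_sequentially)
  show "\<exists>no. \<forall>n\<ge>no. norm (x n - 0) < e"
  proof (intro exI allI impI)
    fix n assume n: "N + K \<le> n"
    then have "K \<le> n - N" "N + (n - N) = n" by auto
    then have "x n < e" using b[of "n - N"] K[of "n - N"] by simp
    then show "norm (x n - 0) < e" using x[of n] by simp
  qed
qed

section \<open>Polynomials of a matrix applied to one vector\<close>

definition poly_matrix_apply :: "complex ^ 'n ^ 'n \<Rightarrow> complex poly \<Rightarrow> complex ^ 'n \<Rightarrow> complex ^ 'n" where
  "poly_matrix_apply M p v = (\<Sum>i\<le>degree p. coeff p i *s (((*v) M) ^^ i) v)"

lemma poly_matrix_apply_eq: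
  assumes "degree p \<le> n"
  shows "poly_matrix_apply M p v = (\<Sum>i\<le>n. coeff p i *s (((*v) M) ^^ i) v)"
  unfolding poly_matrix_apply_def
  by (rule sum.mono_neutral_left) (use assms in \<open>auto simp: coeff_eq_0\<close>)

lemma matrix_vector_mult_sum_complex:
  "(M :: complex ^ 'n ^ 'n) *v (\<Sum>i\<in>A. c i *s f i) = (\<Sum>i\<in>A. c i *s (M *v f i))"
  by (induction A rule: infinite_finite_induct)
     (auto simp: matrix_vector_right_distrib vector_scalar_commute)

text \<open>The coefficients of the product split into those of \<open>q\<close> moved up by one
  degree and \<open>\<mu>\<close> times those of \<open>q\<close>; the first part is what applying
  \<open>M\<close> once more produces.\<close>

lemma poly_matrix_apply_linear_factor:
  "poly_matrix_apply M ([:-\<mu>, 1:] * q) v = M *v poly_matrix_apply M q v - \<mu> *s poly_matrix_apply M q v"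
proof -
  define m where "m = degree q"
  have d: "degree ([:-\<mu>, 1:] * q) \<le> Suc m"
    using degree_mult_le[of "[:-\<mu>, 1:]" q] by (simp add: m_def)
  have "poly_matrix_apply M ([:-\<mu>, 1:] * q) v
      = (\<Sum>i\<le>Suc m. coeff ([:-\<mu>, 1:] * q) i *s (((*v) M) ^^ i) v)"
    by (rule poly_matrix_apply_eq[OF d])
  also have "\<dots> = (\<Sum>i\<le>Suc m. (coeff (pCons 0 q) i - \<mu> * coeff q i) *s (((*v) M) ^^ i) v)"
    by (intro sum.cong) (auto simp: algebra_simps)
  also have "\<dots> = (\<Sum>i\<le>Suc m. coeff (pCons 0 q) i *s (((*v) M) ^^ i) v)
      - (\<Sum>i\<le>Suc m. (\<mu> * coeff q i) *s (((*v) M) ^^ i) v)"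
    by (simp only: vector_sub_rdistrib[symmetric] sum_subtractf[symmetric])
  also have "(\<Sum>i\<le>Suc m. coeff (pCons 0 q) i *s (((*v) M) ^^ i) v)
      = M *v poly_matrix_apply M q v"
    unfolding sum.atMost_Suc_shift
    by (simp add: poly_matrix_apply_def matrix_vector_mult_sum_complex m_def)
  also have "(\<Sum>i\<le>Suc m. (\<mu> * coeff q i) *s (((*v) M) ^^ i) v) = \<mu> *s poly_matrix_apply M q v"
    by (simp add: poly_matrix_apply_eq[of q "Suc m"] m_def vec.scale_sum_right vector_smult_assoc)
  finally show ?thesis .
qed

text \<open>Polynomials in \<open>M\<close> commute with \<open>M - \<mu>\<close>. Together with the
  factor rule above, this passes annihilation of \<open>v\<close> by a product to annihilation of
  \<open>M v - \<mu> v\<close> by the cofactor.\<close>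

lemma poly_matrix_apply_mult_vec:
  "poly_matrix_apply M q (M *v v - \<mu> *s v) = M *v poly_matrix_apply M q v - \<mu> *s poly_matrix_apply M q v"
proof -
  have "(((*v) M) ^^ i) (M *v v - \<mu> *s v) = M *v (((*v) M) ^^ i) v - \<mu> *s (((*v) M) ^^ i) v" for i
    by (induction i) (auto simp: matrix_vector_mult_diff_distrib vector_scalar_commute)
  then show ?thesis
    unfolding poly_matrix_apply_def matrix_vector_mult_sum_complex
    by (simp add: vec.scale_right_diff_distrib sum_subtractf vec.scale_sum_right vector_smult_assoc mult.commute)
qed

text \<open>A substitute for the Jordan form, by induction on the degree. After splitting off a root
  \<open>\<mu>\<close>, either the cofactor \<open>q\<close> already annihilates \<open>v\<close>,
  or \<open>q(M) v\<close> is an eigenvector, so \<open>cmod \<mu> < 1\<close>. In the second case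
  \<open>q\<close> annihilates \<open>w = M v - \<mu> v\<close>, and the iterates of
  \<open>v\<close> obey a recurrence with factor \<open>\<mu>\<close>, perturbed by the null
  sequence of iterates of \<open>w\<close>.\<close>

lemma powers_tendsto_0_if_annihilated:
  fixes M :: "complex ^ 'n ^ 'n"
  assumes ev: "\<And>\<mu> v. v \<noteq> 0 \<Longrightarrow> M *v v = \<mu> *s v \<Longrightarrow> cmod \<mu> < 1"
  shows "p \<noteq> 0 \<Longrightarrow> poly_matrix_apply M p v = 0 \<Longrightarrow> (\<lambda>n. (((*v) M) ^^ n) v) \<longlonglongrightarrow> 0"
proof (induction "degree p" arbitrary: p v)
  case 0
  then obtain c where "p = [:c:]" by (metis degree_eq_zeroE)
  with 0 have "v = 0" by (simp add: poly_matrix_apply_def)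
  moreover have "(((*v) M) ^^ n) 0 = 0" for n by (induction n) auto
  ultimately show ?case by simp
next
  case (Suc d)
  then have "\<not> constant (poly p)" by (simp add: constant_degree)
  then obtain \<mu> where "poly p \<mu> = 0" using fundamental_theorem_of_algebra by blast
  then obtain q where q: "p = [:-\<mu>, 1:] * q" by (auto simp: poly_eq_0_iff_dvd)
  with Suc.prems have q0: "q \<noteq> 0" by auto
  have "degree p = degree [:-\<mu>, 1:] + degree q"
    unfolding q by (rule degree_mult_eq) (use q0 in auto)
  with Suc.hyps(2) have dq: "d = degree q" by simp
  have eq: "M *v poly_matrix_apply M q v = \<mu> *s poly_matrix_apply M q v"
    using Suc.prems(2) unfolding q poly_matrix_apply_linear_factor by simp
  show ?case
  proof (cases "poly_matrix_apply M q v = 0")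
    case True then show ?thesis using Suc.hyps(1)[OF dq q0] by blast
  next
    case False
    then have \<mu>: "cmod \<mu> < 1" using ev eq by blast
    define w where "w = M *v v - \<mu> *s v"
    have "poly_matrix_apply M q w = 0"
      unfolding w_def poly_matrix_apply_mult_vec eq by simp
    then have w: "(\<lambda>n. (((*v) M) ^^ n) w) \<longlonglongrightarrow> 0" using Suc.hyps(1)[OF dq q0] by blast
    have step: "(((*v) M) ^^ Suc n) v = \<mu> *s (((*v) M) ^^ n) v + (((*v) M) ^^ n) w" for n
      by (induction n) (auto simp: w_def matrix_vector_right_distrib vector_scalar_commute)
    have "(\<lambda>n. norm ((((*v) M) ^^ n) v)) \<longlonglongrightarrow> 0"
    proof (rule contracting_recurrence_tendsto_0[where r = "cmod \<mu>"])
      show "norm ((((*v) M) ^^ Suc n) v) \<le> cmod \<mu> * norm ((((*v) M) ^^ n) v) + norm ((((*v) M) ^^ n) w)" for n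
        unfolding step norm_smult_complex_vec[symmetric] by (rule norm_triangle_ineq)
      show "(\<lambda>n. norm ((((*v) M) ^^ n) w)) \<longlonglongrightarrow> 0" using w by (rule tendsto_norm_zero)
    qed (use \<mu> in auto)
    then show ?thesis by (rule tendsto_norm_zero_cancel)
  qed
qed

text \<open>The iterates of \<open>v\<close> up to the real dimension \<open>D\<close> are one too
  many to be independent; the coefficients of a linear relation between them form the
  polynomial.\<close>

lemma exists_annihilating_poly:
  fixes M :: "complex ^ 'n ^ 'n"
  shows "\<exists>p. p \<noteq> 0 \<and> poly_matrix_apply M p v = 0"
proof -
  define f where "f i = (((*v) M) ^^ i) v" for i
  define D where "D = DIM(complex ^ 'n)"
  have "\<exists>c :: nat \<Rightarrow> real. (\<exists>i\<le>D. c i \<noteq> 0) \<and> (\<Sum>i\<le>D. c i *\<^sub>R f i) = 0"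
  \<comment> \<open>Dependence is a property of a set of vectors, so two equal iterates are treated
    apart: their difference is the relation.\<close>
  proof (cases "inj_on f {..D}")
    case False
    then obtain i j where ij: "i \<le> D" "j \<le> D" "i \<noteq> j" "f i = f j" by (auto simp: inj_on_def)
    define c :: "nat \<Rightarrow> real" where "c = (\<lambda>l. if l = i then 1 else if l = j then -1 else 0)"
    have "(\<Sum>l\<le>D. c l *\<^sub>R f l) = (\<Sum>l\<in>{i,j}. c l *\<^sub>R f l)"
      by (rule sum.mono_neutral_right) (use ij in \<open>auto simp: c_def\<close>)
    also have "\<dots> = 0" using ij by (simp add: c_def)
    finally show ?thesis using ij(1) by (intro exI[of _ c]) (auto simp: c_def)
  next
    case True
    then have "card (f ` {..D}) = Suc D" by (simp add: card_image)
    then have "dependent (f ` {..D})" by (intro dependent_biggerset) (auto simp: D_def)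
    then obtain u where u: "(\<exists>v\<in>f ` {..D}. u v \<noteq> 0)" "(\<Sum>v\<in>f ` {..D}. u v *\<^sub>R v) = 0"
      using dependent_finite[of "f ` {..D}"] by auto
    then show ?thesis
      using True by (intro exI[of _ "u \<circ> f"]) (auto simp: sum.reindex)
  qed
  then obtain c :: "nat \<Rightarrow> real" and i where c: "i \<le> D" "c i \<noteq> 0" "(\<Sum>i\<le>D. c i *\<^sub>R f i) = 0" by blast
  define p where "p = (\<Sum>i\<le>D. monom (complex_of_real (c i)) i)"
  have co: "coeff p l = (if l \<le> D then complex_of_real (c l) else 0)" for l
    unfolding p_def coeff_sum by (simp add: if_distrib[of complex_of_real] sum.delta)
  have "degree p \<le> D" by (rule degree_le) (simp add: co)
  then have "poly_matrix_apply M p v = (\<Sum>i\<le>D. coeff p i *s f i)"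
    by (simp add: poly_matrix_apply_eq f_def)
  also have "\<dots> = (\<Sum>i\<le>D. c i *\<^sub>R f i)"
    by (intro sum.cong) (auto simp: co vec_eq_iff scaleR_conv_of_real[where 'a = complex])
  finally have "poly_matrix_apply M p v = 0" using c by simp
  moreover have "p \<noteq> 0" using co[of i] c by auto
  ultimately show ?thesis by blast
qed

section \<open>Expanding maps and their complexification\<close>

definition complex_vec :: "real ^ 'n \<Rightarrow> complex ^ 'n" where
  "complex_vec v = (\<chi> i. complex_of_real (v $ i))"

lemma complex_vec_matrix:
  assumes "linear g"
  shows "(\<chi> i j. complex_of_real (matrix g $ i $ j)) *v complex_vec v = complex_vec (g v)"
proof -
  have "g v = matrix g *v v" using fun_cong[OF matrix_vector_mul(2)[OF assms], of v] by simp
  then show ?thesis by (simp add: vec_eq_iff complex_vec_def matrix_vector_mult_def)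
qed

locale expanding_linear =
  fixes \<phi> :: "real ^ 'n \<Rightarrow> real ^ 'n"
  assumes linear: "linear \<phi>"
    and eigen: "\<And>\<mu>. complex_eigenvalue \<phi> \<mu> \<Longrightarrow> cmod \<mu> > 1"
begin

lemma inj: "inj \<phi>"
proof (rule ccontr)
  assume "\<not> inj \<phi>"
  then obtain v where v: "\<phi> v = 0" "v \<noteq> 0" using linear linear_injective_0 by blast
  have "complex_eigenvalue \<phi> 0"
    unfolding complex_eigenvalue_def
    using v by (intro exI[of _ "complex_vec v"])
      (auto simp: complex_vec_matrix[OF linear], auto simp: complex_vec_def vec_eq_iff)
  from eigen[OF this] show False by simp
qed

lemma bij: "bij \<phi>"
  using inj linear linear_injective_imp_surjective by (auto simp: bij_def)

text \<open>Eigenvalues of the inverse are reciprocals of eigenvalues of \<open>\<phi>\<close>,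
  hence of modulus below 1. Convergence is proved for the complexified matrix and read off in each
  real coordinate.\<close>

lemma inverse_powers_tendsto_0: "(\<lambda>n. (inv \<phi> ^^ n) v) \<longlonglongrightarrow> 0"
proof -
  define g where "g = inv \<phi>"
  have g: "linear g" unfolding g_def using linear inj inj_linear_imp_inv_linear by blast
  have fg: "\<phi> \<circ> g = id" unfolding g_def using bij bij_is_surj surj_iff by blast
  define M where "M = (\<chi> i j. complex_of_real (matrix \<phi> $ i $ j))"
  define N where "N = (\<chi> i j. complex_of_real (matrix g $ i $ j))"
  have "matrix \<phi> ** matrix g = mat 1"
    using matrix_compose[OF g linear] by (simp add: fg matrix_id_mat_1)
  then have MN: "M ** N = mat 1"
    by (simp add: M_def N_def vec_eq_iff matrix_matrix_mult_def mat_def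
         flip: of_real_mult of_real_sum)
  have ev: "cmod \<mu> < 1" if v: "w \<noteq> 0" "N *v w = \<mu> *s w" for \<mu> w
  proof -
    have w: "w = \<mu> *s (M *v w)"
      using MN v(2) by (metis matrix_vector_mul_assoc matrix_vector_mul_lid vector_scalar_commute)
    with v(1) have mu: "\<mu> \<noteq> 0" by auto
    have "M *v w = inverse \<mu> *s w"
      using mu by (subst (2) w) (simp add: vector_smult_assoc)
    then have "complex_eigenvalue \<phi> (inverse \<mu>)"
      unfolding complex_eigenvalue_def M_def using v(1) by blast
    from eigen[OF this] show ?thesis using mu by (simp add: norm_inverse one_less_inverse_iff)
  qed
  obtain p where "p \<noteq> 0" "poly_matrix_apply N p (complex_vec v) = 0"
    using exists_annihilating_poly by blast
  then have lim: "(\<lambda>n. (((*v) N) ^^ n) (complex_vec v)) \<longlonglongrightarrow> 0"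
    using powers_tendsto_0_if_annihilated[of N] ev by blast
  have pw: "(((*v) N) ^^ n) (complex_vec v) = complex_vec ((g ^^ n) v)" for n
    by (induction n) (auto simp: N_def complex_vec_matrix[OF g])
  show ?thesis unfolding g_def[symmetric]
  proof (rule vec_tendstoI)
    fix i
    have "(\<lambda>n. (((*v) N) ^^ n) (complex_vec v) $ i) \<longlonglongrightarrow> 0 $ i"
      by (rule tendsto_vec_nth[OF lim])
    then have "(\<lambda>n. complex_of_real ((g ^^ n) v $ i)) \<longlonglongrightarrow> 0"
      unfolding pw by (simp add: complex_vec_def)
    then have "(\<lambda>n. complex_of_real ((g ^^ n) v $ i)) \<longlonglongrightarrow> complex_of_real 0" by simp
    then show "(\<lambda>n. (g ^^ n) v $ i) \<longlonglongrightarrow> 0 $ i"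
      unfolding tendsto_of_real_iff by simp
  qed
qed

lemma linear_power: "linear (\<phi> ^^ n)"
  by (induction n) (auto simp: linear_id linear_compose[OF _ linear, unfolded o_def] simp flip: id_def)

lemma bij_power: "bij (\<phi> ^^ n)"
  using bij by (rule bij_fn)

text \<open>The inverse powers tend to 0 on each of the finitely many basis vectors, hence uniformly
  on the ball of radius \<open>R\<close>.\<close>

lemma ball_subset_power_image:
  assumes "0 < \<delta>"
  shows "eventually (\<lambda>n. ball 0 R \<subseteq> (\<phi> ^^ n) ` ball 0 \<delta>) sequentially"
proof -
  define g where "g = inv \<phi>"
  have g: "linear g" unfolding g_def using linear inj inj_linear_imp_inv_linear by blast
  have gn: "linear (g ^^ n)" for n
    by (induction n) (auto simp: linear_id linear_compose[OF _ g, unfolded o_def] simp flip: id_def)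
  have fg: "(\<phi> ^^ n) ((g ^^ n) x) = x" for n x
  proof (induction n)
    case (Suc n)
    have "\<phi> (g y) = y" for y unfolding g_def using bij by (simp add: bij_is_surj surj_f_inv_f)
    moreover have "(\<phi> ^^ Suc n) z = (\<phi> ^^ n) (\<phi> z)" for z by (simp add: funpow_swap1)
    ultimately show ?case using Suc by simp
  qed simp
  have "(\<lambda>n. \<Sum>b\<in>Basis. norm ((g ^^ n) b)) \<longlonglongrightarrow> (\<Sum>b\<in>(Basis :: (real^'n) set). 0)"
    unfolding g_def by (intro tendsto_sum tendsto_norm_zero inverse_powers_tendsto_0)
  then have "(\<lambda>n. \<bar>R\<bar> * (\<Sum>b\<in>Basis. norm ((g ^^ n) b))) \<longlonglongrightarrow> \<bar>R\<bar> * 0"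
    by (intro tendsto_mult) auto
  then have "eventually (\<lambda>n. \<bar>R\<bar> * (\<Sum>b\<in>Basis. norm ((g ^^ n) b)) < \<delta>) sequentially"
    using assms by (intro order_tendstoD(2)) auto
  then show ?thesis
  proof eventually_elim
    case (elim n)
    show ?case
    proof
      fix x :: "real ^ 'n" assume x: "x \<in> ball 0 R"
      have "norm ((g ^^ n) x) = norm (\<Sum>b\<in>Basis. (x \<bullet> b) *\<^sub>R (g ^^ n) b)"
        by (metis (no_types, lifting) euclidean_representation gn linear_cmul linear_sum sum.cong)
      also have "\<dots> \<le> (\<Sum>b\<in>Basis. norm ((x \<bullet> b) *\<^sub>R (g ^^ n) b))" by (rule norm_sum)
      also have "\<dots> \<le> (\<Sum>b\<in>Basis. \<bar>R\<bar> * norm ((g ^^ n) b))"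
      proof (rule sum_mono)
        fix b :: "real ^ 'n" assume b: "b \<in> Basis"
        have "\<bar>x \<bullet> b\<bar> \<le> \<bar>R\<bar>" using Basis_le_norm[OF b, of x] x by simp
        then show "norm ((x \<bullet> b) *\<^sub>R (g ^^ n) b) \<le> \<bar>R\<bar> * norm ((g ^^ n) b)"
          by (simp add: mult_right_mono)
      qed
      also have "\<dots> < \<delta>" using elim by (simp add: sum_distrib_left)
      finally show "x \<in> (\<phi> ^^ n) ` ball 0 \<delta>"
        by (intro image_eqI[of _ _ "(g ^^ n) x"]) (auto simp: fg)
    qed
  qed
qed

end

section \<open>Volume, thick boundaries and cells\<close>

abbreviation vol :: "(real ^ 'n) set \<Rightarrow> real" where
  "vol \<equiv> measure lebesgue"

definition translate :: "'a::plus \<Rightarrow> 'a set \<Rightarrow> 'a set" where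
  "translate x A = (\<lambda>a. a + x) ` A"

lemma mem_translate: "y \<in> translate x A \<longleftrightarrow> y - x \<in> A" for x :: "'a :: ab_group_add"
  unfolding translate_def by (auto simp: image_iff) (metis diff_add_cancel)

lemma translate_0 [simp]: "translate (0 :: 'a :: ab_group_add) A = A"
  by (auto simp: mem_translate)

lemma translate_translate: "translate x (translate y A) = translate (x + y) A" for x :: "'a :: ab_group_add"
  by (auto simp: mem_translate algebra_simps)

lemma translate_eq_plus_image: "translate x A = (+) x ` A" for x :: "'a :: ab_group_add"
  unfolding translate_def by (auto simp: add.commute)

lemma image_translate_linear: "linear f \<Longrightarrow> f ` translate x A = translate (f x) (f ` A)"
  unfolding translate_def by (force simp: linear_add)

lemma vol_translate [simp]: "vol (translate x A) = vol A"
  unfolding translate_eq_plus_image by (rule measure_translation)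

definition bmeas :: "(real ^ 'n) set \<Rightarrow> bool" where
  "bmeas E \<longleftrightarrow> bounded E \<and> E \<in> lmeasurable"

lemma bmeas_iff: "bmeas E \<longleftrightarrow> bounded E \<and> E \<in> sets lebesgue"
  unfolding bmeas_def using bounded_set_imp_lmeasurable fmeasurableD by blast

lemma bmeas_translate [simp]: "bmeas (translate x A) \<longleftrightarrow> bmeas A"
proof -
  have *: "bmeas A \<Longrightarrow> bmeas (translate x A)" for x A
    unfolding bmeas_def translate_eq_plus_image by (simp add: measurable_translation bounded_translation)
  show ?thesis using *[of A x] *[of "translate x A" "-x"] by (auto simp: translate_translate)
qed

lemma bmeas_empty [simp]: "bmeas {}" by (simp add: bmeas_def)

lemma bmeas_Un [simp]: "bmeas A \<Longrightarrow> bmeas B \<Longrightarrow> bmeas (A \<union> B)"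
  by (auto simp: bmeas_iff)

lemma bmeas_Diff [simp]: "bmeas A \<Longrightarrow> bmeas B \<Longrightarrow> bmeas (A - B)"
  by (auto simp: bmeas_iff)

lemma bmeas_Int: "bmeas A \<Longrightarrow> B \<in> sets lebesgue \<Longrightarrow> bmeas (A \<inter> B)"
  by (auto simp: bmeas_iff bounded_Int)

lemma bmeas_UN: "finite I \<Longrightarrow> (\<And>i. i \<in> I \<Longrightarrow> bmeas (F i)) \<Longrightarrow> bmeas (\<Union>i\<in>I. F i)"
  by (induction I rule: finite_induct) auto

lemma borel_linear_image:
  fixes f :: "real ^ 'n \<Rightarrow> real ^ 'n"
  assumes "linear f" "bij f" "A \<in> sets borel"
  shows "f ` A \<in> sets borel"
proof -
  have "linear (inv f)" using assms by (simp add: bij_is_inj inj_linear_imp_inv_linear)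
  then have "inv f \<in> borel_measurable borel"
    by (intro borel_measurable_continuous_onI linear_continuous_on) (simp add: linear_linear)
  then have "inv f -` A \<inter> space borel \<in> sets borel" using assms(3) by (rule measurable_sets)
  moreover have "inv f -` A = f ` A" using assms(2) by (simp add: bij_vimage_eq_inv_image bij_imp_bij_inv inv_inv_eq)
  ultimately show ?thesis by simp
qed

text \<open>Borel sets are singled out because their images under linear bijections are again Borel,
  being preimages under the continuous inverse.\<close>

definition bborel :: "(real ^ 'n) set \<Rightarrow> bool" where
  "bborel E \<longleftrightarrow> bounded E \<and> E \<in> sets borel"

lemma bborel_bmeas: "bborel E \<Longrightarrow> bmeas E"
  by (auto simp: bborel_def bmeas_iff)

lemma bborel_linear_image: "linear f \<Longrightarrow> bij f \<Longrightarrow> bborel A \<Longrightarrow> bborel (f ` A)"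
  for f :: "real ^ 'n \<Rightarrow> real ^ 'n"
  by (simp add: bborel_def borel_linear_image bounded_linear_image linear_linear)

text \<open>The library computes the volume of a linear image only for a well-ordered index type of the
  coordinates, so we pass to a well-ordered copy of the index type.\<close>

typedef 'n ordered_copy = "UNIV :: 'n set" by simp

definition ordered_copy_code :: "'n::finite ordered_copy \<Rightarrow> nat" where
  "ordered_copy_code = (SOME f. inj f) \<circ> Rep_ordered_copy"

lemma inj_ordered_copy_code: "inj (ordered_copy_code :: 'n::finite ordered_copy \<Rightarrow> nat)"
proof -
  have "\<exists>f :: 'n \<Rightarrow> nat. inj f" using finite_imp_inj_to_nat_seg[of "UNIV :: 'n set"] by auto
  then have "inj (SOME f :: 'n \<Rightarrow> nat. inj f)" by (rule someI_ex)
  moreover have "inj (Rep_ordered_copy :: 'n ordered_copy \<Rightarrow> 'n)"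
    by (simp add: inj_def Rep_ordered_copy_inject)
  ultimately show ?thesis unfolding ordered_copy_code_def by (rule inj_compose)
qed

instantiation ordered_copy :: (finite) "{finite, wellorder}"
begin

definition less_eq_ordered_copy :: "'a ordered_copy \<Rightarrow> 'a ordered_copy \<Rightarrow> bool" where
  "x \<le> y \<longleftrightarrow> ordered_copy_code x \<le> ordered_copy_code y"

definition less_ordered_copy :: "'a ordered_copy \<Rightarrow> 'a ordered_copy \<Rightarrow> bool" where
  "x < y \<longleftrightarrow> ordered_copy_code x < ordered_copy_code y"

instance
proof
  have "x \<in> range Abs_ordered_copy" for x :: "'a ordered_copy"
    by (rule range_eqI[of _ _ "Rep_ordered_copy x"]) (simp add: Rep_ordered_copy_inverse)
  then have "(UNIV :: 'a ordered_copy set) \<subseteq> range Abs_ordered_copy" by blast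
  then show "finite (UNIV :: 'a ordered_copy set)" by (rule finite_subset) simp
  fix x y z :: "'a ordered_copy"
  show "x < y \<longleftrightarrow> x \<le> y \<and> \<not> y \<le> x" "x \<le> x" "x \<le> y \<or> y \<le> x"
    by (auto simp: less_eq_ordered_copy_def less_ordered_copy_def)
  show "x \<le> z" if "x \<le> y" "y \<le> z" using that by (simp add: less_eq_ordered_copy_def)
  show "x = y" if "x \<le> y" "y \<le> x"
    using that by (intro injD[OF inj_ordered_copy_code]) (simp add: less_eq_ordered_copy_def)
  fix P :: "'a ordered_copy \<Rightarrow> bool" and a
  assume step: "\<And>x. (\<And>y. y < x \<Longrightarrow> P y) \<Longrightarrow> P x"
  show "P a"
  proof (rule measure_induct_rule[of ordered_copy_code P a])
    fix x :: "'a ordered_copy"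
    assume "\<And>y. ordered_copy_code y < ordered_copy_code x \<Longrightarrow> P y"
    then show "P x" by (rule step[OF _]) (simp only: less_ordered_copy_def)
  qed
qed

end

lemma prod_Basis_vec:
  fixes g :: "real ^ 'n \<Rightarrow> 'b::comm_monoid_mult"
  shows "(\<Prod>b\<in>Basis. g b) = (\<Prod>i\<in>UNIV. g (axis i 1))"
proof -
  let ?e = "\<lambda>i. axis i 1 :: real ^ 'n"
  have "Basis = range ?e" by (auto simp: Basis_vec_def)
  then have "prod g Basis = prod g (range ?e)" by (rule arg_cong)
  also have "\<dots> = prod (g \<circ> ?e) UNIV"
    by (rule prod.reindex) (auto simp: inj_on_def axis_eq_axis)
  finally show ?thesis by (simp add: o_def)
qed

text \<open>Boxes determine Lebesgue measure, and relabelling the coordinates carries a box to a box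
  with the same side lengths.\<close>

lemma distr_lborel_reindex:
  fixes \<pi> :: "'m::finite \<Rightarrow> 'n::finite"
  assumes "bij \<pi>"
  shows "distr lborel borel (\<lambda>x :: real ^ 'n. \<chi> j. x $ \<pi> j) = lborel"
proof (rule lborel_eqI[symmetric])
  let ?P = "\<lambda>x :: real ^ 'n. \<chi> j. x $ \<pi> j"
  have "linear ?P" by (rule linearI) (auto simp: vec_eq_iff)
  then have m: "?P \<in> borel_measurable borel"
    by (intro borel_measurable_continuous_onI linear_continuous_on) (simp add: linear_linear)
  fix l u :: "real ^ 'm" assume lu: "\<And>b. b \<in> Basis \<Longrightarrow> l \<bullet> b \<le> u \<bullet> b"
  have le: "l $ j \<le> u $ j" for j using lu[of "axis j 1"] by (simp add: inner_axis)
  define l' u' :: "real ^ 'n" where "l' = (\<chi> i. l $ inv \<pi> i)" and "u' = (\<chi> i. u $ inv \<pi> i)"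
  have \<pi>: "\<pi> (inv \<pi> i) = i" "inv \<pi> (\<pi> j) = j" for i j
    using assms by (simp_all add: bij_is_inj bij_is_surj surj_f_inv_f)
  have reindex: "(\<forall>j. R (\<pi> j) j) \<longleftrightarrow> (\<forall>i. R i (inv \<pi> i))" for R
  proof
    assume a: "\<forall>j. R (\<pi> j) j"
    show "\<forall>i. R i (inv \<pi> i)"
    proof
      fix i show "R i (inv \<pi> i)" using spec[OF a, of "inv \<pi> i"] by (simp only: \<pi>)
    qed
  next
    assume a: "\<forall>i. R i (inv \<pi> i)"
    show "\<forall>j. R (\<pi> j) j"
    proof
      fix j show "R (\<pi> j) j" using spec[OF a, of "\<pi> j"] by (simp only: \<pi>)
    qed
  qed
  have "?P -` box l u = box l' u'"
    using reindex[of "\<lambda>i j. l $ j < x $ i \<and> x $ i < u $ j" for x]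
    by (auto simp: mem_box_cart l'_def u'_def)
  then have "emeasure (distr lborel borel ?P) (box l u) = emeasure lborel (box l' u')"
    using m by (subst emeasure_distr) auto
  also have "\<dots> = (\<Prod>b\<in>Basis. (u' - l') \<bullet> b)"
    by (rule emeasure_lborel_box) (use le in \<open>auto simp: inner_axis l'_def u'_def Basis_vec_def\<close>)
  also have "(\<Prod>b\<in>Basis. (u' - l') \<bullet> b) = (\<Prod>i\<in>UNIV. (u' - l') $ i)"
    by (simp add: prod_Basis_vec inner_axis)
  also have "(\<Prod>i\<in>UNIV. (u' - l') $ i) = (\<Prod>j\<in>UNIV. (u' - l') $ \<pi> j)"
    by (rule prod.reindex_bij_betw[symmetric]) (use assms in simp)
  also have "\<dots> = (\<Prod>b\<in>Basis. (u - l) \<bullet> b)"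
    by (simp add: prod_Basis_vec inner_axis l'_def u'_def \<pi>)
  finally show "emeasure (distr lborel borel ?P) (box l u) = (\<Prod>b\<in>Basis. (u - l) \<bullet> b)" .
qed simp

text \<open>The relabellings \<open>h\<close> and \<open>k\<close> are inverse to each other and
  preserve volume, so \<open>f\<close> scales volumes exactly as its conjugate \<open>g\<close>
  does, by the modulus of the determinant of \<open>g\<close>.\<close>

lemma vol_linear_image:
  fixes f :: "real ^ 'n \<Rightarrow> real ^ 'n"
  assumes f: "linear f" "bij f"
  obtains D where "0 \<le> D" "\<And>A. bborel A \<Longrightarrow> vol (f ` A) = D * vol A"
proof
  define k :: "real ^ 'n ordered_copy \<Rightarrow> real ^ 'n" where "k y = (\<chi> i. y $ Abs_ordered_copy i)" for y
  define h :: "real ^ 'n \<Rightarrow> real ^ 'n ordered_copy" where "h x = (\<chi> j. x $ Rep_ordered_copy j)" for x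
  define g where "g = h \<circ> f \<circ> k"
  have kh [simp]: "k (h x) = x" and hk [simp]: "h (k y) = y" for x y
    by (auto simp: k_def h_def vec_eq_iff Abs_ordered_copy_inverse Rep_ordered_copy_inverse)
  have k: "linear k" by (rule linearI) (auto simp: k_def vec_eq_iff)
  have h: "linear h" by (rule linearI) (auto simp: h_def vec_eq_iff)
  have g: "linear g" unfolding g_def by (intro linear_compose k h f)
  have mk: "k \<in> borel_measurable borel"
    using k by (intro borel_measurable_continuous_onI linear_continuous_on) (simp add: linear_linear)
  have "bij (Abs_ordered_copy :: 'n \<Rightarrow> _)"
    by (metis UNIV_I Abs_ordered_copy_inverse Rep_ordered_copy_inverse bijI')
  then have dk: "distr lborel borel k = lborel"
    unfolding k_def[abs_def] by (rule distr_lborel_reindex)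
  have vk: "vol (k -` A) = vol A" "k -` A \<in> sets borel" if "A \<in> sets borel" for A
  proof -
    show b: "k -` A \<in> sets borel" using measurable_sets[OF mk that] by simp
    have "measure lborel (k -` A) = measure (distr lborel borel k) A"
      using mk that by (subst measure_distr) auto
    then show "vol (k -` A) = vol A" using b that by (simp add: dk)
  qed
  show "0 \<le> \<bar>det (matrix g)\<bar>" by simp
  fix A :: "(real ^ 'n) set" assume A: "bborel A"
  have "k -` A = h ` A" by (auto simp: image_iff) (metis hk)
  then have "bounded (k -` A)"
    using A h by (simp add: bborel_def bounded_linear_image linear_linear)
  then have kA: "k -` A \<in> lmeasurable"
    using vk(2)[of A] A by (intro bounded_set_imp_lmeasurable) (auto simp: bborel_def)
  have "k -` (f ` A) = g ` (k -` A)"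
  proof safe
    fix x a assume "k x = f a" "a \<in> A"
    then have "x = g (h a)" "h a \<in> k -` A" using hk[of x] by (auto simp: g_def)
    then show "x \<in> g ` (k -` A)" by blast
  qed (auto simp: g_def)
  then have "vol (f ` A) = vol (g ` (k -` A))"
    using vk(1)[of "f ` A"] A borel_linear_image[OF f] by (simp add: bborel_def)
  also have "\<dots> = \<bar>det (matrix g)\<bar> * vol A"
    using vk(1)[of A] A by (simp add: measure_linear_image[OF g kA] bborel_def)
  finally show "vol (f ` A) = \<bar>det (matrix g)\<bar> * vol A" .
qed

lemma vol_mono: "A \<subseteq> B \<Longrightarrow> bmeas A \<Longrightarrow> bmeas B \<Longrightarrow> vol A \<le> vol B"
  by (rule measure_mono_fmeasurable) (auto simp: bmeas_def dest: fmeasurableD)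

lemma vol_Un_le: "bmeas A \<Longrightarrow> bmeas B \<Longrightarrow> vol (A \<union> B) \<le> vol A + vol B"
  by (rule measure_Un_le) (auto simp: bmeas_iff)

lemma vol_Un_disjoint: "bmeas A \<Longrightarrow> bmeas B \<Longrightarrow> A \<inter> B = {} \<Longrightarrow> vol (A \<union> B) = vol A + vol B"
  unfolding bmeas_def by (intro measure_Un2[THEN trans]) (auto simp: Diff_triv Int_commute)

section \<open>Thick boundaries\<close>

lemma open_thick_boundary: "open (thick_boundary L A)"
proof -
  have "{t. ball t L \<inter> B \<noteq> {}} = (\<Union>b\<in>B. ball b L)" for B :: "(real ^ 'a) set"
    by (auto simp: dist_commute)
  then have "open {t. ball t L \<inter> B \<noteq> {}}" for B :: "(real ^ 'a) set" by auto
  moreover have "thick_boundary L A = {t. ball t L \<inter> A \<noteq> {}} \<inter> {t. ball t L \<inter> - A \<noteq> {}}"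
    by (auto simp: thick_boundary_def)
  ultimately show ?thesis by (simp add: open_Int)
qed

lemma bounded_thick_boundary:
  assumes "bounded A" shows "bounded (thick_boundary L A)"
proof -
  obtain K where K: "\<And>a. a \<in> A \<Longrightarrow> norm a \<le> K" using assms by (auto simp: bounded_iff)
  have "norm t \<le> K + L" if t: "t \<in> thick_boundary L A" for t
  proof -
    obtain a where a: "a \<in> A" "dist t a < L" using t by (auto simp: thick_boundary_def)
    then show ?thesis using K[OF a(1)] norm_triangle_sub[of t a] by (simp add: dist_norm)
  qed
  then show ?thesis unfolding bounded_iff by blast
qed

lemma bmeas_thick_boundary [simp]: "bmeas A \<Longrightarrow> bmeas (thick_boundary L A)"
  using open_thick_boundary[of L A] bounded_thick_boundary[of A L]
  by (auto simp: bmeas_def intro: lmeasurable_open)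

lemma thick_boundary_translate [simp]:
  "thick_boundary L (translate x A) = translate x (thick_boundary L A)"
proof -
  have 1: "(ball t L \<inter> translate x B \<noteq> {}) \<longleftrightarrow> (ball (t - x) L \<inter> B \<noteq> {})" for t and B :: "(real^'a) set"
  proof
    assume "ball t L \<inter> translate x B \<noteq> {}"
    then obtain b where "b \<in> B" "dist t (b + x) < L" by (auto simp: translate_def)
    then have "b \<in> ball (t - x) L \<inter> B" by (simp add: dist_norm algebra_simps)
    then show "ball (t - x) L \<inter> B \<noteq> {}" by blast
  next
    assume "ball (t - x) L \<inter> B \<noteq> {}"
    then obtain b where "b \<in> B" "dist (t - x) b < L" by auto
    then have "b + x \<in> ball t L \<inter> translate x B" by (simp add: dist_norm algebra_simps translate_def)
    then show "ball t L \<inter> translate x B \<noteq> {}" by blast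
  qed
  have "- translate x A = translate x (- A)" by (auto simp: mem_translate)
  then have "y \<in> thick_boundary L (translate x A) \<longleftrightarrow> y \<in> translate x (thick_boundary L A)" for y
    using 1[of y A] 1[of y "- A"] by (simp only: mem_translate thick_boundary_def mem_Collect_eq)
  then show ?thesis by blast
qed

lemma thick_boundary_Diff: "thick_boundary L (A - B) \<subseteq> thick_boundary L A \<union> thick_boundary L B"
  by (auto simp: thick_boundary_def)

lemma thick_boundary_mono:
  assumes "L \<le> L'" shows "thick_boundary L A \<subseteq> thick_boundary L' A"
proof
  fix t assume t: "t \<in> thick_boundary L A"
  have "ball t L \<subseteq> ball t L'" using assms by (rule subset_ball)
  then have "ball t L' \<inter> C \<noteq> {}" if "ball t L \<inter> C \<noteq> {}" for C using that by blast
  with t show "t \<in> thick_boundary L' A" unfolding thick_boundary_def mem_Collect_eq by metis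
qed

text \<open>A displacement shorter than \<open>L\<close> in the image comes from one shorter than
  \<open>\<delta>\<close>. For strongly expanding \<open>f\<close> this \<open>\<delta>\<close> may
  be tiny, which makes the thick boundaries of large cells relatively small.\<close>

lemma thick_boundary_linear_image:
  assumes f: "linear f" "bij f" and sub: "ball 0 L \<subseteq> f ` ball 0 \<delta>"
  shows "thick_boundary L (f ` A) \<subseteq> f ` thick_boundary \<delta> A"
proof
  fix t assume t: "t \<in> thick_boundary L (f ` A)"
  obtain u where u: "t = f u" using f(2) by (metis bij_pointE)
  have *: "ball u \<delta> \<inter> C \<noteq> {}" if "ball t L \<inter> f ` C \<noteq> {}" for C
  proof -
    from that obtain z where "z \<in> ball t L" "z \<in> f ` C" by blast
    then obtain c where c: "c \<in> C" "dist t (f c) < L" by auto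
    then have "f c - t \<in> ball 0 L" by (simp add: dist_norm norm_minus_commute)
    with sub obtain w where w: "norm w < \<delta>" "f c - t = f w" by auto
    then have "f (c - u) = f w" using f(1) u by (simp add: linear_diff)
    then have "c - u = w" using f(2) by (simp add: bij_is_inj inj_eq)
    then have "c \<in> ball u \<delta>" using w(1) by (simp add: dist_norm norm_minus_commute[of u c])
    then show ?thesis using c(1) by blast
  qed
  have "- f ` A = f ` (- A)" using f(2) by (rule bij_image_Compl_eq[symmetric])
  then have "u \<in> thick_boundary \<delta> A" using t *[of A] *[of "-A"] by (simp add: thick_boundary_def)
  then show "t \<in> f ` thick_boundary \<delta> A" using u by blast
qed

text \<open>The thick boundaries of widths \<open>1 / (n + 1)\<close> decrease to a part of the
  frontier, a null set, so continuity from above sends their volumes to 0.\<close>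

lemma small_thick_boundary:
  assumes A: "bmeas A" "negligible (frontier A)" and e: "0 < e"
  shows "\<exists>\<delta>>0. vol (thick_boundary \<delta> A) < e"
proof -
  define S where "S n = thick_boundary (1 / real (Suc n)) A" for n
  have "(\<lambda>n. measure lebesgue (S n)) \<longlonglongrightarrow> measure lebesgue (\<Inter>i. S i)"
  proof (rule Lim_measure_decseq)
    have S: "S i \<in> lmeasurable" for i
      using bmeas_thick_boundary[OF A(1)] unfolding S_def bmeas_def by blast
    show "range S \<subseteq> sets lebesgue" using S fmeasurableD by blast
    show "emeasure lebesgue (S i) \<noteq> \<infinity>" for i
      using fmeasurableD2[OF S] by simp
    show "decseq S" unfolding S_def decseq_def
      by (intro allI impI thick_boundary_mono) (auto simp: field_simps)
  qed
  moreover have "(\<Inter>i. S i) \<subseteq> frontier A"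
  proof
    fix x assume x: "x \<in> (\<Inter>i. S i)"
    have *: "x \<in> closure C" if C: "\<And>i. ball x (1 / real (Suc i)) \<inter> C \<noteq> {}" for C
      unfolding closure_approachable
    proof (intro allI impI)
      fix d :: real assume "0 < d"
      then obtain i where i: "1 / real (Suc i) < d" using nat_approx_posE by blast
      obtain y where "y \<in> ball x (1 / real (Suc i))" "y \<in> C" using C[of i] by blast
      then show "\<exists>y\<in>C. dist y x < d" using i by (intro bexI[of _ y]) (auto simp: dist_commute)
    qed
    have "x \<in> thick_boundary (1 / real (Suc i)) A" for i using x by (simp add: S_def)
    then have "x \<in> closure A" "x \<in> closure (- A)"
      using *[of A] *[of "- A"] unfolding thick_boundary_def by auto
    then show "x \<in> frontier A" by (simp add: frontier_closures)
  qed
  then have "negligible (\<Inter>i. S i)" using A(2) negligible_subset by blast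
  then have "measure lebesgue (\<Inter>i. S i) = 0" by (simp add: negligible_imp_measure0)
  ultimately have "eventually (\<lambda>n. vol (S n) < e) sequentially"
    using e by (intro order_tendstoD(2)) auto
  then obtain n where "vol (S n) < e" by (auto simp: eventually_sequentially)
  then show ?thesis unfolding S_def by (intro exI[of _ "1 / real (Suc n)"]) auto
qed

text \<open>Half-open, so that the translates by grid points partition the space without
  overlap.\<close>

definition cube :: "real \<Rightarrow> (real ^ 'n) set" where
  "cube s = {x. \<forall>i. 0 \<le> x $ i \<and> x $ i < s}"

lemma convex_cube: "convex (cube s)"
proof (rule convexI)
  fix x y :: "real ^ 'a" and u v :: real
  assume "x \<in> cube s" "y \<in> cube s" and uv: "0 \<le> u" "0 \<le> v" "u + v = 1"
  then show "u *\<^sub>R x + v *\<^sub>R y \<in> cube s"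
    using convex_bound_lt[of _ s _ u v] by (simp add: cube_def)
qed

lemma cube_between: "box 0 (\<chi> i. s) \<subseteq> cube s" "cube s \<subseteq> cbox 0 (\<chi> i. s)"
  by (auto simp: cube_def mem_box_cart less_imp_le)

lemma bborel_cube [simp]: "bborel (cube s :: (real ^ 'n) set)"
proof -
  let ?C = "cube s :: (real ^ 'n) set"
  have "bounded ?C" using cube_between(2)[of s] bounded_cbox bounded_subset by blast
  moreover have "(\<Inter>i. {x :: real ^ 'n. 0 \<le> x $ i} \<inter> {x. x $ i < s}) \<in> sets borel"
    by (intro sets.finite_INT sets.Int borel_closed borel_open closed_Collect_le open_Collect_less
        continuous_intros) auto
  moreover have "?C = (\<Inter>i. {x. 0 \<le> x $ i} \<inter> {x. x $ i < s})" by (auto simp: cube_def)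
  ultimately show ?thesis by (simp only: bborel_def)
qed

lemma bmeas_cube [simp]: "bmeas (cube s)"
  by (simp add: bborel_bmeas)

lemma vol_pos_if_interior:
  assumes "bmeas A" "interior A \<noteq> {}"
  shows "0 < vol A"
proof -
  have "\<not> negligible A"
    using assms(2) open_not_negligible[of "interior A"] negligible_subset[of A "interior A"] interior_subset
    by auto
  then have "vol A \<noteq> 0" using assms(1) negligible_iff_measure0 unfolding bmeas_def by blast
  then show ?thesis by (simp add: less_le)
qed

lemma vol_cube_pos: "0 < s \<Longrightarrow> 0 < vol (cube s :: (real ^ 'n) set)"
proof (rule vol_pos_if_interior)
  assume s: "0 < s"
  have "(\<chi> i. s / 2) \<in> (box 0 (\<chi> i. s) :: (real ^ 'n) set)" using s by (simp add: mem_box_cart)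
  then show "interior (cube s :: (real ^ 'n) set) \<noteq> {}"
    using interior_maximal[OF cube_between(1)[of s] open_box] by blast
qed simp

text \<open>Counting points of a locally finite set and measuring a set of hitting times are both of
  this kind, so one mean theorem serves patch frequencies and densities of events.\<close>

definition additive_on_bounded :: "((real ^ 'n) set \<Rightarrow> real) \<Rightarrow> bool" where
  "additive_on_bounded N \<longleftrightarrow> (\<forall>E. bmeas E \<longrightarrow> 0 \<le> N E) \<and>
     (\<forall>E F. bmeas E \<longrightarrow> bmeas F \<longrightarrow> E \<inter> F = {} \<longrightarrow> N (E \<union> F) = N E + N F)"

lemma additive_on_bounded_vol: "additive_on_bounded vol"
  by (auto simp: additive_on_bounded_def vol_Un_disjoint)

context
  fixes N :: "(real ^ 'n) set \<Rightarrow> real"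
  assumes N: "additive_on_bounded N"
begin

lemma additive_nonneg: "bmeas E \<Longrightarrow> 0 \<le> N E"
  using N by (simp add: additive_on_bounded_def)

lemma additive_Un: "bmeas E \<Longrightarrow> bmeas F \<Longrightarrow> E \<inter> F = {} \<Longrightarrow> N (E \<union> F) = N E + N F"
  using N by (simp add: additive_on_bounded_def)

lemma additive_empty: "N {} = 0"
  using additive_Un[of "{}" "{}"] by simp

lemma additive_Diff: "bmeas E \<Longrightarrow> bmeas F \<Longrightarrow> F \<subseteq> E \<Longrightarrow> N (E - F) = N E - N F"
  using additive_Un[of "E - F" F] by (simp add: Un_absorb2 inf_commute)

lemma additive_mono: "bmeas E \<Longrightarrow> bmeas F \<Longrightarrow> F \<subseteq> E \<Longrightarrow> N F \<le> N E"
  using additive_Diff[of E F] additive_nonneg[of "E - F"] by simp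

lemma additive_UN:
  "finite I \<Longrightarrow> (\<And>i. i \<in> I \<Longrightarrow> bmeas (F i)) \<Longrightarrow> (\<And>i j. i \<in> I \<Longrightarrow> j \<in> I \<Longrightarrow> i \<noteq> j \<Longrightarrow> F i \<inter> F j = {})
    \<Longrightarrow> N (\<Union>i\<in>I. F i) = (\<Sum>i\<in>I. N (F i))"
proof (induction I rule: finite_induct)
  case (insert i I)
  have "N (F i \<union> (\<Union>j\<in>I. F j)) = N (F i) + N (\<Union>j\<in>I. F j)"
    using insert by (intro additive_Un bmeas_UN) auto
  then show ?case using insert by simp
qed (simp add: additive_empty)

end

section \<open>Partition of space into cells\<close>

definition grid_point :: "real \<Rightarrow> int ^ 'n \<Rightarrow> real ^ 'n" where
  "grid_point s v = (\<chi> i. s * of_int (v $ i))"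

text \<open>Taking floors recovers the grid vector, so each point lies in exactly one cell; covering
  and disjointness both follow from this.\<close>

lemma grid_cell_iff:
  assumes "0 < s"
  shows "x \<in> translate (grid_point s v) (cube s) \<longleftrightarrow> v = (\<chi> i. \<lfloor>x $ i / s\<rfloor>)"
proof -
  have "x \<in> translate (grid_point s v) (cube s) \<longleftrightarrow> (\<forall>i. of_int (v $ i) \<le> x $ i / s \<and> x $ i / s < of_int (v $ i) + 1)"
    using assms by (simp add: mem_translate cube_def grid_point_def field_simps)
  also have "\<dots> \<longleftrightarrow> (\<forall>i. \<lfloor>x $ i / s\<rfloor> = v $ i)"
    by (simp add: floor_eq_iff)
  also have "\<dots> \<longleftrightarrow> v = (\<chi> i. \<lfloor>x $ i / s\<rfloor>)" by (auto simp: vec_eq_iff)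
  finally show ?thesis .
qed

lemma finite_grid_cells_meeting_bounded:
  fixes E :: "(real ^ 'n) set"
  assumes "0 < s" "bounded E"
  shows "finite {v. translate (grid_point s v) (cube s) \<inter> E \<noteq> {}}"
proof -
  obtain K where K: "\<And>x. x \<in> E \<Longrightarrow> norm x \<le> K" using assms(2) by (auto simp: bounded_iff)
  define I where "I = {\<lfloor>- (K / s)\<rfloor>..\<lfloor>K / s\<rfloor>}"
  have I: "\<lfloor>x $ i / s\<rfloor> \<in> I" if "x \<in> E" for x i
  proof -
    have "\<bar>x $ i\<bar> \<le> K" using K[OF that] component_le_norm_cart[of x i] by linarith
    then have "x $ i / s \<le> K / s" "- (K / s) \<le> x $ i / s"
      using assms(1) by (auto simp: field_simps)
    then show ?thesis unfolding I_def by (simp only: atLeastAtMost_iff floor_mono simp_thms)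
  qed
  have "{v. translate (grid_point s v) (cube s) \<inter> E \<noteq> {}} \<subseteq> vec_lambda ` (UNIV \<rightarrow>\<^sub>E I)"
  proof
    fix v assume "v \<in> {v. translate (grid_point s v) (cube s) \<inter> E \<noteq> {}}"
    then obtain x where x: "x \<in> E" "x \<in> translate (grid_point s v) (cube s)" by blast
    then have "v $ i \<in> I" for i using I[OF x(1), of i] grid_cell_iff[OF assms(1), of x v] by simp
    then have "vec_nth v \<in> UNIV \<rightarrow>\<^sub>E I" by auto
    then show "v \<in> vec_lambda ` (UNIV \<rightarrow>\<^sub>E I)" by (intro image_eqI[of _ _ "vec_nth v"]) simp_all
  qed
  then show ?thesis by (rule finite_subset) (intro finite_imageI finite_PiE, auto simp: I_def)
qed

text \<open>\<open>E\<close> lies between the union of the cells inside it and the union of the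
  cells meeting it, and the difference is absorbed by a thick boundary. The width \<open>L\<close>
  depends on the shape of the cell alone, so it serves every \<open>N\<close>, \<open>a\<close> and
  \<open>E\<close>.\<close>

lemma cell_estimates:
  fixes f :: "real ^ 'n \<Rightarrow> real ^ 'n"
  assumes f: "linear f" "bij f" and s: "0 < s"
  obtains L where "0 < L"
    "\<And>N a E. additive_on_bounded N \<Longrightarrow> 0 \<le> a \<Longrightarrow> bmeas E
       \<Longrightarrow> (\<And>z. a * vol (f ` cube s) \<le> N (translate z (f ` cube s)))
       \<Longrightarrow> a * (vol E - vol (thick_boundary L E)) \<le> N E"
    "\<And>N a E. additive_on_bounded N \<Longrightarrow> 0 \<le> a \<Longrightarrow> bmeas E
       \<Longrightarrow> (\<And>z. N (translate z (f ` cube s)) \<le> a * vol (f ` cube s))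
       \<Longrightarrow> N E \<le> a * (vol E + vol (thick_boundary L E))"
proof -
  define Q where "Q = f ` cube s"
  have Q: "bmeas Q" unfolding Q_def using f by (intro bborel_bmeas bborel_linear_image) auto
  then obtain K where K: "\<And>x. x \<in> Q \<Longrightarrow> norm x \<le> K" by (auto simp: bmeas_def bounded_iff)
  \<comment> \<open>Twice the norm bound for \<open>Q\<close> bounds the diameter of every cell; the
    summand 1 makes that inequality strict.\<close>
  define L where "L = 2 * \<bar>K\<bar> + 1"
  define cell where "cell v = translate (f (grid_point s v)) Q" for v
  have cell: "cell v = f ` translate (grid_point s v) (cube s)" for v
    by (simp add: cell_def Q_def image_translate_linear f)
  have disj: "cell v \<inter> cell w = {}" if "v \<noteq> w" for v w
    using that f(2) by (auto simp: cell bij_def inj_eq grid_cell_iff[OF s])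
  have cover: "\<exists>v. x \<in> cell v" for x
  proof -
    obtain y where "x = f y" using f(2) by (metis bij_pointE)
    then have "x \<in> cell (\<chi> i. \<lfloor>y $ i / s\<rfloor>)" using grid_cell_iff[OF s] by (auto simp: cell)
    then show ?thesis ..
  qed
  have bcell: "bmeas (cell v)" for v using Q by (simp add: cell_def)
  have diam: "dist x y < L" if "x \<in> cell v" "y \<in> cell v" for x y v
  proof -
    have "norm (x - f (grid_point s v)) \<le> K" "norm (y - f (grid_point s v)) \<le> K"
      using that K by (auto simp: cell_def mem_translate)
    then show ?thesis using norm_triangle_ineq4[of "x - f (grid_point s v)" "y - f (grid_point s v)"]
      by (simp add: L_def dist_norm)
  qed
  have main: "\<exists>I J. finite I \<and> J \<subseteq> I \<and> E \<subseteq> (\<Union>v\<in>I. cell v) \<and> (\<Union>v\<in>J. cell v) \<subseteq> E \<and>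
      (\<Union>v\<in>I. cell v) \<subseteq> E \<union> thick_boundary L E \<and> E \<subseteq> (\<Union>v\<in>J. cell v) \<union> thick_boundary L E"
    if E: "bmeas E" for E
  proof -
    define I where "I = {v. cell v \<inter> E \<noteq> {}}"
    define J where "J = {v \<in> I. cell v \<subseteq> E}"
    define g where "g = inv f"
    have "linear g" unfolding g_def using f by (simp add: bij_is_inj inj_linear_imp_inv_linear)
    then have "bounded (g ` E)"
      using E by (simp add: bmeas_def bounded_linear_image linear_conv_bounded_linear)
    moreover have "I \<subseteq> {v. translate (grid_point s v) (cube s) \<inter> g ` E \<noteq> {}}"
    proof
      fix v assume "v \<in> I"
      then obtain x where x: "x \<in> translate (grid_point s v) (cube s)" "f x \<in> E"
        by (auto simp: I_def cell)
      then have "x \<in> g ` E" unfolding g_def using f(2)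
        by (intro image_eqI[of _ _ "f x"]) (auto simp: bij_is_inj)
      with x show "v \<in> {v. translate (grid_point s v) (cube s) \<inter> g ` E \<noteq> {}}" by blast
    qed
    ultimately have fin: "finite I"
      using finite_grid_cells_meeting_bounded[OF s] finite_subset by blast
    \<comment> \<open>A cell meeting \<open>E\<close> without being contained in it has points on
      both sides, and both are closer than \<open>L\<close> to each of its points.\<close>
    have bd: "cell v \<subseteq> thick_boundary L E" if vI: "v \<in> I" and vJ: "v \<notin> J" for v
    proof
      fix t assume t: "t \<in> cell v"
      obtain x y where "x \<in> cell v" "x \<in> E" "y \<in> cell v" "y \<notin> E" using vI vJ unfolding I_def J_def mem_Collect_eq by blast
      then have "x \<in> ball t L \<inter> E" "y \<in> ball t L \<inter> - E" using diam[OF t] by auto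
      then show "t \<in> thick_boundary L E" unfolding thick_boundary_def by blast
    qed
    show ?thesis
    proof (intro exI conjI)
      show EI: "E \<subseteq> (\<Union>v\<in>I. cell v)"
      proof
        fix x assume x: "x \<in> E"
        obtain v where "x \<in> cell v" using cover by blast
        with x show "x \<in> (\<Union>v\<in>I. cell v)" by (auto simp: I_def)
      qed
      then show "E \<subseteq> (\<Union>v\<in>J. cell v) \<union> thick_boundary L E"
        using bd by fastforce
      show "(\<Union>v\<in>J. cell v) \<subseteq> E" by (auto simp: J_def)
      then show "(\<Union>v\<in>I. cell v) \<subseteq> E \<union> thick_boundary L E" using bd by fastforce
    qed (use fin in \<open>auto simp: J_def\<close>)
  qed
  show thesis
  proof (rule that[of L])
    show "0 < L" by (simp add: L_def)
  next
    fix N :: "(real ^ 'n) set \<Rightarrow> real" and a and E :: "(real ^ 'n) set" assume N: "additive_on_bounded N" and a: "0 \<le> (a :: real)" and E: "bmeas E"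
      and z: "\<And>z. a * vol (f ` cube s) \<le> N (translate z (f ` cube s))"
    obtain I J where IJ: "finite I" "J \<subseteq> I" "(\<Union>v\<in>J. cell v) \<subseteq> E"
      "E \<subseteq> (\<Union>v\<in>J. cell v) \<union> thick_boundary L E"
      using main[OF E] by (elim exE conjE) (rule that; assumption)
    have finJ: "finite J" using IJ(2,1) by (rule finite_subset)
    have bJ: "bmeas (\<Union>v\<in>J. cell v)" using finJ bcell by (rule bmeas_UN)
    have "vol E \<le> vol ((\<Union>v\<in>J. cell v) \<union> thick_boundary L E)"
      by (rule vol_mono[OF IJ(4) E]) (rule bmeas_Un[OF bJ bmeas_thick_boundary[OF E]])
    also have "\<dots> \<le> vol (\<Union>v\<in>J. cell v) + vol (thick_boundary L E)"
      by (rule vol_Un_le[OF bJ bmeas_thick_boundary[OF E]])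
    also have "vol (\<Union>v\<in>J. cell v) = (\<Sum>v\<in>J. vol (cell v))"
      by (rule additive_UN[OF additive_on_bounded_vol finJ]) (simp_all add: bcell disj)
    finally have "vol E - vol (thick_boundary L E) \<le> (\<Sum>v\<in>J. vol (cell v))" by linarith
    then have "a * (vol E - vol (thick_boundary L E)) \<le> a * (\<Sum>v\<in>J. vol (cell v))"
      using a by (rule mult_left_mono)
    also have "\<dots> = (\<Sum>v\<in>J. a * vol Q)" by (simp add: cell_def)
    also have "\<dots> \<le> (\<Sum>v\<in>J. N (cell v))" using z by (intro sum_mono) (simp add: cell_def Q_def)
    also have "\<dots> = N (\<Union>v\<in>J. cell v)"
      by (rule additive_UN[OF N finJ, symmetric]) (simp_all add: bcell disj)
    also have "\<dots> \<le> N E" by (rule additive_mono[OF N E bJ IJ(3)])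
    finally show "a * (vol E - vol (thick_boundary L E)) \<le> N E" .
  next
    fix N :: "(real ^ 'n) set \<Rightarrow> real" and a and E :: "(real ^ 'n) set" assume N: "additive_on_bounded N" and a: "0 \<le> (a :: real)" and E: "bmeas E"
      and z: "\<And>z. N (translate z (f ` cube s)) \<le> a * vol (f ` cube s)"
    obtain I where I: "finite I" "E \<subseteq> (\<Union>v\<in>I. cell v)"
      "(\<Union>v\<in>I. cell v) \<subseteq> E \<union> thick_boundary L E"
      using main[OF E] by (elim exE conjE) (rule that; assumption)
    have bI: "bmeas (\<Union>v\<in>I. cell v)" using I(1) bcell by (rule bmeas_UN)
    have "N E \<le> N (\<Union>v\<in>I. cell v)" using additive_mono[OF N bI E I(2)] .
    also have "\<dots> = (\<Sum>v\<in>I. N (cell v))"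
      by (rule additive_UN[OF N I(1)]) (simp_all add: bcell disj)
    also have "\<dots> \<le> (\<Sum>v\<in>I. a * vol Q)" using z by (intro sum_mono) (simp add: cell_def Q_def)
    also have "\<dots> = a * (\<Sum>v\<in>I. vol (cell v))" by (simp add: cell_def)
    also have "(\<Sum>v\<in>I. vol (cell v)) = vol (\<Union>v\<in>I. cell v)"
      by (rule additive_UN[OF additive_on_bounded_vol I(1), symmetric]) (simp_all add: bcell disj)
    also have "a * \<dots> \<le> a * vol (E \<union> thick_boundary L E)"
      by (rule mult_left_mono[OF vol_mono[OF I(3) bI bmeas_Un[OF E bmeas_thick_boundary[OF E]]] a])
    also have "\<dots> \<le> a * (vol E + vol (thick_boundary L E))"
      by (rule mult_left_mono[OF vol_Un_le[OF E bmeas_thick_boundary[OF E]] a])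
    finally show "N E \<le> a * (vol E + vol (thick_boundary L E))" .
  qed
qed

section \<open>Means of additive set functions\<close>

lemma vol_linear_image_pos:
  fixes f :: "real ^ 'n \<Rightarrow> real ^ 'n"
  assumes f: "linear f" "bij f"
  obtains D where "0 < D" "\<And>A. bborel A \<Longrightarrow> vol (f ` A) = D * vol A"
proof -
  obtain D where D: "0 \<le> D" "\<And>A. bborel A \<Longrightarrow> vol (f ` A) = D * vol A"
    using vol_linear_image[OF f] by blast
  have b: "bborel (ball 0 1 :: (real ^ 'n) set)" by (simp add: bborel_def)
  have "open (f ` ball 0 1)" using f by (intro open_surjective_linear_image) (auto simp: bij_is_surj)
  then have "0 < vol (f ` ball 0 1)"
    using bborel_linear_image[OF f b] by (intro vol_pos_if_interior bborel_bmeas) (auto simp: interior_open)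
  then have "D \<noteq> 0" using D(2)[OF b] by auto
  then show thesis using D by (intro that[of D]) auto
qed

lemma bborel_translate [simp]: "bborel A \<Longrightarrow> bborel (translate x A)"
proof -
  assume A: "bborel A"
  have "(\<lambda>y. y - x) -` A \<inter> space borel \<in> sets borel"
    using A by (intro measurable_sets[of _ borel borel]) (auto simp: bborel_def)
  moreover have "(\<lambda>y. y - x) -` A = translate x A" by (auto simp: mem_translate)
  ultimately show ?thesis
    using A by (simp add: bborel_def) (simp add: translate_eq_plus_image bounded_translation)
qed

lemma bborel_Diff: "bborel A \<Longrightarrow> bborel B \<Longrightarrow> bborel (A - B)"
  by (auto simp: bborel_def)

text \<open>\<open>L\<close> and \<open>C\<close> are chosen after \<open>\<epsilon>\<close> alone,
  before \<open>E\<close>. The right-hand side does not change when \<open>E\<close> is translated,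
  which is the source of all later uniformity.\<close>

definition has_mean :: "((real ^ 'n) set \<Rightarrow> real) \<Rightarrow> real \<Rightarrow> bool" where
  "has_mean N c \<longleftrightarrow> (\<forall>\<epsilon>>0. \<exists>L>0. \<exists>C\<ge>0. \<forall>E. bmeas E \<longrightarrow>
     \<bar>N E - c * vol E\<bar> \<le> \<epsilon> * vol E + C * vol (thick_boundary L E))"

text \<open>The averaging argument freed from tiles. In the application \<open>\<psi> n\<close> is a
  power of \<open>\<phi>\<close>, \<open>\<Lambda>\<close> consists of the translations that carry a
  chosen tile into the tiling, \<open>q\<close> is a ball inside that tile, and \<open>hit\<close>
  is the relative density supplied by repetitivity.\<close>

locale hierarchy =
  fixes \<psi> :: "nat \<Rightarrow> real ^ 'n \<Rightarrow> real ^ 'n" and \<Lambda> :: "(real ^ 'n) set"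
    and s :: real and q :: "(real ^ 'n) set"
  assumes lin: "linear (\<psi> n)" and bij: "bij (\<psi> n)"
    and expand: "0 < \<delta> \<Longrightarrow> eventually (\<lambda>n. ball 0 R \<subseteq> \<psi> n ` ball 0 \<delta>) sequentially"
    and s: "0 < s" and q: "bborel q" "negligible (frontier q)" "interior q \<noteq> {}"
    and hit: "\<exists>x\<in>\<Lambda>. translate x q \<subseteq> translate z (cube s)"
begin

abbreviation Q :: "(real ^ 'n) set" where "Q \<equiv> cube s"

definition V :: "nat \<Rightarrow> real" where "V n = vol (\<psi> n ` Q)"

text \<open>The proportion of a cell occupied by one marked copy. A linear map scales all volumes by
  the same factor, so this proportion is the same at every level.\<close>

definition w :: real where "w = vol q / vol Q"

lemma vol_Q_pos: "0 < vol Q"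
  using s by (rule vol_cube_pos)

lemma w_pos: "0 < w"
  using vol_pos_if_interior[OF bborel_bmeas[OF q(1)] q(3)] vol_Q_pos by (simp add: w_def)

lemma vol_q_le: "vol q \<le> vol Q"
proof -
  obtain x where "translate x q \<subseteq> Q" using hit[of 0] by auto
  then have "vol (translate x q) \<le> vol Q"
    using q by (intro vol_mono) (auto simp: bborel_bmeas)
  then show ?thesis by simp
qed

lemma w_le_1: "w \<le> 1"
  using vol_q_le vol_Q_pos by (simp add: w_def)

lemma bmeas_image: "bborel A \<Longrightarrow> bmeas (\<psi> n ` A)"
  by (intro bborel_bmeas bborel_linear_image lin bij)

lemma
  shows V_pos: "0 < V n"
    and vol_image: "bborel A \<Longrightarrow> vol (\<psi> n ` A) = vol A * (V n / vol Q)"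
proof -
  obtain D where D: "0 < D" "\<And>A. bborel A \<Longrightarrow> vol (\<psi> n ` A) = D * vol A"
    using vol_linear_image_pos[OF lin bij] by blast
  have "V n = D * vol Q" by (simp add: V_def D)
  then show "0 < V n" "bborel A \<Longrightarrow> vol (\<psi> n ` A) = vol A * (V n / vol Q)"
    using D vol_Q_pos by auto
qed

lemma vol_image_q: "vol (\<psi> n ` translate x q) = w * V n"
  using q by (simp add: vol_image w_def)

lemma vol_image_Q: "vol (\<psi> n ` translate z Q) = V n"
  using vol_Q_pos by (simp add: vol_image)

text \<open>For large \<open>n\<close> a thick boundary at level \<open>n\<close> is covered by the
  image of a boundary of small width \<open>\<delta>\<close>. As \<open>\<delta>\<close> is chosen
  for \<open>Q\<close> and \<open>q\<close> themselves, the bound is uniform in \<open>z\<close> and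
  \<open>x\<close>.\<close>

lemma small_boundary:
  assumes "0 < \<epsilon>"
  shows "eventually (\<lambda>n. \<forall>z. vol (thick_boundary L (\<psi> n ` translate z Q)) \<le> \<epsilon> * V n \<and>
    (\<forall>x. vol (thick_boundary L (\<psi> n ` (translate z Q - translate x q))) \<le> \<epsilon> * V n)) sequentially"
proof -
  \<comment> \<open>Half of the allowance goes to the boundary of the cube and half to that of the
    removed copy of \<open>q\<close>, both relative to \<open>vol Q\<close>.\<close>
  define e where "e = \<epsilon> / 2 * vol Q"
  have e: "0 < e" using assms vol_Q_pos by (simp add: e_def)
  obtain \<delta>1 where \<delta>1: "0 < \<delta>1" "vol (thick_boundary \<delta>1 Q) < e"
    using small_thick_boundary[OF _ _ e] convex_cube negligible_convex_frontier by (metis bmeas_cube)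
  obtain \<delta>2 where \<delta>2: "0 < \<delta>2" "vol (thick_boundary \<delta>2 q) < e"
    using small_thick_boundary[OF _ _ e] q bborel_bmeas by metis
  define \<delta> where "\<delta> = min \<delta>1 \<delta>2"
  have \<delta>: "0 < \<delta>" using \<delta>1 \<delta>2 by (simp add: \<delta>_def)
  have bQ: "bborel (thick_boundary \<delta> Q)" and bq: "bborel (thick_boundary \<delta> q)"
    using q bborel_cube[of s, where ?'n = 'n]
    by (auto simp: bborel_def open_thick_boundary bounded_thick_boundary)
  have "vol (thick_boundary \<delta> Q) \<le> vol (thick_boundary \<delta>1 Q)"
    by (intro vol_mono thick_boundary_mono bmeas_thick_boundary) (auto simp: \<delta>_def)
  then have vQ: "vol (thick_boundary \<delta> Q) < e" using \<delta>1 by simp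
  have "vol (thick_boundary \<delta> q) \<le> vol (thick_boundary \<delta>2 q)"
    using q by (intro vol_mono thick_boundary_mono bmeas_thick_boundary) (auto simp: \<delta>_def bborel_bmeas)
  then have vq: "vol (thick_boundary \<delta> q) < e" using \<delta>2 by simp
  show ?thesis using expand[OF \<delta>, of L]
  proof eventually_elim
    case (elim n)
    have 1: "vol (thick_boundary L (\<psi> n ` A)) \<le> \<epsilon> * V n"
      if A: "bborel A" "thick_boundary \<delta> A \<subseteq> translate z (thick_boundary \<delta> Q) \<union> translate x (thick_boundary \<delta> q)"
      for A x z
    proof -
      let ?B = "translate z (thick_boundary \<delta> Q) \<union> translate x (thick_boundary \<delta> q)"
      have bB: "bborel ?B" using bQ bq bborel_translate by (auto simp: bborel_def)
      have "vol (thick_boundary L (\<psi> n ` A)) \<le> vol (\<psi> n ` ?B)"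
        using thick_boundary_linear_image[OF lin bij elim, of A] A bB
        by (intro vol_mono bmeas_thick_boundary bmeas_image) auto
      also have "\<dots> = vol ?B * (V n / vol Q)" using bB by (rule vol_image)
      also have "\<dots> \<le> (e + e) * (V n / vol Q)"
      proof (rule mult_right_mono)
        have "vol ?B \<le> vol (translate z (thick_boundary \<delta> Q)) + vol (translate x (thick_boundary \<delta> q))"
          using bQ bq by (intro vol_Un_le) (auto simp: bborel_bmeas)
        then show "vol ?B \<le> e + e" using vQ vq by simp
      qed (use V_pos[of n] vol_Q_pos in \<open>auto intro: less_imp_le\<close>)
      also have "\<dots> = \<epsilon> * V n" using vol_Q_pos by (simp add: e_def)
      finally show ?thesis .
    qed
    show ?case
    proof (intro allI conjI)
      fix z x
      show "vol (thick_boundary L (\<psi> n ` translate z Q)) \<le> \<epsilon> * V n"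
        by (rule 1[of _ z 0]) auto
      show "vol (thick_boundary L (\<psi> n ` (translate z Q - translate x q))) \<le> \<epsilon> * V n"
        by (rule 1[of _ z x]) (use q thick_boundary_Diff[of \<delta> "translate z Q" "translate x q"] in \<open>auto intro!: bborel_Diff\<close>)
    qed
  qed
qed

lemma has_mean_cells:
  assumes "has_mean N c" "0 < \<epsilon>"
  shows "eventually (\<lambda>n. \<forall>z. \<bar>N (\<psi> n ` translate z Q) - c * V n\<bar> \<le> \<epsilon> * V n) sequentially"
proof -
  obtain L C where LC: "C \<ge> 0" "\<And>E. bmeas E \<Longrightarrow>
      \<bar>N E - c * vol E\<bar> \<le> \<epsilon> / 2 * vol E + C * vol (thick_boundary L E)"
    using assms unfolding has_mean_def by (meson half_gt_zero)
  have "0 < \<epsilon> / (2 * (C + 1))" using assms(2) LC(1) by simp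
  from small_boundary[OF this, of L] show ?thesis
  proof eventually_elim
    case (elim n)
    show ?case
    proof
      fix z
      have "\<bar>N (\<psi> n ` translate z Q) - c * V n\<bar>
          \<le> \<epsilon> / 2 * V n + C * vol (thick_boundary L (\<psi> n ` translate z Q))"
        using LC(2)[OF bmeas_image, of "translate z Q" n] by (simp only: vol_image_Q bborel_translate bborel_cube)
      also have "\<dots> \<le> \<epsilon> / 2 * V n + C * (\<epsilon> / (2 * (C + 1)) * V n)"
        using elim LC(1) by (intro add_left_mono mult_left_mono) auto
      also have "\<dots> \<le> \<epsilon> / 2 * V n + \<epsilon> / 2 * V n"
        using LC(1) assms(2) V_pos[of n] by (intro add_left_mono) (simp add: field_simps)
      finally show "\<bar>N (\<psi> n ` translate z Q) - c * V n\<bar> \<le> \<epsilon> * V n" by simp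
    qed
  qed
qed

text \<open>Both means are compared on a single large cell, whose volume can be cancelled.
  Uniqueness of the mean is the symmetric case.\<close>

lemma has_mean_mono:
  fixes N N' :: "(real ^ 'n) set \<Rightarrow> real"
  assumes N: "has_mean N c" and N': "has_mean N' c'" and le: "\<And>E. bmeas E \<Longrightarrow> N E \<le> N' E"
  shows "c \<le> c'"
proof (rule field_le_epsilon)
  fix e :: real assume e: "0 < e"
  then have e2: "0 < e / 2" by simp
  obtain n where n: "\<bar>N (\<psi> n ` translate 0 Q) - c * V n\<bar> \<le> e / 2 * V n"
    "\<bar>N' (\<psi> n ` translate 0 Q) - c' * V n\<bar> \<le> e / 2 * V n"
    using eventually_happens'[OF sequentially_bot
        eventually_conj[OF has_mean_cells[OF N e2] has_mean_cells[OF N' e2]]] by blast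
  have "N (\<psi> n ` translate 0 Q) \<le> N' (\<psi> n ` translate 0 Q)"
    by (intro le bmeas_image) simp
  with n have "c * V n \<le> c' * V n + (e / 2 * V n + e / 2 * V n)" by linarith
  then have "c * V n \<le> (c' + e) * V n" by (simp add: algebra_simps)
  then show "c \<le> c' + e" using V_pos[of n] by simp
qed

lemma has_mean_unique: "has_mean (N :: (real ^ 'n) set \<Rightarrow> real) c \<Longrightarrow> has_mean N c' \<Longrightarrow> c = c'"
  using has_mean_mono[of N c N c'] has_mean_mono[of N c' N c] by auto

text \<open>Instead of limits over the level, the supremum \<open>lo\<close> of the smallest
  averages and the infimum \<open>hi\<close> of the largest ones are compared. This suffices because
  each level controls the averages over all much larger cells through the cell estimates.\<close>

theorem mean_exists:
  assumes N: "additive_on_bounded N"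
    and bdd: "\<And>n. \<exists>K. \<forall>z. N (translate z (\<psi> n ` Q)) \<le> K"
    and local: "eventually (\<lambda>n. \<forall>x\<in>\<Lambda>. N (\<psi> n ` translate x q) = a n) sequentially"
  shows "\<exists>c\<ge>0. has_mean N c"
proof -
  define r where "r n z = N (translate z (\<psi> n ` Q)) / V n" for n z
  define l where "l n = (INF z. r n z)" for n
  define u where "u n = (SUP z. r n z)" for n
  have r0: "0 \<le> r n z" for n z
    using additive_nonneg[OF N] V_pos[of n] by (simp add: r_def bmeas_image)
  have bb: "bdd_below (range (r n))" for n using r0 by (intro bdd_belowI[of _ 0]) auto
  have ba: "bdd_above (range (r n))" for n
  proof -
    obtain K where "\<And>z. N (translate z (\<psi> n ` Q)) \<le> K" using bdd by blast
    then show ?thesis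
      using V_pos[of n] by (intro bdd_aboveI[of _ "K / V n"]) (auto simp: r_def divide_right_mono)
  qed
  have l0: "0 \<le> l n" for n unfolding l_def using r0 by (intro cINF_greatest) auto
  have lr: "l n \<le> r n z" for n z unfolding l_def using bb by (intro cINF_lower) auto
  have ru: "r n z \<le> u n" for n z unfolding u_def using ba by (intro cSUP_upper) auto
  have u0: "0 \<le> u n" for n using r0[of n 0] ru[of n 0] by linarith
  have "\<exists>L>0. \<forall>E. bmeas E \<longrightarrow> l n * (vol E - vol (thick_boundary L E)) \<le> N E \<and>
      N E \<le> u n * (vol E + vol (thick_boundary L E))" for n
  proof -
    obtain L where L: "0 < L"
      "\<And>N a E. additive_on_bounded N \<Longrightarrow> 0 \<le> a \<Longrightarrow> bmeas E
         \<Longrightarrow> (\<And>z. a * vol (\<psi> n ` Q) \<le> N (translate z (\<psi> n ` Q)))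
         \<Longrightarrow> a * (vol E - vol (thick_boundary L E)) \<le> N E"
      "\<And>N a E. additive_on_bounded N \<Longrightarrow> 0 \<le> a \<Longrightarrow> bmeas E
         \<Longrightarrow> (\<And>z. N (translate z (\<psi> n ` Q)) \<le> a * vol (\<psi> n ` Q))
         \<Longrightarrow> N E \<le> a * (vol E + vol (thick_boundary L E))"
      using cell_estimates[OF lin bij s] by blast
    have "l n * vol (\<psi> n ` Q) \<le> N (translate z (\<psi> n ` Q))"
      "N (translate z (\<psi> n ` Q)) \<le> u n * vol (\<psi> n ` Q)" for z
      using lr[of n z] ru[of n z] V_pos[of n]
      by (simp_all add: r_def V_def[symmetric] pos_le_divide_eq pos_divide_le_eq)
    then show ?thesis using L N l0 u0 by metis
  qed
  then obtain L where Lpos: "\<And>n. L n > (0::real)"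
    and lo: "\<And>n E. bmeas E \<Longrightarrow> l n * (vol E - vol (thick_boundary (L n) E)) \<le> N E"
    and up: "\<And>n E. bmeas E \<Longrightarrow> N E \<le> u n * (vol E + vol (thick_boundary (L n) E))"
    by metis
  \<comment> \<open>Both bounds are tested on one cell of a level \<open>j\<close> so high that its
    boundaries of widths \<open>L n\<close> and \<open>L m\<close> have relative volume at most
    \<open>\<epsilon>\<close>.\<close>
  have lu: "l n \<le> u m" for n m
  proof (rule field_le_epsilon)
    fix e :: real assume e: "0 < e"
    define \<epsilon> where "\<epsilon> = e / (l n + u m + 1)"
    have \<epsilon>: "0 < \<epsilon>" using e l0[of n] u0[of m] by (simp add: \<epsilon>_def)
    obtain j where j: "vol (thick_boundary (L n) (\<psi> j ` translate 0 Q)) \<le> \<epsilon> * V j"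
       "vol (thick_boundary (L m) (\<psi> j ` translate 0 Q)) \<le> \<epsilon> * V j"
      using eventually_happens'[OF sequentially_bot
        eventually_conj[OF small_boundary[OF \<epsilon>, of "L n"] small_boundary[OF \<epsilon>, of "L m"]]] by blast
    let ?E = "\<psi> j ` translate 0 Q"
    have bE: "bmeas ?E" by (intro bmeas_image) simp
    have "l n * (V j - \<epsilon> * V j) \<le> l n * (vol ?E - vol (thick_boundary (L n) ?E))"
      using j l0 by (intro mult_left_mono) (simp_all add: vol_image_Q del: translate_0)
    also have "\<dots> \<le> N ?E" using bE by (rule lo)
    also have "\<dots> \<le> u m * (vol ?E + vol (thick_boundary (L m) ?E))" using bE by (rule up)
    also have "\<dots> \<le> u m * (V j + \<epsilon> * V j)"
      using j u0 by (intro mult_left_mono) (simp_all add: vol_image_Q del: translate_0)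
    finally have "(l n - l n * \<epsilon>) * V j \<le> (u m + u m * \<epsilon>) * V j" by (simp add: algebra_simps)
    then have "l n - l n * \<epsilon> \<le> u m + u m * \<epsilon>" using V_pos[of j] by simp
    then have "l n \<le> u m + (l n + u m) * \<epsilon>" by (simp add: algebra_simps)
    also have "(l n + u m) * \<epsilon> \<le> e"
      unfolding \<epsilon>_def using e l0[of n] u0[of m] by (simp add: field_simps)
    finally show "l n \<le> u m + e" by simp
  qed
  define lo where "lo = (SUP n. l n)"
  define hi where "hi = (INF n. u n)"
  have lo1: "l n \<le> lo" for n unfolding lo_def
    by (intro cSUP_upper) (auto intro!: bdd_aboveI[of _ "u 0"] lu)
  have hi1: "hi \<le> u n" for n unfolding hi_def
    by (intro cINF_lower) (auto intro!: bdd_belowI[of _ "l 0"] lu)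
  have lohi: "lo \<le> hi" unfolding lo_def hi_def
    by (intro cSUP_least cINF_greatest) (auto intro: lu)
  have lo0: "0 \<le> lo" using l0[of 0] lo1[of 0] by linarith
  have lo_approx: "\<exists>n. lo - \<epsilon> \<le> l n" if "0 < \<epsilon>" for \<epsilon>
  proof (rule ccontr)
    assume "\<not> ?thesis"
    then have "lo \<le> lo - \<epsilon>" unfolding lo_def by (intro cSUP_least) (auto simp: not_le less_imp_le)
    with that show False by simp
  qed
  have hi_approx: "\<exists>n. u n \<le> hi + \<epsilon>" if "0 < \<epsilon>" for \<epsilon>
  proof (rule ccontr)
    assume "\<not> ?thesis"
    then have "hi + \<epsilon> \<le> hi" unfolding hi_def by (intro cINF_greatest) (auto simp: not_le less_imp_le)
    with that show False by simp
  qed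
  have r_lo: "\<exists>z. r n z \<le> lo + \<epsilon>" if "0 < \<epsilon>" for n \<epsilon>
  proof (rule ccontr)
    assume "\<not> ?thesis"
    then have "lo + \<epsilon> \<le> l n" unfolding l_def by (intro cINF_greatest) (auto simp: not_le less_imp_le)
    with that lo1[of n] show False by simp
  qed
  have r_hi: "\<exists>z. hi - \<epsilon> \<le> r n z" if "0 < \<epsilon>" for n \<epsilon>
  proof (rule ccontr)
    assume "\<not> ?thesis"
    then have "u n \<le> hi - \<epsilon>" unfolding u_def by (intro cSUP_least) (auto simp: not_le less_imp_le)
    with that hi1[of n] show False by simp
  qed
  \<comment> \<open>Levels \<open>n\<close> and \<open>m\<close> that nearly attain
    \<open>lo\<close> and \<open>hi\<close> are fixed before \<open>j\<close>, which is then high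
    enough for their boundary terms and for \<open>local\<close>. The error constants
    \<open>2 + lo\<close> and \<open>2 + hi + \<epsilon>\<close> of the two bounds for
    \<open>a j\<close> add up to the bracket.\<close>
  have key: "(hi - lo) * w \<le> \<epsilon> * (4 + lo + hi + \<epsilon>)" if \<epsilon>: "0 < \<epsilon>" for \<epsilon>
  proof -
    obtain n m where n: "lo - \<epsilon> \<le> l n" and m: "u m \<le> hi + \<epsilon>"
      using lo_approx[OF \<epsilon>] hi_approx[OF \<epsilon>] by blast
    obtain j where j: "\<And>x. x \<in> \<Lambda> \<Longrightarrow> N (\<psi> j ` translate x q) = a j"
      and jn: "\<And>z x. vol (thick_boundary (L n) (\<psi> j ` (translate z Q - translate x q))) \<le> \<epsilon> * V j"
      and jm: "\<And>z x. vol (thick_boundary (L m) (\<psi> j ` (translate z Q - translate x q))) \<le> \<epsilon> * V j"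
      using eventually_happens'[OF sequentially_bot eventually_conj[OF local
        eventually_conj[OF small_boundary[OF \<epsilon>, of "L n"] small_boundary[OF \<epsilon>, of "L m"]]]] by blast
    have Vj: "0 < V j" by (rule V_pos)
    have split: "N (\<psi> j ` translate z Q) = a j + N (\<psi> j ` (translate z Q - translate x q))"
        "bmeas (\<psi> j ` (translate z Q - translate x q))"
        "vol (\<psi> j ` (translate z Q - translate x q)) = (1 - w) * V j"
      if x: "x \<in> \<Lambda>" "translate x q \<subseteq> translate z Q" for x z
    proof -
      have b: "bmeas (\<psi> j ` translate z Q)" "bmeas (\<psi> j ` translate x q)"
        using q by (auto intro!: bmeas_image)
      have e: "\<psi> j ` (translate z Q - translate x q) = \<psi> j ` translate z Q - \<psi> j ` translate x q"
        using bij by (intro image_set_diff bij_is_inj)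
      have sub: "\<psi> j ` translate x q \<subseteq> \<psi> j ` translate z Q" using x(2) by blast
      show "bmeas (\<psi> j ` (translate z Q - translate x q))" using b e by simp
      show "N (\<psi> j ` translate z Q) = a j + N (\<psi> j ` (translate z Q - translate x q))"
        using additive_Diff[OF N b sub] j[OF x(1)] e by simp
      show "vol (\<psi> j ` (translate z Q - translate x q)) = (1 - w) * V j"
        using additive_Diff[OF additive_on_bounded_vol b sub] e
        by (simp add: vol_image_Q vol_image_q algebra_simps)
    qed
    have rN: "N (\<psi> j ` translate z Q) = r j (\<psi> j z) * V j" for z
      using Vj by (simp add: r_def image_translate_linear lin)
    have psi_surj: "\<exists>z'. z = \<psi> j z'" for z using bij[of j] by (metis bij_pointE)
    \<comment> \<open>In a cell of average near \<open>lo\<close>, the part outside the marked copy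
      holds at least nearly \<open>lo * (1 - w) * V j\<close>, so little more than
      \<open>lo * w * V j\<close> is left for the copy.\<close>
    have "a j \<le> V j * (lo * w + \<epsilon> * (2 + lo))"
    proof -
      obtain z0 where "r j z0 \<le> lo + \<epsilon>" using r_lo[OF \<epsilon>] by blast
      then obtain z where z: "r j (\<psi> j z) \<le> lo + \<epsilon>" using psi_surj[of z0] by auto
      obtain x where x: "x \<in> \<Lambda>" "translate x q \<subseteq> translate z Q" using hit by blast
      let ?E = "\<psi> j ` (translate z Q - translate x q)"
      have "(lo - \<epsilon>) * ((1 - w) * V j) \<le> l n * ((1 - w) * V j)"
        using n w_le_1 Vj by (intro mult_right_mono) auto
      moreover have "l n * vol (thick_boundary (L n) ?E) \<le> lo * (\<epsilon> * V j)"
        using lo1[of n] l0[of n] jn lo0 by (intro mult_mono) auto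
      moreover have "l n * (vol ?E - vol (thick_boundary (L n) ?E)) \<le> N ?E"
        using split(2)[OF x] by (rule lo)
      ultimately have "(lo - \<epsilon>) * ((1 - w) * V j) - lo * (\<epsilon> * V j) \<le> N ?E"
        using split(3)[OF x] by (simp add: right_diff_distrib)
      moreover have "r j (\<psi> j z) * V j \<le> (lo + \<epsilon>) * V j" using z Vj by (intro mult_right_mono) auto
      ultimately have "a j \<le> (lo + \<epsilon>) * V j - ((lo - \<epsilon>) * ((1 - w) * V j) - lo * (\<epsilon> * V j))"
        using split(1)[OF x] rN[of z] by linarith
      also have "\<dots> = V j * (lo * w + \<epsilon> * (2 + lo)) - V j * (\<epsilon> * w)" by (simp add: algebra_simps)
      also have "\<dots> \<le> V j * (lo * w + \<epsilon> * (2 + lo))" using Vj \<epsilon> w_pos by simp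
      finally show ?thesis .
    qed
    \<comment> \<open>The mirror image: the part outside holds at most about
      \<open>hi * (1 - w) * V j\<close>, which forces about \<open>hi * w * V j\<close> into the
      copy.\<close>
    moreover have "V j * (hi * w - \<epsilon> * (2 + hi + \<epsilon>)) \<le> a j"
    proof -
      obtain z0 where "hi - \<epsilon> \<le> r j z0" using r_hi[OF \<epsilon>] by blast
      then obtain z where z: "hi - \<epsilon> \<le> r j (\<psi> j z)" using psi_surj[of z0] by auto
      obtain x where x: "x \<in> \<Lambda>" "translate x q \<subseteq> translate z Q" using hit by blast
      let ?E = "\<psi> j ` (translate z Q - translate x q)"
      have "N ?E \<le> u m * (vol ?E + vol (thick_boundary (L m) ?E))"
        using split(2)[OF x] by (rule up)
      also have "\<dots> \<le> (hi + \<epsilon>) * ((1 - w) * V j + \<epsilon> * V j)"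
        using m u0[of m] jm w_le_1 Vj \<epsilon> split(3)[OF x] lohi lo0
        by (intro mult_mono add_mono) auto
      finally have "N ?E \<le> (hi + \<epsilon>) * ((1 - w) * V j + \<epsilon> * V j)" .
      moreover have "(hi - \<epsilon>) * V j \<le> r j (\<psi> j z) * V j" using z Vj by (intro mult_right_mono) auto
      ultimately have "(hi - \<epsilon>) * V j - (hi + \<epsilon>) * ((1 - w) * V j + \<epsilon> * V j) \<le> a j"
        using split(1)[OF x] rN[of z] by linarith
      moreover have "(hi - \<epsilon>) * V j - (hi + \<epsilon>) * ((1 - w) * V j + \<epsilon> * V j)
          = V j * (hi * w - \<epsilon> * (2 + hi + \<epsilon>)) + V j * (\<epsilon> * w)" by (simp add: algebra_simps)
      moreover have "0 \<le> V j * (\<epsilon> * w)" using Vj \<epsilon> w_pos by simp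
      ultimately show ?thesis by linarith
    qed
    ultimately have "V j * (hi * w - \<epsilon> * (2 + hi + \<epsilon>)) \<le> V j * (lo * w + \<epsilon> * (2 + lo))" by linarith
    then have "hi * w - \<epsilon> * (2 + hi + \<epsilon>) \<le> lo * w + \<epsilon> * (2 + lo)" using Vj by simp
    then show ?thesis by (simp add: algebra_simps)
  qed
  have "hi \<le> lo"
  proof (rule ccontr)
    assume "\<not> hi \<le> lo"
    then have p: "0 < (hi - lo) * w" using w_pos by simp
    \<comment> \<open>The cap 1 bounds the bracket by \<open>5 + lo + hi\<close>; the factor 2 then
      leaves only half of \<open>(hi - lo) * w\<close> on the right.\<close>
    define \<epsilon> where "\<epsilon> = min 1 ((hi - lo) * w / (2 * (5 + lo + hi)))"
    have \<epsilon>: "0 < \<epsilon>" "\<epsilon> \<le> 1" "\<epsilon> \<le> (hi - lo) * w / (2 * (5 + lo + hi))"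
      using p lo0 lohi by (auto simp: \<epsilon>_def intro!: divide_pos_pos)
    have "(hi - lo) * w \<le> \<epsilon> * (4 + lo + hi + \<epsilon>)" using key \<epsilon>(1) .
    also have "\<dots> \<le> \<epsilon> * (5 + lo + hi)" using \<epsilon> by (intro mult_left_mono) auto
    also have "\<dots> \<le> (hi - lo) * w / (2 * (5 + lo + hi)) * (5 + lo + hi)"
      using \<epsilon> lo0 lohi by (intro mult_right_mono) auto
    also have "\<dots> = (hi - lo) * w / 2" using lo0 lohi by (simp add: field_simps)
    finally show False using p by simp
  qed
  with lohi have eq: "hi = lo" by simp
  have "\<exists>L>0. \<exists>C\<ge>0. \<forall>E. bmeas E \<longrightarrow> \<bar>N E - lo * vol E\<bar> \<le> \<epsilon> * vol E + C * vol (thick_boundary L E)"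
    if \<epsilon>: "0 < \<epsilon>" for \<epsilon> :: real
  proof -
    obtain n m where n: "lo - \<epsilon> \<le> l n" and m: "u m \<le> lo + \<epsilon>"
      using lo_approx[OF \<epsilon>] hi_approx[OF \<epsilon>] eq by blast
    let ?L = "max (L n) (L m)"
    show ?thesis
    proof (rule exI[of _ ?L], rule conjI[OF _ exI[of _ "lo + \<epsilon>"]], goal_cases)
      case 2
      have "\<bar>N E - lo * vol E\<bar> \<le> \<epsilon> * vol E + (lo + \<epsilon>) * vol (thick_boundary ?L E)"
        if E: "bmeas E" for E
      proof -
      have t: "vol (thick_boundary (L n) E) \<le> vol (thick_boundary ?L E)"
        "vol (thick_boundary (L m) E) \<le> vol (thick_boundary ?L E)"
        using E by (auto intro!: vol_mono thick_boundary_mono)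
      have "(lo - \<epsilon>) * vol E \<le> l n * vol E" using n by (intro mult_right_mono) auto
      moreover have "l n * vol (thick_boundary (L n) E) \<le> (lo + \<epsilon>) * vol (thick_boundary ?L E)"
        using lo1[of n] \<epsilon> t lo0 by (intro mult_mono) auto
      moreover have "l n * (vol E - vol (thick_boundary (L n) E)) \<le> N E" using E by (rule lo)
      ultimately have 1: "(lo - \<epsilon>) * vol E - (lo + \<epsilon>) * vol (thick_boundary ?L E) \<le> N E"
        by (simp add: right_diff_distrib)
      have "N E \<le> u m * (vol E + vol (thick_boundary (L m) E))" using E by (rule up)
      also have "\<dots> \<le> (lo + \<epsilon>) * (vol E + vol (thick_boundary ?L E))"
        using m u0[of m] t lo0 \<epsilon> by (intro mult_mono add_mono) auto
      finally have 2: "N E \<le> (lo + \<epsilon>) * (vol E + vol (thick_boundary ?L E))" .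
      from 1 2 show ?thesis by (simp add: abs_le_iff algebra_simps)
      qed
      then show ?case using lo0 \<epsilon> by simp
    qed (use Lpos[of n] in simp)
  qed
  then have "has_mean N lo" unfolding has_mean_def by blast
  with lo0 show ?thesis by blast
qed

end

section \<open>Tilings and supertiles\<close>

lemma supp_shift_tile [simp]: "supp (shift_tile x T) = translate x (supp T)"
  by (cases T) (auto simp: translate_def)

lemma shift_tile_0 [simp]: "shift_tile (0 :: 'a :: ab_group_add) T = T"
  by (cases T) auto

lemma shift_tile_shift_tile [simp]:
  "shift_tile x (shift_tile y T) = shift_tile (x + y) T" for x :: "'a :: ab_group_add"
  by (cases T) (auto simp: image_image algebra_simps)

lemma mem_shift_pattern:
  "U \<in> shift_pattern x P \<longleftrightarrow> shift_tile (- x) U \<in> P" for x :: "'a :: ab_group_add"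
  unfolding shift_pattern_def by (auto intro: image_eqI[of _ _ "shift_tile (- x) U"])

lemma shift_pattern_0 [simp]: "shift_pattern (0 :: 'a :: ab_group_add) P = P"
  by (auto simp: mem_shift_pattern)

lemma shift_pattern_shift_pattern [simp]:
  "shift_pattern x (shift_pattern y P) = shift_pattern (x + y) P" for x :: "'a :: ab_group_add"
  by (auto simp: mem_shift_pattern algebra_simps)

lemma shift_pattern_mono: "P \<subseteq> P' \<Longrightarrow> shift_pattern x P \<subseteq> shift_pattern x P'"
  by (auto simp: shift_pattern_def)

lemma shift_pattern_subset_iff:
  "shift_pattern x P \<subseteq> S \<longleftrightarrow> P \<subseteq> shift_pattern (- x) S" for x :: "'a :: ab_group_add"
  using shift_pattern_mono[of "shift_pattern x P" S "- x"] shift_pattern_mono[of P "shift_pattern (- x) S" x]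
  by auto

lemma finite_shift_pattern [simp]: "finite P \<Longrightarrow> finite (shift_pattern x P)"
  by (simp add: shift_pattern_def)

lemma shift_pattern_empty [simp]: "shift_pattern x {} = {}"
  by (simp add: shift_pattern_def)

lemma shift_pattern_singleton [simp]: "shift_pattern x {U} = {shift_tile x U}"
  by (simp add: shift_pattern_def)

lemma support_shift_pattern [simp]: "support (shift_pattern x P) = translate x (support P)"
  by (auto simp: support_def shift_pattern_def translate_def)

lemma support_mono: "P \<subseteq> P' \<Longrightarrow> support P \<subseteq> support P'"
  by (auto simp: support_def)

lemma translate_Int: "translate x (A \<inter> B) = translate x A \<inter> translate x B" for x :: "'a :: ab_group_add"
  by (auto simp: mem_translate)

lemma translate_eq_empty_iff [simp]: "translate x A = {} \<longleftrightarrow> A = {}"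
  by (simp add: translate_def)

lemma interior_translate [simp]: "interior (translate x S) = translate x (interior S)"
  for x :: "'a :: real_normed_vector"
  by (simp add: translate_eq_plus_image interior_translation)

lemma closure_translate [simp]: "closure (translate x S) = translate x (closure S)"
  for x :: "'a :: real_normed_vector"
  by (simp add: translate_eq_plus_image closure_translation)

lemma compact_translate [simp]: "compact S \<Longrightarrow> compact (translate x S)"
  for x :: "'a :: real_normed_vector"
  by (simp add: translate_eq_plus_image compact_translation)

lemma translate_ball: "translate x (ball y r) = ball (x + y) r" for x :: "'a :: real_normed_vector"
  by (auto simp: mem_translate dist_norm algebra_simps)

lemma is_tile_shift [simp]: "is_tile (shift_tile x U) \<longleftrightarrow> is_tile U"
proof -
  have *: "is_tile U \<Longrightarrow> is_tile (shift_tile x U)" for x U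
    by (simp add: is_tile_def)
  show ?thesis using *[of U x] *[of "shift_tile x U" "- x"] by auto
qed

lemma is_patch_shift [simp]: "is_patch (shift_pattern x P) \<longleftrightarrow> is_patch P"
proof -
  have *: "is_patch (shift_pattern x P)" if P: "is_patch P" for x P
    unfolding is_patch_def is_pattern_def
  proof (intro conjI ballI impI)
    fix S U assume S: "S \<in> shift_pattern x P" and U: "U \<in> shift_pattern x P" and ne: "S \<noteq> U"
    obtain S' U' where eq: "S = shift_tile x S'" "U = shift_tile x U'" "S' \<in> P" "U' \<in> P"
      using S U by (auto simp: shift_pattern_def)
    then have "S' \<noteq> U'" using ne by auto
    then have "interior (supp S') \<inter> interior (supp U') = {}"
      using P eq(3,4) unfolding is_patch_def by blast
    then show "interior (supp S) \<inter> interior (supp U) = {}"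
      unfolding eq by (simp flip: translate_Int)
  qed (use that in \<open>auto simp: is_patch_def is_pattern_def shift_pattern_def\<close>)
  show ?thesis using *[of P x] *[of "shift_pattern x P" "- x"] by auto
qed

lemma translate_UNIV [simp]: "translate x UNIV = UNIV" for x :: "'a :: ab_group_add"
  by (auto simp: mem_translate)

lemma is_tiling_shift [simp]: "is_tiling (shift_pattern x S) \<longleftrightarrow> is_tiling S"
proof -
  have "translate x A = UNIV \<longleftrightarrow> A = UNIV" for A :: "(real ^ 'a) set"
    by (metis translate_UNIV translate_translate translate_0 add.left_inverse)
  then show ?thesis by (simp add: is_tiling_def)
qed

lemma agree_on_shift:
  "agree_on K (shift_pattern x P) (shift_pattern x P') \<longleftrightarrow> agree_on (translate (- x) K) P P'"
  for x :: "'a :: ab_group_add"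
proof -
  have 1: "{U \<in> shift_pattern x P. supp U \<inter> K \<noteq> {}}
      = shift_pattern x {U \<in> P. supp U \<inter> translate (- x) K \<noteq> {}}" for P :: "('a, 'b) tile set"
  proof -
    have "translate (- x) (supp U) \<inter> translate (- x) K \<noteq> {} \<longleftrightarrow> supp U \<inter> K \<noteq> {}" for U :: "('a, 'b) tile"
      by (simp flip: translate_Int)
    then show ?thesis by (auto simp: mem_shift_pattern)
  qed
  have "shift_pattern x A = shift_pattern x C \<longleftrightarrow> A = C" for A C :: "('a, 'b) tile set"
    by (metis shift_pattern_0 shift_pattern_shift_pattern add.left_inverse)
  then show ?thesis unfolding agree_on_def 1 .
qed

lemma agree_on_subset: "agree_on K P P' \<Longrightarrow> K' \<subseteq> K \<Longrightarrow> agree_on K' P P'"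
  unfolding agree_on_def set_eq_iff mem_Collect_eq by blast

lemma agree_on_sym: "agree_on K P P' \<Longrightarrow> agree_on K P' P"
  by (simp add: agree_on_def)

lemma agree_on_trans: "agree_on K P P' \<Longrightarrow> agree_on K P' P'' \<Longrightarrow> agree_on K P P''"
  by (simp add: agree_on_def)

text \<open>A tile that meets an open set meets it in its interior, so a subpatch covering an open set
  contains all tiles meeting that set.\<close>

lemma mem_if_meets_covered_open:
  assumes S: "is_patch S" and P: "P \<subseteq> S" and U: "U \<in> S"
    and G: "open G" "G \<subseteq> support P" and meets: "supp U \<inter> G \<noteq> {}"
  shows "U \<in> P"
proof -
  have tile: "supp W = closure (interior (supp W))" if "W \<in> S" for W
    using S that by (auto simp: is_patch_def is_pattern_def is_tile_def)
  have "interior (supp U) \<inter> G \<noteq> {}"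
    using meets tile[OF U] G(1) open_Int_closure_eq_empty[of G "interior (supp U)"] by (metis inf_commute)
  then obtain y where y: "y \<in> interior (supp U) \<inter> G" by blast
  with G(2) obtain W where W: "W \<in> P" "y \<in> supp W" by (auto simp: support_def)
  then have "y \<in> closure (interior (supp W))" using tile P by blast
  then have "interior (supp U) \<inter> interior (supp W) \<noteq> {}"
    using y open_Int_closure_eq_empty[of "interior (supp U)" "interior (supp W)"] by auto
  then have "U = W" using S U W P unfolding is_patch_def by blast
  with W show ?thesis by simp
qed

text \<open>Every tile of either patch that meets \<open>G\<close> already lies in the common part.
  This is how a shared supertile or a shared finite patch turns into agreement of tilings.\<close>

lemma agree_on_if_common_cover:
  assumes "is_patch S" "is_patch S'" "P \<subseteq> S" "P \<subseteq> S'" "open G" "G \<subseteq> support P"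
  shows "agree_on G S S'"
proof -
  have "U \<in> S'" if "U \<in> S" "supp U \<inter> G \<noteq> {}" for U
    using mem_if_meets_covered_open[OF assms(1,3) that(1) assms(5,6) that(2)] assms(4) by blast
  moreover have "U \<in> S" if "U \<in> S'" "supp U \<inter> G \<noteq> {}" for U
    using mem_if_meets_covered_open[OF assms(2,4) that(1) assms(5,6) that(2)] assms(3) by blast
  ultimately show ?thesis unfolding agree_on_def by blast
qed

text \<open>The linear functional given by the inner product with \<open>x\<close> attains a maximum
  on the compact support, and translation by \<open>x\<close> would raise that maximum by the
  squared norm of \<open>x\<close>.\<close>

lemma no_period:
  assumes "is_tile U" "shift_tile x U = U" shows "x = 0"
proof -
  have c: "compact (supp U)" "supp U \<noteq> {}" using assms(1) by (auto simp: is_tile_def)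
  have "continuous_on (supp U) (\<lambda>p. p \<bullet> x)" by (intro continuous_intros)
  then obtain p where p: "p \<in> supp U" "\<And>p'. p' \<in> supp U \<Longrightarrow> p' \<bullet> x \<le> p \<bullet> x"
    using continuous_attains_sup[OF c] by blast
  have "translate x (supp U) = supp U" using assms(2) supp_shift_tile by metis
  then have "p + x \<in> supp U" using p(1) by (metis translate_def image_eqI)
  then have "(p + x) \<bullet> x \<le> p \<bullet> x" by (rule p(2))
  then have "x \<bullet> x \<le> 0" by (simp add: inner_add_left)
  then show ?thesis by (metis inner_gt_zero_iff not_le)
qed

section \<open>Separation and local finiteness of the copies of a tile\<close>

lemma tile_contains_ball:
  assumes "is_tile U" obtains c r where "0 < r" "ball c r \<subseteq> interior (supp U)"
proof -
  have "interior (supp U) \<noteq> {}" using assms by (auto simp: is_tile_def)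
  then obtain c where "c \<in> interior (supp U)" by blast
  then show thesis using that open_contains_ball[of "interior (supp U)"] by auto
qed

text \<open>Two copies displaced by less than the radius of a ball inside the tile have overlapping
  interiors, so they are the same tile of the patch; as a tile has no period, the displacement is
  0.\<close>

lemma shifted_copies_separated:
  assumes S: "is_patch S" and U: "is_tile U"
  obtains r where "0 < r"
    "\<And>x y. shift_tile x U \<in> S \<Longrightarrow> shift_tile y U \<in> S \<Longrightarrow> x \<noteq> y \<Longrightarrow> r \<le> dist x y"
proof -
  obtain c r where r: "0 < r" "ball c r \<subseteq> interior (supp U)" using tile_contains_ball[OF U] .
  have "r \<le> dist x y" if xy: "shift_tile x U \<in> S" "shift_tile y U \<in> S" "x \<noteq> y" for x y
  proof (rule ccontr)
    assume "\<not> r \<le> dist x y"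
    then have "y + c \<in> translate x (ball c r)" "y + c \<in> translate y (ball c r)"
      using r(1) by (auto simp: mem_translate dist_norm norm_minus_commute)
    then have "y + c \<in> interior (supp (shift_tile x U)) \<inter> interior (supp (shift_tile y U))"
      using r(2) by (auto simp: mem_translate)
    then have "shift_tile x U = shift_tile y U" using S xy unfolding is_patch_def by blast
    then have "shift_tile (- y + x) U = U" by (metis shift_tile_shift_tile add.left_inverse shift_tile_0)
    then have "- y + x = 0" by (rule no_period[OF U])
    then show False using xy(3) by simp
  qed
  with r(1) that show thesis by blast
qed

text \<open>Finitely many balls of radius \<open>r / 2\<close> cover \<open>E\<close>, and each
  holds at most one point of a translate of \<open>Y\<close>. Their number does not depend on
  \<open>z\<close>.\<close>

lemma separated_set_count:
  fixes Y :: "(real ^ 'n) set"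
  assumes r: "0 < r" and Y: "\<And>x y. x \<in> Y \<Longrightarrow> y \<in> Y \<Longrightarrow> x \<noteq> y \<Longrightarrow> r \<le> dist x y"
    and E: "bounded E"
  shows "\<exists>K. \<forall>z. finite (Y \<inter> translate z E) \<and> card (Y \<inter> translate z E) \<le> K"
proof -
  have "compact (closure E)" using E by simp
  then obtain k where k: "finite k" "closure E \<subseteq> (\<Union>x\<in>k. ball x (r / 2))"
    using r unfolding compact_eq_totally_bounded by (metis half_gt_zero)
  have "finite (Y \<inter> translate z E) \<and> card (Y \<inter> translate z E) \<le> card k" for z
  proof -
    have "\<exists>x\<in>k. dist x (y - z) < r / 2" if "y \<in> Y \<inter> translate z E" for y
    proof -
      have "y - z \<in> E" using that by (simp add: mem_translate)
      then have "y - z \<in> (\<Union>x\<in>k. ball x (r / 2))" by (intro subsetD[OF k(2)] subsetD[OF closure_subset])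
      then show ?thesis by auto
    qed
    then obtain f where f: "\<And>y. y \<in> Y \<inter> translate z E \<Longrightarrow> f y \<in> k \<and> dist (f y) (y - z) < r / 2"
      by metis
    have "inj_on f (Y \<inter> translate z E)"
    proof (rule inj_onI, rule ccontr)
      fix y y' assume y: "y \<in> Y \<inter> translate z E" "y' \<in> Y \<inter> translate z E" "f y = f y'" "y \<noteq> y'"
      have "dist (y - z) (y' - z) < r"
        using f[OF y(1)] f[OF y(2)] y(3) dist_triangle_half_r[of "f y" "y - z" r "y' - z"] by metis
      then have "dist y y' < r" by (simp add: dist_norm)
      then show False using Y[of y y'] y by simp
    qed
    moreover have "f ` (Y \<inter> translate z E) \<subseteq> k" using f by blast
    ultimately show ?thesis using k(1) by (meson card_inj_on_le inj_on_finite)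
  qed
  then show ?thesis by blast
qed

text \<open>A copy of \<open>b\<close> that meets \<open>K\<close> is displaced by a difference of a
  point of \<open>K\<close> and a point of \<open>b\<close>. These differences form a bounded set,
  which contains finitely many of the separated displacements.\<close>

lemma locally_finite:
  fixes S :: "(real ^ 'n, 'l) tile set"
  assumes S: "is_patch S" "S \<subseteq> translates B" and B: "finite B" "\<And>b. b \<in> B \<Longrightarrow> is_tile b"
    and K: "bounded K"
  shows "finite {U \<in> S. supp U \<inter> K \<noteq> {}}"
proof -
  have fin: "finite {x. shift_tile x b \<in> S \<and> translate x (supp b) \<inter> K \<noteq> {}}" if b: "b \<in> B" for b
  proof -
    let ?Y = "{x. shift_tile x b \<in> S}"
    obtain r where r: "0 < r"
      "\<And>x y. shift_tile x b \<in> S \<Longrightarrow> shift_tile y b \<in> S \<Longrightarrow> x \<noteq> y \<Longrightarrow> r \<le> dist x y"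
      using shifted_copies_separated[OF S(1) B(2)[OF b]] by metis
    let ?E = "\<Union>u\<in>K. \<Union>v\<in>supp b. {u - v}"
    have "bounded (supp b)" using B(2)[OF b] by (simp add: is_tile_def compact_imp_bounded)
    then have "bounded ?E" by (rule bounded_differences[OF K])
    then have "finite (?Y \<inter> translate 0 ?E)" using separated_set_count[of r ?Y ?E] r by blast
    moreover have "{x. shift_tile x b \<in> S \<and> translate x (supp b) \<inter> K \<noteq> {}} \<subseteq> ?Y \<inter> translate 0 ?E"
    proof
      fix x assume "x \<in> {x. shift_tile x b \<in> S \<and> translate x (supp b) \<inter> K \<noteq> {}}"
      then obtain y where y: "shift_tile x b \<in> S" "y - x \<in> supp b" "y \<in> K" by (auto simp: mem_translate)
      then have "x \<in> ?E" by (intro UN_I[of y] UN_I[of "y - x"]) auto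
      with y show "x \<in> ?Y \<inter> translate 0 ?E" by simp
    qed
    ultimately show ?thesis by (rule finite_subset[rotated])
  qed
  have "{U \<in> S. supp U \<inter> K \<noteq> {}} \<subseteq>
      (\<Union>b\<in>B. (\<lambda>x. shift_tile x b) ` {x. shift_tile x b \<in> S \<and> translate x (supp b) \<inter> K \<noteq> {}})"
  proof
    fix U assume U: "U \<in> {U \<in> S. supp U \<inter> K \<noteq> {}}"
    then have "U \<in> translates B" using S(2) by blast
    then obtain x b where xb: "U = shift_tile x b" "b \<in> B" unfolding translates_def by blast
    with U show "U \<in> (\<Union>b\<in>B. (\<lambda>x. shift_tile x b) ` {x. shift_tile x b \<in> S \<and> translate x (supp b) \<inter> K \<noteq> {}})"
      by auto
  qed
  then show ?thesis by (rule finite_subset) (use B(1) fin in auto)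
qed

text \<open>\<open>P n\<close> is the supertile of level \<open>n\<close> of the marked tile. Only
  inclusion of its copies in \<open>T\<close> is stated, which leaves room for copies that overlap;
  \<open>covers\<close> says that it contains arbitrarily wide neighbourhoods of the marked part
  \<open>\<psi> n\<close> followed by \<open>q\<close>.\<close>

locale supertiles = hierarchy \<psi> \<Lambda> s q
  for \<psi> :: "nat \<Rightarrow> real ^ 'n \<Rightarrow> real ^ 'n" and \<Lambda> s q +
  fixes T :: "(real ^ 'n, 'l::finite) tile set" and P :: "nat \<Rightarrow> (real ^ 'n, 'l) tile set"
  assumes tiling: "is_tiling T"
    and loc_fin: "bounded K \<Longrightarrow> finite {U \<in> T. supp U \<inter> K \<noteq> {}}"
    and super: "x \<in> \<Lambda> \<Longrightarrow> shift_pattern (\<psi> n x) (P n) \<subseteq> T"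
    and fin_P: "finite (P n)"
    and covers: "eventually (\<lambda>n. \<forall>y\<in>\<psi> n ` q. ball y R \<subseteq> support (P n)) sequentially"
    and q_compact: "compact q"
begin

lemma patch_T: "is_patch T"
  using tiling by (simp add: is_tiling_def)

text \<open>Whether \<open>y\<close> belongs to \<open>Y\<close> is read off from the tiling seen
  from \<open>y\<close> within radius \<open>R\<close>. Occurrences of a finite patch and hitting
  times of a local event both have this form.\<close>

definition locally_derived :: "real \<Rightarrow> (real ^ 'n) set \<Rightarrow> bool" where
  "locally_derived R Y \<longleftrightarrow> (\<forall>y y'. agree_on (ball 0 R) (shift_pattern (- y) T) (shift_pattern (- y') T)
     \<longrightarrow> (y \<in> Y \<longleftrightarrow> y' \<in> Y))"

text \<open>Within radius \<open>R\<close> of a point of the marked part the supertile covers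
  everything, so the tiling looks alike from corresponding points of all its copies, and
  \<open>Y\<close> meets the marked parts in translates of one set.\<close>

lemma locally_derived_supertiles:
  assumes "locally_derived R Y"
  shows "eventually (\<lambda>n. \<forall>x\<in>\<Lambda>. Y \<inter> \<psi> n ` translate x q = translate (\<psi> n x) {y \<in> \<psi> n ` q. y + \<psi> n x \<in> Y}
     \<and> (\<forall>x'\<in>\<Lambda>. {y \<in> \<psi> n ` q. y + \<psi> n x \<in> Y} = {y \<in> \<psi> n ` q. y + \<psi> n x' \<in> Y})) sequentially"
  using covers[of R]
proof eventually_elim
  case (elim n)
  have "y + \<psi> n x \<in> Y \<longleftrightarrow> y + \<psi> n x' \<in> Y" if x: "x \<in> \<Lambda>" "x' \<in> \<Lambda>" and y: "y \<in> \<psi> n ` q" for x x' y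
  proof -
    have sub: "shift_pattern (- y) (P n) \<subseteq> shift_pattern (- (y + \<psi> n x)) T" if "x \<in> \<Lambda>" for x
      using shift_pattern_mono[OF super[OF that, of n], of "- (y + \<psi> n x)"] by simp
    have "ball y R \<subseteq> support (P n)" using elim y by blast
    then have "translate (- y) (ball y R) \<subseteq> translate (- y) (support (P n))"
      by (simp add: translate_def image_mono)
    then have "ball 0 R \<subseteq> support (shift_pattern (- y) (P n))"
      by (simp add: translate_ball)
    then have "agree_on (ball 0 R) (shift_pattern (- (y + \<psi> n x)) T) (shift_pattern (- (y + \<psi> n x')) T)"
      using sub[OF x(1)] sub[OF x(2)] patch_T
      by (intro agree_on_if_common_cover[of _ _ "shift_pattern (- y) (P n)"]) auto
    then show ?thesis using assms unfolding locally_derived_def by blast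
  qed
  note * = this
  have A: "Y \<inter> \<psi> n ` translate x q = translate (\<psi> n x) {y \<in> \<psi> n ` q. y + \<psi> n x \<in> Y}" for x
    unfolding image_translate_linear[OF lin] by (simp add: set_eq_iff mem_translate conj_commute)
  have B: "{y \<in> \<psi> n ` q. y + \<psi> n x \<in> Y} = {y \<in> \<psi> n ` q. y + \<psi> n x' \<in> Y}"
    if "x \<in> \<Lambda>" "x' \<in> \<Lambda>" for x x' using *[OF that] by blast
  show ?case by (intro ballI conjI A B)
qed

lemma count_mean_exists:
  assumes Y: "locally_derived R Y"
    and r: "0 < r" "\<And>x y. x \<in> Y \<Longrightarrow> y \<in> Y \<Longrightarrow> x \<noteq> y \<Longrightarrow> r \<le> dist x y"
  shows "\<exists>c\<ge>0. has_mean (\<lambda>E. real (card (Y \<inter> E))) c"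
proof -
  obtain x0 where x0: "x0 \<in> \<Lambda>" using hit by blast
  show ?thesis
  proof (rule mean_exists[where a = "\<lambda>n. real (card {y \<in> \<psi> n ` q. y + \<psi> n x0 \<in> Y})"])
  have fin: "finite (Y \<inter> E)" if "bounded E" for E
    using separated_set_count[of r Y E, OF r(1) r(2) that] by (metis translate_0)
  show "additive_on_bounded (\<lambda>E. real (card (Y \<inter> E)))"
    unfolding additive_on_bounded_def
  proof (intro conjI allI impI)
    fix E F :: "(real ^ 'n) set" assume E: "bmeas E" and F: "bmeas F" and d: "E \<inter> F = {}"
    have "card (Y \<inter> E \<union> Y \<inter> F) = card (Y \<inter> E) + card (Y \<inter> F)"
      using E F d by (intro card_Un_disjoint fin) (auto simp: bmeas_def)
    then show "real (card (Y \<inter> (E \<union> F))) = real (card (Y \<inter> E)) + real (card (Y \<inter> F))"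
      by (simp add: Int_Un_distrib)
  qed simp
  show "\<exists>K. \<forall>z. real (card (Y \<inter> translate z (\<psi> n ` Q))) \<le> K" for n
  proof -
    have "bounded (\<psi> n ` Q)" using bmeas_image[of Q n] by (simp add: bmeas_def)
    then obtain K where "\<forall>z. card (Y \<inter> translate z (\<psi> n ` Q)) \<le> K"
      using separated_set_count[OF r] by metis
    then show ?thesis by (intro exI[of _ "real K"]) simp
  qed
  show "eventually (\<lambda>n. \<forall>x\<in>\<Lambda>. real (card (Y \<inter> \<psi> n ` translate x q))
      = real (card {y \<in> \<psi> n ` q. y + \<psi> n x0 \<in> Y})) sequentially"
    using locally_derived_supertiles[OF Y]
  proof eventually_elim
    case (elim n)
    have "card (translate a A) = card A" for a and A :: "(real ^ 'n) set"
      unfolding translate_def by (rule card_image) (simp add: inj_on_def)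
    have "card (Y \<inter> \<psi> n ` translate x q) = card {y \<in> \<psi> n ` q. y + \<psi> n x0 \<in> Y}"
      if x: "x \<in> \<Lambda>" for x
    proof -
      have "Y \<inter> \<psi> n ` translate x q = translate (\<psi> n x) {y \<in> \<psi> n ` q. y + \<psi> n x0 \<in> Y}"
        using bspec[OF elim x] x0 by auto
      then show ?thesis using \<open>\<And>a A. card (translate a A) = card A\<close> by simp
    qed
    then show ?case by simp
  qed
  qed
qed

lemma volume_mean_exists:
  assumes Y: "locally_derived R Y" and m: "Y \<in> sets lebesgue"
  shows "\<exists>c\<ge>0. has_mean (\<lambda>E. vol (Y \<inter> E)) c"
proof -
  obtain x0 where x0: "x0 \<in> \<Lambda>" using hit by blast
  show ?thesis
  proof (rule mean_exists[where a = "\<lambda>n. vol {y \<in> \<psi> n ` q. y + \<psi> n x0 \<in> Y}"])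
  have bm: "bmeas (Y \<inter> E)" if "bmeas E" for E
    using bmeas_Int[OF that m] by (simp add: Int_commute)
  show "additive_on_bounded (\<lambda>E. vol (Y \<inter> E))"
    unfolding additive_on_bounded_def
  proof (intro conjI allI impI)
    fix E F :: "(real ^ 'n) set" assume "bmeas E" "bmeas F" "E \<inter> F = {}"
    then show "vol (Y \<inter> (E \<union> F)) = vol (Y \<inter> E) + vol (Y \<inter> F)"
      unfolding Int_Un_distrib by (intro vol_Un_disjoint bm) auto
  qed simp
  show "\<exists>K. \<forall>z. vol (Y \<inter> translate z (\<psi> n ` Q)) \<le> K" for n
  proof (intro exI allI)
    fix z
    have "vol (Y \<inter> translate z (\<psi> n ` Q)) \<le> vol (translate z (\<psi> n ` Q))"
      by (intro vol_mono bm) (auto intro!: bmeas_image)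
    then show "vol (Y \<inter> translate z (\<psi> n ` Q)) \<le> V n" by (simp add: V_def)
  qed
  show "eventually (\<lambda>n. \<forall>x\<in>\<Lambda>. vol (Y \<inter> \<psi> n ` translate x q)
      = vol {y \<in> \<psi> n ` q. y + \<psi> n x0 \<in> Y}) sequentially"
    using locally_derived_supertiles[OF Y]
  proof eventually_elim
    case (elim n)
    have "vol (Y \<inter> \<psi> n ` translate x q) = vol {y \<in> \<psi> n ` q. y + \<psi> n x0 \<in> Y}"
      if x: "x \<in> \<Lambda>" for x
    proof -
      have "Y \<inter> \<psi> n ` translate x q = translate (\<psi> n x) {y \<in> \<psi> n ` q. y + \<psi> n x0 \<in> Y}"
        using bspec[OF elim x] x0 by auto
      then show ?thesis by simp
    qed
    then show ?case by simp
  qed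
  qed
qed

lemma occurrences_locally_derived:
  assumes "finite F" "is_patch F"
  shows "\<exists>R. locally_derived R {y. shift_pattern y F \<subseteq> T}"
proof -
  have "bounded (support F)"
    unfolding support_def using assms
    by (auto simp: is_patch_def is_pattern_def is_tile_def compact_imp_bounded)
  then obtain R where R: "support F \<subseteq> ball 0 R" using bounded_subset_ballD by blast
  have "F \<subseteq> S'" if ag: "agree_on (ball 0 R) S S'" and F: "F \<subseteq> S" for S S' :: "(real ^ 'n, 'l) tile set"
  proof
    fix U assume U: "U \<in> F"
    then have "supp U \<noteq> {}" using assms(2) by (auto simp: is_patch_def is_pattern_def is_tile_def)
    moreover have "supp U \<subseteq> ball 0 R" using R U by (auto simp: support_def)
    ultimately have "supp U \<inter> ball 0 R \<noteq> {}" by blast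
    then show "U \<in> S'" using ag U F unfolding agree_on_def by blast
  qed
  then have "locally_derived R {y. shift_pattern y F \<subseteq> T}"
    unfolding locally_derived_def mem_Collect_eq shift_pattern_subset_iff
    using agree_on_sym by blast
  then show ?thesis ..
qed

text \<open>Each occurrence of \<open>F\<close> yields a copy of one fixed tile \<open>U\<close>
  with the same displacement, so the separation of the copies of \<open>U\<close> passes to the
  occurrences and makes their counts finite.\<close>

theorem patch_frequency:
  assumes F: "finite F" "is_patch F" "F \<noteq> {}"
  defines "Y \<equiv> {y. shift_pattern y F \<subseteq> T}"
  shows "\<And>E. bounded E \<Longrightarrow> finite (Y \<inter> E)"
    and "\<exists>c. has_mean (\<lambda>E. real (card (Y \<inter> E))) c"
proof -
  obtain U where U: "U \<in> F" using F(3) by blast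
  then have "is_tile U" using F(2) by (auto simp: is_patch_def is_pattern_def)
  then obtain r where r: "0 < r"
    "\<And>x y. shift_tile x U \<in> T \<Longrightarrow> shift_tile y U \<in> T \<Longrightarrow> x \<noteq> y \<Longrightarrow> r \<le> dist x y"
    using shifted_copies_separated[OF patch_T] by metis
  have UT: "shift_tile y U \<in> T" if "y \<in> Y" for y
    using that U by (auto simp: Y_def shift_pattern_def)
  have sep: "\<And>x y. x \<in> Y \<Longrightarrow> y \<in> Y \<Longrightarrow> x \<noteq> y \<Longrightarrow> r \<le> dist x y" using r(2) UT by blast
  show "finite (Y \<inter> E)" if "bounded E" for E
    using separated_set_count[of r Y E, OF r(1) sep that] by (metis translate_0)
  obtain R where "locally_derived R Y" using occurrences_locally_derived[OF F(1,2)] unfolding Y_def by blast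
  from count_mean_exists[OF this r(1) sep]
  show "\<exists>c. has_mean (\<lambda>E. real (card (Y \<inter> E))) c" by blast
qed

end

text \<open>Volume and thick boundary are invariant under translation, so one error bound, depending
  on \<open>A n\<close> but not on \<open>x\<close>, serves all translates.\<close>

lemma has_mean_van_hove:
  fixes N :: "(real ^ 'n) set \<Rightarrow> real"
  assumes N: "has_mean N c" and A: "van_hove A"
  shows "uniform_limit UNIV (\<lambda>n x. N (translate x (A n)) / vol (A n)) (\<lambda>x. c) sequentially"
proof (rule uniform_limitI)
  fix e :: real assume e: "0 < e"
  then obtain L C where LC: "0 < L" "0 \<le> C"
    "\<And>E. bmeas E \<Longrightarrow> \<bar>N E - c * vol E\<bar> \<le> e / 2 * vol E + C * vol (thick_boundary L E)"
    using N unfolding has_mean_def by (meson half_gt_zero)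
  have "(\<lambda>n. C * (vol (thick_boundary L (A n)) / vol (A n))) \<longlonglongrightarrow> C * 0"
    using A LC(1) unfolding van_hove_def by (intro tendsto_mult tendsto_const) auto
  then have "eventually (\<lambda>n. C * (vol (thick_boundary L (A n)) / vol (A n)) < e / 2) sequentially"
    using e by (intro order_tendstoD(2)) auto
  then show "\<forall>\<^sub>F n in sequentially. \<forall>x\<in>UNIV. dist (N (translate x (A n)) / vol (A n)) c < e"
  proof eventually_elim
    case (elim n)
    have v: "0 < vol (A n)" "bmeas (A n)" using A by (auto simp: van_hove_def bmeas_iff)
    show ?case
    proof
      fix x
      have "\<bar>N (translate x (A n)) - c * vol (A n)\<bar> \<le> e / 2 * vol (A n) + C * vol (thick_boundary L (A n))"
        using LC(3)[of "translate x (A n)"] v by simp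
      then have "\<bar>N (translate x (A n)) - c * vol (A n)\<bar> / vol (A n)
          \<le> (e / 2 * vol (A n) + C * vol (thick_boundary L (A n))) / vol (A n)"
        using v by (intro divide_right_mono) auto
      also have "\<dots> = e / 2 + C * (vol (thick_boundary L (A n)) / vol (A n))"
        using v by (simp add: field_simps)
      also have "\<dots> < e" using elim by linarith
      also have "\<bar>N (translate x (A n)) - c * vol (A n)\<bar> / vol (A n) = dist (N (translate x (A n)) / vol (A n)) c"
      proof -
        have "N (translate x (A n)) / vol (A n) - c = (N (translate x (A n)) - c * vol (A n)) / vol (A n)"
          using v(1) by (simp add: diff_divide_distrib)
        then show ?thesis using v(1) by (simp add: dist_real_def abs_divide)
      qed
      finally show "dist (N (translate x (A n)) / vol (A n)) c < e" .
    qed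
  qed
qed

lemma uniform_limit_imp_sequence_limit:
  assumes "uniform_limit UNIV f (\<lambda>x. c :: real) sequentially"
  shows "(\<lambda>n. f n (x n)) \<longlonglongrightarrow> c"
proof (rule tendstoI)
  fix e :: real assume "0 < e"
  from uniform_limitD[OF assms this] show "\<forall>\<^sub>F n in sequentially. dist (f n (x n)) c < e"
    by eventually_elim auto
qed

section \<open>Fixed points of expanding substitutions\<close>

lemma subst_mono: "P \<subseteq> P' \<Longrightarrow> subst B \<phi> \<rho> P \<subseteq> subst B \<phi> \<rho> P'"
  unfolding subst_def by blast

lemma subst_power_mono: "P \<subseteq> P' \<Longrightarrow> (subst B \<phi> \<rho> ^^ n) P \<subseteq> (subst B \<phi> \<rho> ^^ n) P'"
  by (induction n) (simp_all add: subst_mono)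

lemma mem_subst:
  "U \<in> subst B \<phi> \<rho> P \<longleftrightarrow> (\<exists>b x. b \<in> B \<and> shift_tile x b \<in> P \<and> U \<in> shift_pattern (\<phi> x) (\<rho> b))"
  unfolding subst_def by blast

lemma subst_shift:
  assumes "linear \<phi>"
  shows "subst B \<phi> \<rho> (shift_pattern x P) = shift_pattern (\<phi> x) (subst B \<phi> \<rho> P)"
proof -
  have "U \<in> subst B \<phi> \<rho> (shift_pattern x P) \<longleftrightarrow> U \<in> shift_pattern (\<phi> x) (subst B \<phi> \<rho> P)" for U
  proof -
    have "U \<in> subst B \<phi> \<rho> (shift_pattern x P) \<longleftrightarrow>
        (\<exists>b y. b \<in> B \<and> shift_tile (- x + y) b \<in> P \<and> shift_tile (- \<phi> y) U \<in> \<rho> b)"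
      by (simp add: mem_subst mem_shift_pattern)
    also have "\<dots> \<longleftrightarrow> (\<exists>b y. b \<in> B \<and> shift_tile y b \<in> P \<and> shift_tile (- \<phi> (x + y)) U \<in> \<rho> b)"
    proof
      assume "\<exists>b y. b \<in> B \<and> shift_tile (- x + y) b \<in> P \<and> shift_tile (- \<phi> y) U \<in> \<rho> b"
      then obtain b y where "b \<in> B" "shift_tile (- x + y) b \<in> P" "shift_tile (- \<phi> y) U \<in> \<rho> b" by blast
      then show "\<exists>b y. b \<in> B \<and> shift_tile y b \<in> P \<and> shift_tile (- \<phi> (x + y)) U \<in> \<rho> b"
        by (intro exI[of _ b] exI[of _ "- x + y"]) simp
    next
      assume "\<exists>b y. b \<in> B \<and> shift_tile y b \<in> P \<and> shift_tile (- \<phi> (x + y)) U \<in> \<rho> b"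
      then obtain b y where "b \<in> B" "shift_tile y b \<in> P" "shift_tile (- \<phi> (x + y)) U \<in> \<rho> b" by blast
      then show "\<exists>b y. b \<in> B \<and> shift_tile (- x + y) b \<in> P \<and> shift_tile (- \<phi> y) U \<in> \<rho> b"
        by (intro exI[of _ b] exI[of _ "x + y"]) simp
    qed
    also have "\<dots> \<longleftrightarrow> U \<in> shift_pattern (\<phi> x) (subst B \<phi> \<rho> P)"
      by (simp add: mem_subst mem_shift_pattern linear_add[OF assms] algebra_simps)
    finally show ?thesis .
  qed
  then show ?thesis by blast
qed

lemma subst_power_shift:
  assumes "linear \<phi>"
  shows "(subst B \<phi> \<rho> ^^ n) (shift_pattern x P) = shift_pattern ((\<phi> ^^ n) x) ((subst B \<phi> \<rho> ^^ n) P)"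
  by (induction n) (simp_all add: subst_shift[OF assms])

text \<open>A shifted copy of a proto-tile determines its displacement, since tiles have no period;
  so a finite pattern yields finitely many terms.\<close>

lemma finite_subst:
  fixes B :: "(real ^ 'n, 'l) tile set"
  assumes pre: "pre_overlapping_substitution B \<phi> \<rho>" and P: "finite P"
  shows "finite (subst B \<phi> \<rho> P)"
proof -
  have B: "finite B" "\<And>b. b \<in> B \<Longrightarrow> is_tile b" "\<And>b. b \<in> B \<Longrightarrow> finite (\<rho> b)"
    using pre by (auto simp: pre_overlapping_substitution_def)
  have fin: "finite {x. shift_tile x b \<in> P}" if "b \<in> B" for b
  proof (rule inj_on_finite[OF _ _ P])
    show "inj_on (\<lambda>x. shift_tile x b) {x. shift_tile x b \<in> P}"
    proof (rule inj_onI)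
      fix x y assume "shift_tile x b = shift_tile y b"
      then have "shift_tile (- y + x) b = b" by (metis shift_tile_shift_tile add.left_inverse shift_tile_0)
      then have "- y + x = 0" by (rule no_period[OF B(2)[OF that]])
      then show "x = y" by simp
    qed
  qed auto
  have "subst B \<phi> \<rho> P = (\<Union>b\<in>B. \<Union>x\<in>{x. shift_tile x b \<in> P}. shift_pattern (\<phi> x) (\<rho> b))"
    unfolding subst_def by blast
  then show ?thesis using B fin by simp
qed

lemma subst_translates:
  assumes pre: "pre_overlapping_substitution B \<phi> \<rho>"
  shows "subst B \<phi> \<rho> P \<subseteq> translates B"
proof
  fix U assume "U \<in> subst B \<phi> \<rho> P"
  then obtain b x where b: "b \<in> B" "shift_tile (- \<phi> x) U \<in> \<rho> b" by (auto simp: mem_subst mem_shift_pattern)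
  then have "shift_tile (- \<phi> x) U \<in> translates B"
    using pre unfolding pre_overlapping_substitution_def by blast
  then obtain y c where c: "shift_tile (- \<phi> x) U = shift_tile y c" "c \<in> B" unfolding translates_def by blast
  then have "U = shift_tile (\<phi> x + y) c" by (metis add.right_inverse shift_tile_0 shift_tile_shift_tile)
  with c(2) show "U \<in> translates B" unfolding translates_def by blast
qed

lemma subst_support:
  assumes lin: "linear \<phi>" and ex: "expanding B \<phi> \<rho>" and P: "P \<subseteq> translates B"
  shows "\<phi> ` support P \<subseteq> support (subst B \<phi> \<rho> P)"
proof
  fix z assume "z \<in> \<phi> ` support P"
  then obtain y U where U: "z = \<phi> y" "y \<in> supp U" "U \<in> P" by (auto simp: support_def)
  then have "U \<in> translates B" using P by blast
  then obtain x b where b: "U = shift_tile x b" "b \<in> B" unfolding translates_def by blast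
  have "y - x \<in> supp b" using U(2) by (simp add: b mem_translate)
  then have "\<phi> (y - x) \<in> support (\<rho> b)" using ex b(2) unfolding expanding_def by blast
  then have "z \<in> support (shift_pattern (\<phi> x) (\<rho> b))"
    using lin by (simp add: U(1) mem_translate linear_diff)
  moreover have "shift_pattern (\<phi> x) (\<rho> b) \<subseteq> subst B \<phi> \<rho> P" using b U(3) unfolding subst_def by blast
  ultimately show "z \<in> support (subst B \<phi> \<rho> P)" using support_mono by blast
qed

lemma subst_power_support:
  assumes pre: "pre_overlapping_substitution B \<phi> \<rho>" and ex: "expanding B \<phi> \<rho>" and P: "P \<subseteq> translates B"
  shows "(\<phi> ^^ n) ` support P \<subseteq> support ((subst B \<phi> \<rho> ^^ n) P)"
proof (induction n)
  case (Suc n)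
  have lin: "linear \<phi>" using pre by (simp add: pre_overlapping_substitution_def)
  have sub: "(subst B \<phi> \<rho> ^^ n) P \<subseteq> translates B"
    using P subst_translates[OF pre] by (cases n) auto
  have "(\<phi> ^^ Suc n) ` support P = \<phi> ` (\<phi> ^^ n) ` support P" by (simp add: image_comp)
  also have "\<dots> \<subseteq> \<phi> ` support ((subst B \<phi> \<rho> ^^ n) P)" using Suc by (rule image_mono)
  also have "\<dots> \<subseteq> support (subst B \<phi> \<rho> ((subst B \<phi> \<rho> ^^ n) P))" by (rule subst_support[OF lin ex sub])
  finally show ?case by simp
qed simp

text \<open>If \<open>t0 + x\<close> is a tile of the tiling, monotonicity of the substitution and
  the fixed point equation place its supertile of level \<open>n\<close> inside the tiling, and
  linearity makes this the supertile of \<open>t0\<close> shifted by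
  \<open>\<psi> n x\<close>.\<close>

lemma fixed_point_supertiles:
  fixes B :: "(real ^ 'n, 'l::finite) tile set"
  assumes ov: "overlapping_substitution B \<phi> \<rho>" and ex: "expanding B \<phi> \<rho>"
    and T: "is_tiling \<T>" "\<T> \<subseteq> translates B" and k: "k > 0"
    and fixpt: "(subst B \<phi> \<rho> ^^ k) \<T> = \<T>" and rep: "repetitive \<T>"
  obtains \<psi> \<Lambda> s q P where "supertiles \<psi> \<Lambda> s q \<T> P"
proof -
  have pre: "pre_overlapping_substitution B \<phi> \<rho>" using ov by (simp add: overlapping_substitution_def)
  interpret expanding_linear \<phi>
    using pre unfolding pre_overlapping_substitution_def
    by (intro expanding_linear.intro) blast+
  have B: "finite B" "\<And>b. b \<in> B \<Longrightarrow> is_tile b"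
    using pre by (auto simp: pre_overlapping_substitution_def)
  have patch: "is_patch \<T>" using T(1) by (simp add: is_tiling_def)
  have "\<T> \<noteq> {}" using T(1) by (auto simp: is_tiling_def support_def)
  then obtain t0 where t0: "t0 \<in> \<T>" by blast
  then have tile: "is_tile t0" using patch by (auto simp: is_patch_def is_pattern_def)
  obtain c r where r: "0 < r" "ball c r \<subseteq> interior (supp t0)" using tile_contains_ball[OF tile] .
  \<comment> \<open>Halving the radius leaves a margin \<open>r / 2\<close> between \<open>q\<close>
    and the outside of the tile; \<open>\<psi> n\<close> magnifies this margin beyond any prescribed
    radius.\<close>
  define q where "q = cball c (r / 2)"
  define \<psi> where "\<psi> n = \<phi> ^^ (k * n)" for n
  define P where "P n = (subst B \<phi> \<rho> ^^ (k * n)) {t0}" for n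
  define \<Lambda> where "\<Lambda> = {x. shift_tile x t0 \<in> \<T>}"
  \<comment> \<open>Repetitivity for the patch consisting of \<open>t0\<close> alone: every ball of
    radius \<open>R\<close> contains a copy of that tile.\<close>
  obtain R where R: "0 < R"
    "\<And>x. \<exists>y. shift_pattern y {t0} \<subseteq> \<T> \<and> support (shift_pattern y {t0}) \<subseteq> ball x R"
    using rep[unfolded repetitive_def, rule_format, of "{t0}"] t0 by auto
  have lin_psi: "linear (\<psi> n)" for n unfolding \<psi>_def by (rule linear_power)
  have bij_psi: "Fun.bij (\<psi> n)" for n unfolding \<psi>_def by (rule bij_power)
  have mono: "strict_mono ((*) k)" using k by (simp add: strict_mono_def)
  have exp: "eventually (\<lambda>n. ball 0 R' \<subseteq> \<psi> n ` ball 0 \<delta>) sequentially" if "0 < \<delta>" for \<delta> R'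
    unfolding \<psi>_def using eventually_subseq[OF mono ball_subset_power_image[OF that, of R']] .
  have fixn: "(subst B \<phi> \<rho> ^^ (k * n)) \<T> = \<T>" for n
    by (induction n) (simp_all add: funpow_add fixpt)
  have q_supp: "q \<subseteq> supp t0" and q_margin: "\<And>y. y \<in> q \<Longrightarrow> ball y (r / 2) \<subseteq> supp t0"
  proof -
    have sub: "ball c r \<subseteq> supp t0" using r(2) interior_subset by blast
    have "q \<subseteq> ball c r" using r(1) by (auto simp: q_def)
    then show "q \<subseteq> supp t0" using sub by blast
    fix y assume "y \<in> q"
    have "ball y (r / 2) \<subseteq> ball c r"
    proof
      fix z assume "z \<in> ball y (r / 2)"
      with \<open>y \<in> q\<close> show "z \<in> ball c r"
        using dist_triangle[of c z y] by (auto simp: q_def)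
    qed
    then show "ball y (r / 2) \<subseteq> supp t0" using sub by blast
  qed
  have "supertiles \<psi> \<Lambda> (2 * R) q \<T> P"
  proof (intro supertiles.intro hierarchy.intro supertiles_axioms.intro)
    show "linear (\<psi> n)" "Fun.bij (\<psi> n)" for n by (rule lin_psi bij_psi)+
    show "eventually (\<lambda>n. ball 0 R' \<subseteq> \<psi> n ` ball 0 \<delta>) sequentially" if "0 < \<delta>" for \<delta> R'
      using exp[OF that] .
    show "0 < 2 * R" using R by simp
    show "bborel q" by (simp add: q_def bborel_def)
    show "negligible (frontier q)" unfolding q_def by (intro negligible_convex_frontier convex_cball)
    show "interior q \<noteq> {}" using r(1) by (simp add: q_def)
    show "compact q" by (simp add: q_def)
    show "\<exists>x\<in>\<Lambda>. translate x q \<subseteq> translate z (cube (2 * R))" for z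
    proof -
      obtain y where y: "shift_tile y t0 \<in> \<T>" "translate y (supp t0) \<subseteq> ball (z + (\<chi> i. R)) R"
        using R(2)[of "z + (\<chi> i. R)"] by (auto simp: support_def)
      \<comment> \<open>A cube of side \<open>2 * R\<close> contains the ball of radius
        \<open>R\<close> about its centre, hence a copy of the tile; this explains the side
        length.\<close>
      have "ball (z + (\<chi> i. R)) R \<subseteq> translate z (cube (2 * R))"
      proof
        fix v assume "v \<in> ball (z + (\<chi> i. R)) R"
        then have v: "norm (v - z - (\<chi> i. R)) < R" by (simp add: dist_norm norm_minus_commute algebra_simps)
        have "\<bar>(v - z) $ i - R\<bar> < R" for i
          using component_le_norm_cart[of "v - z - (\<chi> i. R)" i] v by simp
        then have "0 \<le> (v - z) $ i \<and> (v - z) $ i < 2 * R" for i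
          by (simp add: abs_less_iff) (smt (verit, best))
        then show "v \<in> translate z (cube (2 * R))" by (simp add: mem_translate cube_def)
      qed
      moreover have "translate y q \<subseteq> translate y (supp t0)" using q_supp by (simp add: translate_def image_mono)
      ultimately show ?thesis using y by (intro bexI[of _ y]) (auto simp: \<Lambda>_def)
    qed
    show "is_tiling \<T>" by fact
    show "finite {U \<in> \<T>. supp U \<inter> K \<noteq> {}}" if "bounded K" for K
      using locally_finite[OF patch T(2) B that] by blast
    show "shift_pattern (\<psi> n x) (P n) \<subseteq> \<T>" if "x \<in> \<Lambda>" for x n
    proof -
      have "shift_pattern x {t0} \<subseteq> \<T>" using that by (simp add: \<Lambda>_def)
      from subst_power_mono[OF this, where B = B and \<phi> = \<phi> and \<rho> = \<rho> and n = "k * n"] show ?thesis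
        by (simp add: subst_power_shift[OF linear] fixn P_def \<psi>_def del: shift_pattern_singleton)
    qed
    show "finite (P n)" for n
    proof -
      have "finite ((subst B \<phi> \<rho> ^^ m) {t0})" for m
        by (induction m) (auto intro: finite_subst[OF pre])
      then show ?thesis by (simp add: P_def)
    qed
    show "eventually (\<lambda>n. \<forall>y\<in>\<psi> n ` q. ball y R' \<subseteq> support (P n)) sequentially" for R'
    proof -
      have "0 < r / 2" using r by simp
      from exp[OF this, of R'] show ?thesis
      proof eventually_elim
        case (elim n)
        have supp: "\<psi> n ` supp t0 \<subseteq> support (P n)"
          using subst_power_support[OF pre ex, where P = "{t0}" and n = "k * n"] t0 T(2)
          by (auto simp: P_def \<psi>_def support_def)
        show ?case
        proof
          fix y assume "y \<in> \<psi> n ` q"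
          then obtain u where u: "u \<in> q" "y = \<psi> n u" by blast
          have "ball y R' = translate y (ball 0 R')" by (simp add: translate_ball)
          also have "\<dots> \<subseteq> translate y (\<psi> n ` ball 0 (r / 2))"
            using elim by (simp add: translate_def image_mono)
          also have "\<dots> = \<psi> n ` translate u (ball 0 (r / 2))"
            by (simp add: u(2) image_translate_linear[OF lin_psi])
          also have "\<dots> \<subseteq> \<psi> n ` supp t0" using q_margin[OF u(1)] by (intro image_mono) (simp add: translate_ball)
          finally show "ball y R' \<subseteq> support (P n)" using supp by blast
        qed
      qed
    qed
  qed
  then show thesis by (rule that)
qed

context supertiles
begin

theorem uniform_patch_frequency:
  assumes F: "is_patch F" "finite F" "F \<noteq> {}"
  shows "\<exists>c :: real. \<forall>A :: nat \<Rightarrow> (real ^ 'n) set. van_hove A \<longrightarrow>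
      (\<forall>n x. finite {y \<in> (\<lambda>a. a + x) ` A n. shift_pattern y F \<subseteq> T}) \<and>
      (\<forall>x :: nat \<Rightarrow> real ^ 'n.
         (\<lambda>n. real (card {y \<in> (\<lambda>a. a + x n) ` A n. shift_pattern y F \<subseteq> T})
                / measure lebesgue (A n)) \<longlonglongrightarrow> c) \<and>
      uniform_limit UNIV
        (\<lambda>n x. real (card {y \<in> (\<lambda>a. a + x) ` A n. shift_pattern y F \<subseteq> T})
                / measure lebesgue (A n)) (\<lambda>x. c) sequentially"
proof -
  let ?Y = "{y. shift_pattern y F \<subseteq> T}"
  obtain c where c: "has_mean (\<lambda>E. real (card (?Y \<inter> E))) c"
    using patch_frequency(2)[OF F(2,1,3)] by blast
  have eq: "{y \<in> (\<lambda>a. a + x) ` E. shift_pattern y F \<subseteq> T} = ?Y \<inter> translate x E" for x E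
    by (auto simp: translate_def)
  show ?thesis
    unfolding eq
  proof (intro exI allI impI conjI)
    fix A :: "nat \<Rightarrow> (real ^ 'n) set" assume A: "van_hove A"
    show "finite (?Y \<inter> translate x (A n))" for n x
    proof (rule patch_frequency(1)[OF F(2,1,3)])
      show "bounded (translate x (A n))"
        using A by (simp add: van_hove_def translate_eq_plus_image bounded_translation)
    qed
    show u: "uniform_limit UNIV (\<lambda>n x. real (card (?Y \<inter> translate x (A n))) / vol (A n)) (\<lambda>x. c) sequentially"
      by (rule has_mean_van_hove[OF c A])
    show "(\<lambda>n. real (card (?Y \<inter> translate (x n) (A n))) / vol (A n)) \<longlonglongrightarrow> c" for x
      by (rule uniform_limit_imp_sequence_limit[OF u])
  qed
qed

end

section \<open>The hull\<close>

lemma topspace_local_topology: "topspace local_topology = Collect is_tiling"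
proof
  show "topspace local_topology \<subseteq> Collect is_tiling"
    using openin_topspace[of local_topology] unfolding openin_local_topology by (rule conjunct1)
  have "openin local_topology (Collect is_tiling)"
    unfolding openin_local_topology by (auto intro: exI[of _ 1])
  then show "Collect is_tiling \<subseteq> topspace local_topology" by (rule openin_subset)
qed

text \<open>The strict inequalities \<open>norm x < e\<close> and \<open>1 / e + norm x < r\<close>
  survive a further small translation, which makes \<open>W\<close> open, while they still imply
  closeness within \<open>e\<close>.\<close>

lemma locally_close_neighbourhood:
  assumes S: "is_tiling S" and e: "0 < e"
  obtains W where "openin local_topology W" "S \<in> W"
    "\<And>S'. S' \<in> W \<Longrightarrow> is_tiling S' \<and> locally_close e S S'"
proof -
  define W where "W = {S'. is_tiling S' \<and> (\<exists>x r. norm x < e \<and> 1 / e + norm x < r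
    \<and> agree_on (ball 0 r) S (shift_pattern x S'))}"
  have "openin local_topology W"
    unfolding openin_local_topology
  proof (intro conjI ballI)
    show "W \<subseteq> Collect is_tiling" by (auto simp: W_def)
    fix S1 assume "S1 \<in> W"
    then obtain x r where x: "is_tiling S1" "norm x < e" "1 / e + norm x < r"
        "agree_on (ball 0 r) S (shift_pattern x S1)" by (auto simp: W_def)
    \<comment> \<open>The window \<open>1 / d\<close> must contain the ball of radius
      \<open>r\<close> after a shift by \<open>x\<close>; the other bounds on \<open>d\<close> fit
      it into the slack of the two strict inequalities.\<close>
    define B where "B = \<bar>r\<bar> + norm x + 1"
    have B: "0 < B" unfolding B_def using norm_ge_zero[of x] by linarith
    define d where "d = min (1 / B) (min (e - norm x) ((r - (1 / e + norm x)) / 2))"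
    have "d \<le> 1 / B" "d \<le> e - norm x" "d \<le> (r - (1 / e + norm x)) / 2"
      unfolding d_def min_le_iff_disj by blast+
    moreover have "0 < d" using x B by (simp add: d_def)
    ultimately have d: "0 < d" "B \<le> 1 / d" "norm x + d \<le> e" "1 / e + norm x + 2 * d \<le> r"
      using B by (simp_all add: field_simps)
    have "S2 \<in> W" if S2: "is_tiling S2" "locally_close d S1 S2" for S2
    proof -
      obtain x' where x': "norm x' < d" "agree_on (ball 0 (1 / d)) S1 (shift_pattern x' S2)"
        using S2(2) by (auto simp: locally_close_def)
      have "norm x + r \<le> 1 / d" using d(2) unfolding B_def by linarith
      then have "translate (- x) (ball 0 r) \<subseteq> ball 0 (1 / d)"
        by (simp add: translate_ball ball_subset_ball_iff)
      then have "agree_on (translate (- x) (ball 0 r)) S1 (shift_pattern x' S2)"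
        using x'(2) agree_on_subset by blast
      then have "agree_on (ball 0 r) (shift_pattern x S1) (shift_pattern (x + x') S2)"
        by (simp flip: agree_on_shift)
      then have a: "agree_on (ball 0 r) S (shift_pattern (x + x') S2)" using x(4) agree_on_trans by blast
      have n: "norm (x + x') \<le> norm x + norm x'" by (rule norm_triangle_ineq)
      have "norm (x + x') < e" "1 / e + norm (x + x') < r" using n x'(1) d by linarith+
      with a S2(1) show ?thesis by (auto simp: W_def)
    qed
    then show "\<exists>d>0. \<forall>Q. is_tiling Q \<and> locally_close d S1 Q \<longrightarrow> Q \<in> W" using d(1) by blast
  qed
  moreover have "S \<in> W" unfolding W_def mem_Collect_eq using S e
    by (intro conjI exI[where x = 0] exI[where x = "1 / e + 1"]) (simp_all add: agree_on_def)
  moreover have "is_tiling S' \<and> locally_close e S S'" if S': "S' \<in> W" for S'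
  proof -
    obtain x r where x: "is_tiling S'" "norm x < e" "1 / e + norm x < r"
        "agree_on (ball 0 r) S (shift_pattern x S')" using S' by (auto simp: W_def)
    have "ball 0 (1 / e) \<subseteq> ball (0 :: real ^ 'a) r"
      using x(3) norm_ge_zero[of x] by (intro subset_ball) linarith
    then show ?thesis using x agree_on_subset unfolding locally_close_def by blast
  qed
  ultimately show thesis by (rule that)
qed

context supertiles
begin

abbreviation X :: "(real ^ 'n, 'l) tile set set" where "X \<equiv> tiling_hull T"

lemma hull_tiling: "S \<in> X \<Longrightarrow> is_tiling S"
proof -
  have "X \<subseteq> Collect is_tiling"
    unfolding tiling_hull_def topspace_local_topology[symmetric] by (rule closure_of_subset_topspace)
  then show "S \<in> X \<Longrightarrow> is_tiling S" by (auto dest: subsetD)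
qed

lemma hull_patch: "S \<in> X \<Longrightarrow> is_patch S"
  using hull_tiling by (simp add: is_tiling_def)

lemma hull_agrees_with_shift:
  assumes S: "S \<in> X"
  shows "\<exists>x. agree_on (ball 0 r) (shift_pattern x T) S"
proof -
  define e where "e = 1 / (\<bar>r\<bar> + 1)"
  have e: "0 < e" "r \<le> 1 / e" by (auto simp: e_def)
  obtain W where W: "openin local_topology W" "S \<in> W"
    "\<And>S'. S' \<in> W \<Longrightarrow> is_tiling S' \<and> locally_close e S S'"
    using locally_close_neighbourhood[OF hull_tiling[OF S] e(1)] by metis
  obtain y where "shift_pattern y T \<in> W"
    using S W(1,2) unfolding tiling_hull_def in_closure_of by blast
  then obtain x where "agree_on (ball 0 (1 / e)) S (shift_pattern x (shift_pattern y T))"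
    using W(3) unfolding locally_close_def by blast
  then have "agree_on (ball 0 r) S (shift_pattern (x + y) T)"
    using agree_on_subset[OF _ subset_ball[OF e(2)]] by simp
  then show ?thesis by (blast intro: agree_on_sym)
qed

text \<open>The small translation allowed by the local topology is absorbed into the translation of
  \<open>T\<close>, so membership in the closure becomes exact agreement with translates of
  \<open>T\<close> on all balls.\<close>

lemma hull_iff: "S \<in> X \<longleftrightarrow> is_tiling S \<and> (\<forall>r. \<exists>x. agree_on (ball 0 r) (shift_pattern x T) S)"
proof
  assume S: "is_tiling S \<and> (\<forall>r. \<exists>x. agree_on (ball 0 r) (shift_pattern x T) S)"
  show "S \<in> X"
    unfolding tiling_hull_def in_closure_of topspace_local_topology
  proof (intro conjI allI impI)
    fix W assume W: "S \<in> W \<and> openin local_topology W"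
    then obtain e where e: "0 < e" "\<And>Q. is_tiling Q \<Longrightarrow> locally_close e S Q \<Longrightarrow> Q \<in> W"
      unfolding openin_local_topology by blast
    obtain x where "agree_on (ball 0 (1 / e)) (shift_pattern x T) S" using S by blast
    then have "locally_close e S (shift_pattern x T)"
      unfolding locally_close_def using e(1) by (intro exI[of _ 0]) (simp add: agree_on_sym)
    then have "shift_pattern x T \<in> W" using e(2) tiling by simp
    then show "\<exists>y. y \<in> range (\<lambda>x. shift_pattern x T) \<and> y \<in> W" by blast
  qed (use S in simp)
qed (simp add: hull_tiling hull_agrees_with_shift)

lemma T_in_hull: "T \<in> X"
  unfolding hull_iff
  by (intro conjI tiling allI exI[where x = 0]) (simp add: agree_on_def)

lemma hull_agrees_on_bounded:
  assumes "S \<in> X" "bounded K"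
  shows "\<exists>x. agree_on K (shift_pattern x T) S"
proof -
  obtain r where "K \<subseteq> ball 0 r" using assms(2) bounded_subset_ballD by blast
  then show ?thesis using hull_agrees_with_shift[OF assms(1), of r] agree_on_subset by blast
qed

lemma shift_in_hull: "S \<in> X \<Longrightarrow> shift_pattern y S \<in> X"
proof -
  assume S: "S \<in> X"
  have "\<exists>x. agree_on (ball 0 r) (shift_pattern x T) (shift_pattern y S)" for r
  proof -
    obtain x where "agree_on (translate (- y) (ball 0 r)) (shift_pattern x T) S"
      using hull_agrees_on_bounded[OF S, of "translate (- y) (ball 0 r)"] by (auto simp: translate_ball)
    then have "agree_on (ball 0 r) (shift_pattern (y + x) T) (shift_pattern y S)"
      by (simp flip: agree_on_shift)
    then show ?thesis ..
  qed
  then show ?thesis using hull_tiling[OF S] by (simp add: hull_iff)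
qed

lemma shift_in_hull_iff [simp]: "shift_pattern y S \<in> X \<longleftrightarrow> S \<in> X"
  using shift_in_hull[of S y] shift_in_hull[of "shift_pattern y S" "- y"] by auto

lemma hull_loc_fin:
  assumes "S \<in> X" "bounded K"
  shows "finite {U \<in> S. supp U \<inter> K \<noteq> {}}"
proof -
  obtain x where x: "agree_on K (shift_pattern x T) S" using hull_agrees_on_bounded[OF assms] ..
  have "{U \<in> shift_pattern x T. supp U \<inter> K \<noteq> {}} = shift_pattern x {U \<in> T. supp U \<inter> translate (- x) K \<noteq> {}}"
  proof -
    have "translate (- x) (supp U) \<inter> translate (- x) K \<noteq> {} \<longleftrightarrow> supp U \<inter> K \<noteq> {}" for U :: "(real ^ 'n, 'l) tile"
      by (simp flip: translate_Int)
    then show ?thesis by (auto simp: mem_shift_pattern)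
  qed
  moreover have "bounded (translate (- x) K)"
    unfolding translate_eq_plus_image by (rule bounded_translation[OF assms(2)])
  ultimately have "finite {U \<in> shift_pattern x T. supp U \<inter> K \<noteq> {}}"
    using loc_fin[of "translate (- x) K"] by (simp only: finite_shift_pattern)
  then show ?thesis using x unfolding agree_on_def by (simp only:)
qed

text \<open>Every finite nonempty subpatch of a hull tiling is a translate of such a patch. Taking
  them from the one countable tiling \<open>T\<close> leaves countably many.\<close>

definition pieces :: "(real ^ 'n, 'l) tile set set" where
  "pieces = {F. F \<subseteq> T \<and> finite F \<and> F \<noteq> {}}"

lemma countable_T: "countable T"
proof -
  have "T \<subseteq> (\<Union>n. {U \<in> T. supp U \<inter> ball 0 (real n) \<noteq> {}})"
  proof -
    have "\<exists>n. supp U \<inter> ball 0 (real n) \<noteq> {}" if "U \<in> T" for U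
    proof -
      have "supp U \<noteq> {}" using that patch_T by (auto simp: is_patch_def is_pattern_def is_tile_def)
      then obtain z where "z \<in> supp U" by blast
      moreover obtain n where "norm z < real n" using reals_Archimedean2 by blast
      ultimately have "z \<in> supp U \<inter> ball 0 (real n)" by simp
      then show ?thesis by blast
    qed
    then show ?thesis by blast
  qed
  moreover have "countable {U \<in> T. supp U \<inter> ball 0 (real n) \<noteq> {}}" for n
    by (rule countable_finite[OF loc_fin]) simp
  then have "countable (\<Union>n. {U \<in> T. supp U \<inter> ball 0 (real n) \<noteq> {}})" by simp
  ultimately show ?thesis by (rule countable_subset)
qed

lemma countable_pieces: "countable pieces"
  using countable_Collect_finite_subset[OF countable_T] unfolding pieces_def
  by (rule countable_subset[rotated]) auto

lemma piece_bounded: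
  assumes "F \<in> pieces" obtains R where "support F \<subseteq> ball 0 R"
proof -
  have "compact (supp U)" if "U \<in> F" for U
    using that assms patch_T by (auto simp: pieces_def is_patch_def is_pattern_def is_tile_def)
  then have "bounded (support F)"
    using assms unfolding support_def by (intro bounded_UN) (auto simp: pieces_def compact_imp_bounded)
  then show thesis using that bounded_subset_ballD by blast
qed

lemma piece_transfer:
  assumes F: "F \<in> pieces" and K: "translate v (support F) \<subseteq> K" and ag: "agree_on K S S'"
    and sub: "shift_pattern v F \<subseteq> S"
  shows "shift_pattern v F \<subseteq> S'"
proof
  fix U assume U: "U \<in> shift_pattern v F"
  then obtain U' where U': "U = shift_tile v U'" "U' \<in> F" by (auto simp: shift_pattern_def)
  have "supp U' \<noteq> {}"
    using U'(2) F patch_T by (auto simp: pieces_def is_patch_def is_pattern_def is_tile_def)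
  moreover have "supp U' \<subseteq> support F" using U' by (auto simp: support_def)
  ultimately have "supp U \<inter> K \<noteq> {}" using K unfolding U' supp_shift_tile by (auto simp: translate_def)
  then show "U \<in> S'" using ag U sub unfolding agree_on_def by blast
qed

text \<open>Both the patch and the set of allowed positions are data: an open \<open>Z\<close> gives
  an open set of the hull, a compact \<open>Z\<close> a closed one, and a bounded \<open>Z\<close> a
  condition on a bounded window.\<close>

definition cyl :: "(real ^ 'n, 'l) tile set \<Rightarrow> (real ^ 'n) set \<Rightarrow> (real ^ 'n, 'l) tile set set" where
  "cyl F Z = {S \<in> X. \<exists>v\<in>Z. shift_pattern v F \<subseteq> S}"

lemma cyl_subset: "cyl F Z \<subseteq> X"
  by (auto simp: cyl_def)

lemma piece_occurrences_separated:
  assumes "F \<in> pieces" "S \<in> X"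
  obtains r where "0 < r"
    "\<And>x y. shift_pattern x F \<subseteq> S \<Longrightarrow> shift_pattern y F \<subseteq> S \<Longrightarrow> x \<noteq> y \<Longrightarrow> r \<le> dist x y"
proof -
  obtain U where U: "U \<in> F" using assms by (auto simp: pieces_def)
  then have "is_tile U" using assms patch_T by (auto simp: pieces_def is_patch_def is_pattern_def)
  then obtain r where r: "0 < r"
    "\<And>x y. shift_tile x U \<in> S \<Longrightarrow> shift_tile y U \<in> S \<Longrightarrow> x \<noteq> y \<Longrightarrow> r \<le> dist x y"
    using shifted_copies_separated[OF hull_patch[OF assms(2)]] by metis
  have "shift_tile x U \<in> S" if "shift_pattern x F \<subseteq> S" for x
    using that U by (auto simp: shift_pattern_def)
  with r that show thesis by blast
qed

section \<open>The topology of the hull in terms of cylinders\<close>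

definition HT :: "(real ^ 'n, 'l) tile set topology" where
  "HT = subtopology local_topology X"

lemma topspace_HT [simp]: "topspace HT = X"
proof -
  have "X \<subseteq> Collect is_tiling" using hull_tiling by blast
  then show ?thesis by (auto simp: HT_def topspace_subtopology topspace_local_topology)
qed

lemma ball_translate_bound:
  assumes "support F \<subseteq> ball 0 R" "norm v \<le> K"
  shows "translate v (support F) \<subseteq> ball 0 (R + K)"
proof
  fix z assume "z \<in> translate v (support F)"
  then have "norm (z - v) < R" using assms(1) by (auto simp: mem_translate)
  then show "z \<in> ball 0 (R + K)" using assms(2) norm_triangle_ineq[of "z - v" v] by simp
qed

text \<open>Closeness within \<open>e\<close> moves the occurrence by less than \<open>e\<close>,
  which keeps it in the open set \<open>Z\<close>, provided that the window of agreement contains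
  the occurrence.\<close>

lemma openin_cyl:
  assumes F: "F \<in> pieces" and Z: "open Z"
  shows "openin HT (cyl F Z)"
proof -
  define G where "G = {S. is_tiling S \<and> (\<exists>v\<in>Z. shift_pattern v F \<subseteq> S)}"
  obtain R where R: "support F \<subseteq> ball 0 R" using piece_bounded[OF F] .
  have "openin local_topology G"
    unfolding openin_local_topology
  proof (intro conjI ballI)
    show "G \<subseteq> Collect is_tiling" by (auto simp: G_def)
    fix S assume "S \<in> G"
    then obtain v where v: "v \<in> Z" "shift_pattern v F \<subseteq> S" by (auto simp: G_def)
    obtain \<delta> where \<delta>: "0 < \<delta>" "ball v \<delta> \<subseteq> Z" using Z v(1) open_contains_ball by blast
    define B where "B = \<bar>R\<bar> + norm v + 1"
    define e where "e = min \<delta> (1 / B)"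
    have B: "0 < B" unfolding B_def using norm_ge_zero[of v] by linarith
    then have e: "0 < e" "e \<le> \<delta>" "e \<le> 1 / B" using \<delta>(1) by (simp_all add: e_def)
    then have e: "0 < e" "e \<le> \<delta>" "B \<le> 1 / e" using B by (simp_all add: field_simps)
    have "S' \<in> G" if S': "is_tiling S'" "locally_close e S S'" for S'
    proof -
      obtain x where x: "norm x < e" "agree_on (ball 0 (1 / e)) S (shift_pattern x S')"
        using S'(2) by (auto simp: locally_close_def)
      have "translate v (support F) \<subseteq> ball 0 (R + norm v)" by (rule ball_translate_bound[OF R]) simp
      also have "\<dots> \<subseteq> ball 0 (1 / e)" using e(3) by (intro subset_ball) (simp add: B_def)
      finally have "shift_pattern v F \<subseteq> shift_pattern x S'"
        using piece_transfer[OF F _ x(2) v(2)] by blast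
      then have "shift_pattern (v - x) F \<subseteq> S'"
        unfolding shift_pattern_subset_iff by simp
      moreover have "v - x \<in> Z" using \<delta>(2) e(2) x(1) by (auto simp: subset_iff dist_norm)
      ultimately show ?thesis using S'(1) by (auto simp: G_def)
    qed
    then show "\<exists>e>0. \<forall>Q. is_tiling Q \<and> locally_close e S Q \<longrightarrow> Q \<in> G" using e(1) by blast
  qed
  moreover have "cyl F Z = G \<inter> X" using hull_tiling by (auto simp: cyl_def G_def)
  ultimately show ?thesis unfolding HT_def openin_subtopology by blast
qed

text \<open>Occurrences of \<open>F\<close> in \<open>S\<close> are separated, so those near
  \<open>Z\<close> are finitely many and keep a positive distance from \<open>Z\<close>. A
  sufficiently close tiling moves them by less than that distance.\<close>

lemma closedin_cyl:
  assumes F: "F \<in> pieces" and Z: "compact Z"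
  shows "closedin HT (cyl F Z)"
proof -
  have "openin HT (X - cyl F Z)"
  proof (subst openin_subopen, intro ballI)
    fix S assume S: "S \<in> X - cyl F Z"
    let ?Y = "{w. shift_pattern w F \<subseteq> S}"
    obtain r where r: "0 < r" "\<And>x y. x \<in> ?Y \<Longrightarrow> y \<in> ?Y \<Longrightarrow> x \<noteq> y \<Longrightarrow> r \<le> dist x y"
      using piece_occurrences_separated[OF F, of S] S by auto
    obtain K where K: "0 < K" "Z \<subseteq> ball 0 K" using Z compact_imp_bounded bounded_subset_ballD by blast
    have "finite (?Y \<inter> translate 0 (ball 0 (K + 1)))"
      using separated_set_count[of r ?Y "ball 0 (K + 1)", OF r bounded_ball] by blast
    then have cl: "closed (?Y \<inter> ball 0 (K + 1))" by (simp add: finite_imp_closed)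
    have disj: "?Y \<inter> ball 0 (K + 1) \<inter> Z = {}" using S by (auto simp: cyl_def)
    obtain d where d0: "0 < d \<and> (\<forall>y\<in>?Y \<inter> ball 0 (K + 1). \<forall>v\<in>Z. d \<le> dist y v)"
      using separate_closed_compact[OF cl Z disj] ..
    have d: "0 < d" "\<And>y v. y \<in> ?Y \<inter> ball 0 (K + 1) \<Longrightarrow> v \<in> Z \<Longrightarrow> d \<le> dist y v"
      using d0 by simp_all
    obtain R where R: "support F \<subseteq> ball 0 R" using piece_bounded[OF F] .
    define M where "M = \<bar>R\<bar> + K + 1"
    \<comment> \<open>The bound 1 keeps a moved occurrence inside the ball of radius
      \<open>K + 1\<close>, \<open>d\<close> keeps it off \<open>Z\<close>, and \<open>1 / M\<close>
      makes the window large enough to see it.\<close>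
    define e where "e = min (min 1 d) (1 / M)"
    have M: "0 < M" using K(1) by (simp add: M_def)
    then have e: "0 < e" using d(1) by (simp add: e_def)
    have "e \<le> 1 / M" "e \<le> 1" "e \<le> d" unfolding e_def by (simp_all add: min_le_iff_disj)
    then have e': "M \<le> 1 / e" "e \<le> 1" "e \<le> d" using e M by (simp_all add: field_simps)
    obtain W where W: "openin local_topology W" "S \<in> W"
      "\<And>S'. S' \<in> W \<Longrightarrow> is_tiling S' \<and> locally_close e S S'"
      using locally_close_neighbourhood[OF hull_tiling e, of S] S by (metis DiffD1)
    have 1: "openin HT (W \<inter> X)" using W(1) unfolding HT_def openin_subtopology by blast
    have 2: "S \<in> W \<inter> X" using W(2) S by blast
    have 3: "W \<inter> X \<subseteq> X - cyl F Z"
    proof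
      fix S' assume S': "S' \<in> W \<inter> X"
      then obtain x where x: "norm x < e" "agree_on (ball 0 (1 / e)) S (shift_pattern x S')"
        using W(3) unfolding locally_close_def by blast
      have "\<not> shift_pattern v F \<subseteq> S'" if v: "v \<in> Z" for v
      proof
        assume "shift_pattern v F \<subseteq> S'"
        from shift_pattern_mono[OF this, of x]
        have s: "shift_pattern (x + v) F \<subseteq> shift_pattern x S'" by simp
        have nv: "norm v < K" using K(2) v by auto
        have xv: "norm (x + v) \<le> K + norm x" using nv norm_triangle_ineq[of x v] by linarith
        have "translate (x + v) (support F) \<subseteq> ball 0 (R + (K + norm x))"
          by (rule ball_translate_bound[OF R xv])
        also have "\<dots> \<subseteq> ball 0 (1 / e)"
          using x(1) e' abs_ge_self[of R] unfolding M_def by (intro subset_ball) linarith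
        finally have "shift_pattern (x + v) F \<subseteq> S"
          using piece_transfer[OF F _ agree_on_sym[OF x(2)] s] by blast
        moreover have "x + v \<in> ball 0 (K + 1)"
          using nv x(1) e'(2) norm_triangle_ineq[of x v] unfolding mem_ball_0 by linarith
        ultimately have "d \<le> dist (x + v) v" by (intro d(2)[OF _ v] IntI CollectI)
        then show False using x(1) e'(3) by (simp add: dist_norm)
      qed
      then show "S' \<in> X - cyl F Z" using S' by (auto simp: cyl_def)
    qed
    show "\<exists>W. openin HT W \<and> S \<in> W \<and> W \<subseteq> X - cyl F Z" using 1 2 3 by blast
  qed
  then show ?thesis by (simp add: closedin_def cyl_subset)
qed

lemma covering_subpatch:
  assumes S: "S \<in> X" and r: "0 < r"
  obtains F x where "F \<in> pieces" "shift_pattern x F \<subseteq> S" "ball 0 r \<subseteq> support (shift_pattern x F)"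
proof -
  define P0 where "P0 = {U \<in> S. supp U \<inter> ball 0 r \<noteq> {}}"
  obtain x where x: "agree_on (ball 0 r) (shift_pattern x T) S" using hull_agrees_with_shift[OF S] ..
  have fin: "finite P0" unfolding P0_def using hull_loc_fin[OF S] by simp
  have cov: "ball 0 r \<subseteq> support P0"
  proof
    fix z :: "real ^ 'n" assume z: "z \<in> ball 0 r"
    have "z \<in> support S" using hull_tiling[OF S] by (simp add: is_tiling_def)
    then obtain U where "U \<in> S" "z \<in> supp U" by (auto simp: support_def)
    moreover from this z have "supp U \<inter> ball 0 r \<noteq> {}" by blast
    ultimately show "z \<in> support P0" unfolding support_def P0_def by blast
  qed
  have P0T: "P0 \<subseteq> shift_pattern x T" using x unfolding P0_def agree_on_def by blast
  have ne: "P0 \<noteq> {}"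
  proof
    assume "P0 = {}"
    then have "ball (0 :: real ^ 'n) r = {}" using cov by (simp add: support_def)
    with r show False by simp
  qed
  define F where "F = shift_pattern (- x) P0"
  have eq: "shift_pattern x F = P0" by (simp add: F_def)
  have "F \<subseteq> T" using P0T shift_pattern_mono[of P0 "shift_pattern x T" "- x"] by (simp add: F_def)
  moreover have "finite F" using fin by (simp add: F_def)
  moreover have "F \<noteq> {}" using ne by (simp add: F_def shift_pattern_def)
  ultimately have "F \<in> pieces" by (simp add: pieces_def)
  moreover have "P0 \<subseteq> S" by (auto simp: P0_def)
  ultimately show thesis using that[of F x] cov unfolding eq by blast
qed

text \<open>A finite patch of \<open>S\<close> covering the ball of radius \<open>1 / e\<close>
  determines everything in that ball; any hull tiling that contains it displaced by less than
  \<open>e\<close> is locally close to \<open>S\<close>.\<close>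

lemma open_contains_cyl:
  assumes W: "openin HT W" and S: "S \<in> W"
  obtains F x e where "F \<in> pieces" "0 < e" "shift_pattern x F \<subseteq> S" "cyl F (ball x e) \<subseteq> W"
proof -
  obtain G where G: "openin local_topology G" "W = G \<inter> X"
    using W unfolding HT_def openin_subtopology by blast
  then obtain e where e: "0 < e" "\<And>Q. is_tiling Q \<Longrightarrow> locally_close e S Q \<Longrightarrow> Q \<in> G"
    using S unfolding openin_local_topology by blast
  have SX: "S \<in> X" using S G by blast
  have "0 < 1 / e" using e by simp
  then obtain F x where F: "F \<in> pieces" "shift_pattern x F \<subseteq> S" "ball 0 (1 / e) \<subseteq> support (shift_pattern x F)"
    using covering_subpatch[OF SX] by metis
  have "cyl F (ball x e) \<subseteq> W"
  proof
    fix S' assume "S' \<in> cyl F (ball x e)"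
    then obtain v where v: "S' \<in> X" "dist x v < e" "shift_pattern v F \<subseteq> S'" by (auto simp: cyl_def)
    have "shift_pattern x F \<subseteq> shift_pattern (x - v) S'"
      using shift_pattern_mono[OF v(3), of "x - v"] by simp
    then have "agree_on (ball 0 (1 / e)) S (shift_pattern (x - v) S')"
      using F hull_patch[OF SX] hull_patch[OF v(1)]
      by (intro agree_on_if_common_cover[of _ _ "shift_pattern x F"]) auto
    then have "locally_close e S S'" using v(2) unfolding locally_close_def by (auto simp: dist_norm)
    then have "S' \<in> G" using e(2) hull_tiling[OF v(1)] by blast
    then show "S' \<in> W" using G(2) v(1) by blast
  qed
  with F e(1) that show thesis by blast
qed

section \<open>Borel sets of the hull and measurability of translation\<close>

definition HM :: "(real ^ 'n, 'l) tile set measure" where "HM = borel_of HT"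

lemma space_HM [simp]: "space HM = X"
  by (simp add: HM_def borel_of_def space_measure_of_conv)

lemma sets_HM: "sets HM = sigma_sets X {W. openin HT W}"
  unfolding HM_def borel_of_def topspace_HT
  by (rule sets_measure_of) (use openin_subset[of HT] in auto)

lemma open_in_sets_HM: "openin HT W \<Longrightarrow> W \<in> sets HM"
  by (auto simp: sets_HM)

lemma closed_in_sets_HM: "closedin HT W \<Longrightarrow> W \<in> sets HM"
  unfolding closedin_def topspace_HT
  by (metis double_diff open_in_sets_HM order_refl sets.compl_sets space_HM)

definition open_cyls :: "(real ^ 'n, 'l) tile set set set" where
  "open_cyls = {cyl F Z | F Z. F \<in> pieces \<and> open Z \<and> bounded Z}"

text \<open>There are countably many pieces, and their positions may be restricted to a countable
  base of the space, so countably many cylinders generate the Borel sets.\<close>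

lemma open_is_countable_union_of_cyls:
  assumes W: "openin HT W"
  shows "\<exists>\<C>. countable \<C> \<and> \<C> \<subseteq> open_cyls \<and> W = \<Union>\<C>"
proof -
  obtain \<B> :: "(real ^ 'n) set set" where \<B>: "countable \<B>" "topological_basis \<B>"
    using ex_countable_basis by blast
  define \<C> where "\<C> = (\<lambda>(F, Z). cyl F Z) ` {(F, Z). F \<in> pieces \<and> Z \<in> \<B> \<and> bounded Z \<and> cyl F Z \<subseteq> W}"
  have "countable {(F, Z). F \<in> pieces \<and> Z \<in> \<B> \<and> bounded Z \<and> cyl F Z \<subseteq> W}"
    by (rule countable_subset[OF _ countable_SIGMA[OF countable_pieces \<B>(1)]]) auto
  then have "countable \<C>" by (simp add: \<C>_def)
  moreover have "\<C> \<subseteq> open_cyls"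
    using topological_basis_open[OF \<B>(2)] by (auto simp: \<C>_def open_cyls_def)
  moreover have "W \<subseteq> \<Union>\<C>"
  proof
    fix S assume S: "S \<in> W"
    obtain F x e where F: "F \<in> pieces" "0 < e" "shift_pattern x F \<subseteq> S" "cyl F (ball x e) \<subseteq> W"
      using open_contains_cyl[OF W S] .
    obtain Z where Z: "Z \<in> \<B>" "x \<in> Z" "Z \<subseteq> ball x e"
      using topological_basisE[OF \<B>(2) open_ball, of x x e] F(2) by auto
    have SX: "S \<in> X" using S openin_subset[OF W] by auto
    have "cyl F Z \<subseteq> W" using Z(3) F(4) unfolding cyl_def by blast
    moreover have "bounded Z" using Z(3) bounded_ball bounded_subset by blast
    ultimately have "cyl F Z \<in> \<C>" using F(1) Z(1) unfolding \<C>_def by (intro image_eqI[of _ _ "(F, Z)"]) auto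
    moreover have "S \<in> cyl F Z" using SX Z(2) F(3) by (auto simp: cyl_def)
    ultimately show "S \<in> \<Union>\<C>" by blast
  qed
  moreover have "\<Union>\<C> \<subseteq> W" by (auto simp: \<C>_def)
  ultimately show ?thesis by blast
qed

lemma sets_HM_cyls: "sets HM = sigma_sets X open_cyls"
proof
  have sa: "sigma_algebra X (sigma_sets X open_cyls)"
    by (rule sigma_algebra_sigma_sets) (auto simp: open_cyls_def cyl_def)
  show "sets HM \<subseteq> sigma_sets X open_cyls"
    unfolding sets_HM
  proof (rule sigma_sets_mono, rule subsetI)
    fix W assume "W \<in> {W. openin HT W}"
    then obtain \<C> where \<C>: "countable \<C>" "\<C> \<subseteq> open_cyls" "W = \<Union>\<C>"
      using open_is_countable_union_of_cyls by blast
    have "\<Union>\<C> \<in> sigma_sets X open_cyls"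
      using \<C> by (intro sigma_algebra.countable_Union[OF sa]) (auto intro: sigma_sets.Basic)
    then show "W \<in> sigma_sets X open_cyls" using \<C>(3) by simp
  qed
  show "sigma_sets X open_cyls \<subseteq> sets HM"
    unfolding sets_HM
    by (rule sigma_sets_mono) (auto simp: open_cyls_def intro!: openin_cyl)
qed

lemma measurable_HM_I:
  assumes "f \<in> space M \<rightarrow> X"
    and "\<And>F Z. F \<in> pieces \<Longrightarrow> open Z \<Longrightarrow> f -` cyl F Z \<inter> space M \<in> sets M"
  shows "f \<in> measurable M HM"
proof (rule measurable_sigma_sets[where \<Omega> = X and A = open_cyls])
  show "sets HM = sigma_sets X open_cyls" by (rule sets_HM_cyls)
  show "open_cyls \<subseteq> Pow X" by (auto simp: open_cyls_def cyl_def)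
qed (use assms in \<open>auto simp: open_cyls_def\<close>)

text \<open>Joint measurability is what Fubini's theorem will require. An occurrence at
  \<open>w\<close> in \<open>S\<close> is seen at \<open>w - y\<close> from \<open>y\<close>;
  covering the open set of pairs with \<open>w - y\<close> in \<open>Z\<close> by basic rectangles
  turns the preimage into a countable union of products.\<close>

lemma joint_shift_measurable:
  "(\<lambda>(S, y). shift_pattern (- y) S) \<in> measurable (HM \<Otimes>\<^sub>M borel) HM"
proof (rule measurable_HM_I)
  show "(\<lambda>(S, y). shift_pattern (- y) S) \<in> space (HM \<Otimes>\<^sub>M borel) \<rightarrow> X"
    by (auto simp: space_pair_measure)
  fix F Z assume F: "F \<in> pieces" and Z: "open (Z :: (real ^ 'n) set)"
  obtain \<B> :: "(real ^ 'n) set set" where \<B>: "countable \<B>" "topological_basis \<B>"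
    using ex_countable_basis by blast
  define I where "I = {(a, b). a \<in> \<B> \<and> b \<in> \<B> \<and> (\<forall>w\<in>a. \<forall>y\<in>b. w - y \<in> Z)}"
  have "countable I" by (rule countable_subset[OF _ countable_SIGMA[OF \<B>(1) \<B>(1)]]) (auto simp: I_def)
  have "(\<lambda>(S, y). shift_pattern (- y) S) -` cyl F Z \<inter> space (HM \<Otimes>\<^sub>M borel)
      = (\<Union>(a, b)\<in>I. cyl F a \<times> b)" (is "?L = ?R")
  proof
    show "?L \<subseteq> ?R"
    proof
      fix p assume p: "p \<in> ?L"
      obtain S y where Sy: "p = (S, y)" by force
      with p obtain v where v: "S \<in> X" "v \<in> Z" "shift_pattern v F \<subseteq> shift_pattern (- y) S"
        by (auto simp: cyl_def space_pair_measure)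
      have sub: "shift_pattern (v + y) F \<subseteq> S"
        using shift_pattern_mono[OF v(3), of y] by (simp add: add.commute)
      have "open ((\<lambda>(w, y). w - y) -` Z)"
        using Z by (intro open_vimage) (auto simp: case_prod_beta intro!: continuous_intros)
      moreover have "(v + y, y) \<in> (\<lambda>(w, y). w - y) -` Z" using v(2) by simp
      ultimately obtain A C where AC: "open A" "open C" "v + y \<in> A" "y \<in> C" "A \<times> C \<subseteq> (\<lambda>(w, y). w - y) -` Z"
        by (rule open_prod_elim) auto
      obtain a where a: "a \<in> \<B>" "v + y \<in> a" "a \<subseteq> A" using topological_basisE[OF \<B>(2) AC(1,3)] .
      obtain b where b: "b \<in> \<B>" "y \<in> b" "b \<subseteq> C" using topological_basisE[OF \<B>(2) AC(2,4)] .
      have "w - y' \<in> Z" if "w \<in> a" "y' \<in> b" for w y'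
      proof -
        have "(w, y') \<in> A \<times> C" using that a(3) b(3) by blast
        then have "(w, y') \<in> (\<lambda>(w, y). w - y) -` Z" using AC(5) by blast
        then show ?thesis by simp
      qed
      then have "(a, b) \<in> I" using a(1) b(1) by (auto simp: I_def)
      moreover have "p \<in> cyl F a \<times> b" using Sy v(1) sub a(2) b(2) by (auto simp: cyl_def)
      ultimately show "p \<in> ?R" by blast
    qed
    show "?R \<subseteq> ?L"
    proof
      fix p assume "p \<in> ?R"
      then obtain a b S y w where *: "(a, b) \<in> I" "p = (S, y)" "S \<in> X" "y \<in> b" "w \<in> a" "shift_pattern w F \<subseteq> S"
        by (auto simp: cyl_def)
      have "shift_pattern (w - y) F \<subseteq> shift_pattern (- y) S"
        using shift_pattern_mono[OF *(6), of "- y"] by (simp add: algebra_simps)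
      moreover have "w - y \<in> Z" using * by (auto simp: I_def)
      ultimately show "p \<in> ?L" using *(2,3) by (auto simp: cyl_def space_pair_measure)
    qed
  qed
  moreover have "?R \<in> sets (HM \<Otimes>\<^sub>M borel)"
  proof (rule sets.countable_UN''[OF \<open>countable I\<close>])
    fix p assume "p \<in> I"
    then show "(case p of (a, b) \<Rightarrow> cyl F a \<times> b) \<in> sets (HM \<Otimes>\<^sub>M borel)"
      using topological_basis_open[OF \<B>(2)] openin_cyl[OF F]
      by (auto simp: I_def intro!: pair_measureI open_in_sets_HM)
  qed
  ultimately show "?L \<in> sets (HM \<Otimes>\<^sub>M borel)" by simp
qed

lemma shift_measurable: "shift_pattern y \<in> measurable HM HM"
proof -
  have "(\<lambda>S. (\<lambda>(S, y). shift_pattern (- y) S) (S, - y)) \<in> measurable HM HM"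
    by (rule measurable_compose[OF measurable_Pair2' joint_shift_measurable]) simp
  then show ?thesis by simp
qed

lemma orbit_measurable: "S \<in> X \<Longrightarrow> (\<lambda>y. shift_pattern (- y) S) \<in> measurable borel HM"
  using measurable_compose[OF measurable_Pair1' joint_shift_measurable, of S] by simp

end

section \<open>Densities of local events and uniqueness\<close>

lemma has_mean_cong:
  "has_mean N c \<Longrightarrow> (\<And>E. bmeas E \<Longrightarrow> N' E = N E) \<Longrightarrow> has_mean N' c"
  unfolding has_mean_def by simp

lemma has_mean_vol: "has_mean vol 1"
  unfolding has_mean_def by (intro allI impI exI[where x = 1] exI[where x = 0] conjI) simp_all

lemma has_mean_zero: "has_mean (\<lambda>E. 0) 0"
  unfolding has_mean_def by (intro allI impI exI[where x = 1] exI[where x = 0] conjI) simp_all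

lemma has_mean_add:
  assumes "has_mean N c" "has_mean N' c'"
  shows "has_mean (\<lambda>E. N E + N' E) (c + c')"
  unfolding has_mean_def
proof (intro allI impI)
  fix \<epsilon> :: real assume "0 < \<epsilon>"
  then have h: "0 < \<epsilon> / 2" by simp
  obtain L C where L: "0 < L" "0 \<le> C"
    "\<And>E. bmeas E \<Longrightarrow> \<bar>N E - c * vol E\<bar> \<le> \<epsilon> / 2 * vol E + C * vol (thick_boundary L E)"
    using assms(1) h unfolding has_mean_def by meson
  obtain L' C' where L': "0 < L'" "0 \<le> C'"
    "\<And>E. bmeas E \<Longrightarrow> \<bar>N' E - c' * vol E\<bar> \<le> \<epsilon> / 2 * vol E + C' * vol (thick_boundary L' E)"
    using assms(2) h unfolding has_mean_def by meson
  let ?L = "max L L'"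
  have "\<bar>N E + N' E - (c + c') * vol E\<bar> \<le> \<epsilon> * vol E + (C + C') * vol (thick_boundary ?L E)"
    if E: "bmeas E" for E
  proof -
    have "vol (thick_boundary L E) \<le> vol (thick_boundary ?L E)"
      "vol (thick_boundary L' E) \<le> vol (thick_boundary ?L E)"
      using E by (auto intro!: vol_mono thick_boundary_mono)
    then have "C * vol (thick_boundary L E) \<le> C * vol (thick_boundary ?L E)"
      "C' * vol (thick_boundary L' E) \<le> C' * vol (thick_boundary ?L E)"
      using L(2) L'(2) by (auto intro: mult_left_mono)
    with L(3)[OF E] L'(3)[OF E] have "\<bar>N E - c * vol E\<bar> + \<bar>N' E - c' * vol E\<bar>
        \<le> (\<epsilon> / 2 * vol E + \<epsilon> / 2 * vol E) + (C * vol (thick_boundary ?L E) + C' * vol (thick_boundary ?L E))"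
      by linarith
    also have "\<dots> = \<epsilon> * vol E + (C + C') * vol (thick_boundary ?L E)" by (simp add: distrib_right)
    finally have 1: "\<bar>N E - c * vol E\<bar> + \<bar>N' E - c' * vol E\<bar> \<le> \<epsilon> * vol E + (C + C') * vol (thick_boundary ?L E)" .
    have "N E + N' E - (c + c') * vol E = (N E - c * vol E) + (N' E - c' * vol E)" by (simp add: distrib_right)
    then have "\<bar>N E + N' E - (c + c') * vol E\<bar> \<le> \<bar>N E - c * vol E\<bar> + \<bar>N' E - c' * vol E\<bar>"
      by (simp only: abs_triangle_ineq)
    with 1 show ?thesis by linarith
  qed
  moreover have "0 < ?L" "0 \<le> C + C'" using L L' by auto
  ultimately show "\<exists>L>0. \<exists>C\<ge>0. \<forall>E. bmeas E \<longrightarrow>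
      \<bar>N E + N' E - (c + c') * vol E\<bar> \<le> \<epsilon> * vol E + C * vol (thick_boundary L E)"
    by (intro exI[where x = ?L] conjI exI[where x = "C + C'"] allI impI)
qed

lemma has_mean_translate:
  fixes a :: "real ^ 'n"
  assumes "has_mean N c" shows "has_mean (\<lambda>E. N (translate a E)) c"
  unfolding has_mean_def
proof (intro allI impI)
  fix \<epsilon> :: real assume "0 < \<epsilon>"
  then obtain L C where L: "0 < L" "0 \<le> C"
    "\<And>E. bmeas E \<Longrightarrow> \<bar>N E - c * vol E\<bar> \<le> \<epsilon> * vol E + C * vol (thick_boundary L E)"
    using assms unfolding has_mean_def by meson
  have "\<bar>N (translate a E) - c * vol E\<bar> \<le> \<epsilon> * vol E + C * vol (thick_boundary L E)" if "bmeas E" for E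
    using L(3)[of "translate a E"] that by simp
  with L(1,2) show "\<exists>L>0. \<exists>C\<ge>0. \<forall>E. bmeas E \<longrightarrow>
      \<bar>N (translate a E) - c * vol E\<bar> \<le> \<epsilon> * vol E + C * vol (thick_boundary L E)"
    by (intro exI[where x = L] conjI exI[where x = C] allI impI)
qed

context hierarchy
begin

text \<open>A bound on the cells of one fixed level passes to every bounded measurable set up to a
  boundary term, which is negligible on a cell of a much higher level.\<close>

lemma has_mean_le_if_cells:
  assumes N: "additive_on_bounded N" and m: "has_mean N c" and a: "0 \<le> a"
    and le: "\<And>z. N (\<psi> n ` translate z Q) \<le> a * V n"
  shows "c \<le> a"
proof (rule field_le_epsilon)
  fix e :: real assume e: "0 < e"
  obtain L where L: "0 < L" "\<And>N a E. additive_on_bounded N \<Longrightarrow> 0 \<le> a \<Longrightarrow> bmeas E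
       \<Longrightarrow> (\<And>z. N (translate z (\<psi> n ` Q)) \<le> a * vol (\<psi> n ` Q))
       \<Longrightarrow> N E \<le> a * (vol E + vol (thick_boundary L E))"
    using cell_estimates[OF lin bij s, of n] by metis
  have cells: "N (translate z (\<psi> n ` Q)) \<le> a * vol (\<psi> n ` Q)" for z
  proof -
    obtain z' where "z = \<psi> n z'" using bij[of n] by (metis bij_pointE)
    then show ?thesis using le[of z'] by (simp add: image_translate_linear[OF lin] V_def)
  qed
  define \<epsilon> where "\<epsilon> = e / (2 * (a + 1))"
  have \<epsilon>: "0 < \<epsilon>" "0 < e / 2" using e a by (auto simp: \<epsilon>_def)
  obtain j where j: "\<bar>N (\<psi> j ` translate 0 Q) - c * V j\<bar> \<le> e / 2 * V j"
    "vol (thick_boundary L (\<psi> j ` translate 0 Q)) \<le> \<epsilon> * V j"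
    using eventually_happens'[OF sequentially_bot
        eventually_conj[OF has_mean_cells[OF m \<epsilon>(2)] small_boundary[OF \<epsilon>(1), of L]]] by blast
  let ?E = "\<psi> j ` translate 0 Q"
  have "N ?E \<le> a * (vol ?E + vol (thick_boundary L ?E))"
    by (rule L(2)[OF N a _ cells]) (simp add: bmeas_image)
  also have "\<dots> \<le> a * (V j + \<epsilon> * V j)"
    using j(2) a by (intro mult_left_mono) (simp_all add: vol_image_Q del: translate_0)
  also have "\<dots> \<le> a * V j + e / 2 * V j"
  proof -
    have "a * \<epsilon> \<le> e / 2" using a e by (simp add: \<epsilon>_def field_simps)
    then have "a * \<epsilon> * V j \<le> e / 2 * V j" using V_pos[of j] by (intro mult_right_mono) auto
    then show ?thesis by (simp add: distrib_left)
  qed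
  finally have "c * V j \<le> a * V j + e / 2 * V j + e / 2 * V j" using j(1) by linarith
  then have "c * V j \<le> (a + e) * V j" by (simp add: distrib_right)
  then show "c \<le> a + e" using V_pos[of j] by simp
qed

end

context supertiles
begin

section \<open>Local events and their densities\<close>

definition local_on :: "real \<Rightarrow> (real ^ 'n, 'l) tile set set \<Rightarrow> bool" where
  "local_on R F \<longleftrightarrow> (\<forall>S\<in>X. \<forall>S'\<in>X. agree_on (ball 0 R) S S' \<longrightarrow> (S \<in> F \<longleftrightarrow> S' \<in> F))"

definition local_events :: "(real ^ 'n, 'l) tile set set set" where
  "local_events = {F. F \<in> sets HM \<and> (\<exists>R. local_on R F)}"

text \<open>The hitting times of an event: shifting by \<open>- y\<close> places the point
  \<open>y\<close> of \<open>S\<close> at the origin, so \<open>F\<close> is tested as seen from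
  \<open>y\<close>.\<close>

definition hits :: "(real ^ 'n, 'l) tile set \<Rightarrow> (real ^ 'n, 'l) tile set set \<Rightarrow> (real ^ 'n) set" where
  "hits S F = {y. shift_pattern (- y) S \<in> F}"

lemma local_on_mono: "local_on R F \<Longrightarrow> R \<le> R' \<Longrightarrow> local_on R' F"
  unfolding local_on_def by (meson agree_on_subset subset_ball)

lemma local_events_sets: "F \<in> local_events \<Longrightarrow> F \<in> sets HM"
  by (simp add: local_events_def)

lemma local_events_subset: "F \<in> local_events \<Longrightarrow> F \<subseteq> X"
  using sets.sets_into_space[of F HM] by (simp add: local_events_def)

lemma local_events_common_radius:
  assumes "F \<in> local_events" "G \<in> local_events" obtains R where "local_on R F" "local_on R G"
proof -
  obtain R R' where "local_on R F" "local_on R' G" using assms by (auto simp: local_events_def)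
  then have "local_on (max R R') F" "local_on (max R R') G" by (auto intro: local_on_mono)
  then show thesis by (rule that)
qed

lemma local_events_Un: "F \<in> local_events \<Longrightarrow> G \<in> local_events \<Longrightarrow> F \<union> G \<in> local_events"
proof -
  assume FG: "F \<in> local_events" "G \<in> local_events"
  obtain R where R: "local_on R F" "local_on R G" using local_events_common_radius[OF FG] .
  have "local_on R (F \<union> G)" using R unfolding local_on_def by simp
  then show ?thesis using FG by (auto simp: local_events_def)
qed

lemma local_events_Int: "F \<in> local_events \<Longrightarrow> G \<in> local_events \<Longrightarrow> F \<inter> G \<in> local_events"
proof -
  assume FG: "F \<in> local_events" "G \<in> local_events"
  obtain R where R: "local_on R F" "local_on R G" using local_events_common_radius[OF FG] .
  have "local_on R (F \<inter> G)" using R unfolding local_on_def by simp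
  then show ?thesis using FG by (auto simp: local_events_def)
qed

lemma local_events_Diff: "F \<in> local_events \<Longrightarrow> G \<in> local_events \<Longrightarrow> F - G \<in> local_events"
proof -
  assume FG: "F \<in> local_events" "G \<in> local_events"
  obtain R where R: "local_on R F" "local_on R G" using local_events_common_radius[OF FG] .
  have "local_on R (F - G)" using R unfolding local_on_def by simp
  then show ?thesis using FG by (auto simp: local_events_def)
qed

lemma X_in_events: "X \<in> local_events"
  using sets.top[of HM] by (auto simp: local_events_def local_on_def)

lemma empty_in_events: "{} \<in> local_events"
  by (auto simp: local_events_def local_on_def)

lemma hits_borel:
  assumes "S \<in> X" "F \<in> sets HM" shows "hits S F \<in> sets borel"
proof -
  have "(\<lambda>y. shift_pattern (- y) S) -` F \<inter> space borel \<in> sets borel"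
    using orbit_measurable[OF assms(1)] assms(2) by (rule measurable_sets)
  then show ?thesis by (simp add: hits_def vimage_def)
qed

lemma bmeas_hits: "S \<in> X \<Longrightarrow> F \<in> sets HM \<Longrightarrow> bmeas E \<Longrightarrow> bmeas (hits S F \<inter> E)"
  using bmeas_Int[of E "hits S F"] hits_borel[of S F] by (simp add: Int_commute)

lemma additive_hits:
  assumes "F \<in> sets HM" shows "additive_on_bounded (\<lambda>E. vol (hits T F \<inter> E))"
  unfolding additive_on_bounded_def
proof (intro conjI allI impI)
  fix E E' :: "(real ^ 'n) set" assume "bmeas E" "bmeas E'" "E \<inter> E' = {}"
  then show "vol (hits T F \<inter> (E \<union> E')) = vol (hits T F \<inter> E) + vol (hits T F \<inter> E')"
    unfolding Int_Un_distrib
    by (intro vol_Un_disjoint bmeas_hits[OF T_in_hull assms]) auto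
qed simp

lemma event_mean_exists:
  assumes "F \<in> local_events" shows "\<exists>c\<ge>0. has_mean (\<lambda>E. vol (hits T F \<inter> E)) c"
proof -
  obtain R where R: "F \<in> sets HM" "local_on R F" using assms by (auto simp: local_events_def)
  have "locally_derived R (hits T F)"
    unfolding locally_derived_def hits_def mem_Collect_eq
    using R(2) T_in_hull unfolding local_on_def by simp
  then show ?thesis
    using hits_borel[OF T_in_hull R(1)] by (intro volume_mean_exists) auto
qed

definition dens :: "(real ^ 'n, 'l) tile set set \<Rightarrow> real" where
  "dens F = (THE c. has_mean (\<lambda>E. vol (hits T F \<inter> E)) c)"

lemma dens_eqI: "has_mean (\<lambda>E. vol (hits T F \<inter> E)) c \<Longrightarrow> dens F = c"
  unfolding dens_def by (rule the_equality) (auto intro: has_mean_unique)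

lemma
  assumes "F \<in> local_events"
  shows has_mean_dens: "has_mean (\<lambda>E. vol (hits T F \<inter> E)) (dens F)"
    and dens_nonneg: "0 \<le> dens F"
proof -
  obtain c where c: "0 \<le> c" "has_mean (\<lambda>E. vol (hits T F \<inter> E)) c" using event_mean_exists[OF assms] by blast
  then show "has_mean (\<lambda>E. vol (hits T F \<inter> E)) (dens F)" "0 \<le> dens F" using dens_eqI[OF c(2)] by auto
qed

lemma dens_empty: "dens {} = 0"
  by (rule dens_eqI) (simp add: hits_def has_mean_zero)

lemma dens_X: "dens X = 1"
  by (rule dens_eqI) (simp add: hits_def T_in_hull has_mean_vol)

lemma dens_Un:
  assumes FG: "F \<in> local_events" "G \<in> local_events" "F \<inter> G = {}"
  shows "dens (F \<union> G) = dens F + dens G"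
proof (rule dens_eqI, rule has_mean_cong[OF has_mean_add[OF has_mean_dens[OF FG(1)] has_mean_dens[OF FG(2)]]])
  fix E :: "(real ^ 'n) set" assume E: "bmeas E"
  have "hits T (F \<union> G) \<inter> E = (hits T F \<inter> E) \<union> (hits T G \<inter> E)" by (auto simp: hits_def)
  moreover have "(hits T F \<inter> E) \<inter> (hits T G \<inter> E) = {}" using FG(3) by (auto simp: hits_def)
  ultimately show "vol (hits T (F \<union> G) \<inter> E) = vol (hits T F \<inter> E) + vol (hits T G \<inter> E)"
    using E FG by (simp add: vol_Un_disjoint bmeas_hits T_in_hull local_events_sets)
qed

lemma dens_mono: "F \<in> local_events \<Longrightarrow> G \<in> local_events \<Longrightarrow> F \<subseteq> G \<Longrightarrow> dens F \<le> dens G"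
  using dens_Un[of F "G - F"] dens_nonneg[of "G - F"] local_events_Diff[of G F] by (simp add: Un_absorb1)

lemma dens_Un_le:
  assumes "F \<in> local_events" "G \<in> local_events" shows "dens (F \<union> G) \<le> dens F + dens G"
proof -
  have "dens (F \<union> (G - F)) = dens F + dens (G - F)"
    by (rule dens_Un[OF assms(1) local_events_Diff[OF assms(2,1)]]) blast
  moreover have "dens (G - F) \<le> dens G" by (rule dens_mono[OF local_events_Diff[OF assms(2,1)] assms(2)]) blast
  ultimately show ?thesis by simp
qed

text \<open>The hitting times of the preimage are a translate of those of \<open>F\<close>, and
  means are invariant under translation.\<close>

lemma shift_event:
  fixes a :: "real ^ 'n"
  assumes F: "F \<in> local_events"
  defines "F' \<equiv> shift_pattern a -` F \<inter> X"
  shows "F' \<in> local_events" "dens F' = dens F"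
proof -
  have m: "F' \<in> sets HM"
    unfolding F'_def using measurable_sets[OF shift_measurable local_events_sets[OF F], of a] by simp
  obtain R where R: "local_on R F" using F by (auto simp: local_events_def)
  have "local_on (\<bar>R\<bar> + norm a) F'"
    unfolding local_on_def
  proof (intro ballI impI)
    fix S S' assume S: "S \<in> X" "S' \<in> X" "agree_on (ball 0 (\<bar>R\<bar> + norm a)) S S'"
    have "translate (- a) (ball 0 R) \<subseteq> ball 0 (\<bar>R\<bar> + norm a)"
      using abs_ge_self[of R] by (simp add: translate_ball ball_subset_ball_iff)
    then have "agree_on (ball 0 R) (shift_pattern a S) (shift_pattern a S')"
      unfolding agree_on_shift using S(3) agree_on_subset by blast
    then show "S \<in> F' \<longleftrightarrow> S' \<in> F'"
      using R S(1,2) unfolding local_on_def F'_def by simp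
  qed
  with m show "F' \<in> local_events" by (auto simp: local_events_def)
  have h: "hits T F' = translate a (hits T F)"
    by (auto simp: hits_def F'_def mem_translate T_in_hull)
  show "dens F' = dens F"
  proof (rule dens_eqI, rule has_mean_cong[OF has_mean_translate[OF has_mean_dens[OF F], of "- a"]])
    fix E :: "(real ^ 'n) set"
    have "hits T F' \<inter> E = translate a (hits T F \<inter> translate (- a) E)"
      by (simp add: h translate_Int translate_translate)
    then show "vol (hits T F' \<inter> E) = vol (hits T F \<inter> translate (- a) E)" by simp
  qed
qed

text \<open>On a bounded window a hull tiling agrees with a translate of \<open>T\<close>, so its
  hitting times in the cell correspond to those of \<open>T\<close> in another cell of the same
  level, and the mean for \<open>T\<close> is uniform over these.\<close>

lemma hull_cells_uniform:
  assumes F: "F \<in> local_events" and e: "0 < e"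
  shows "\<exists>j. \<forall>S\<in>X. \<bar>vol (hits S F \<inter> \<psi> j ` Q) - dens F * V j\<bar> \<le> e * V j"
proof -
  obtain j where j: "\<And>z. \<bar>vol (hits T F \<inter> \<psi> j ` translate z Q) - dens F * V j\<bar> \<le> e * V j"
    using eventually_happens'[OF sequentially_bot has_mean_cells[OF has_mean_dens[OF F] e]] by blast
  obtain R where R: "local_on R F" using F by (auto simp: local_events_def)
  have "\<bar>vol (hits S F \<inter> \<psi> j ` Q) - dens F * V j\<bar> \<le> e * V j" if S: "S \<in> X" for S
  proof -
    let ?E = "\<psi> j ` Q"
    have "bounded ?E" using bmeas_image[of Q j] by (simp add: bmeas_def)
    then obtain K where K: "?E \<subseteq> ball 0 K" using bounded_subset_ballD by blast
    obtain x where x: "agree_on (ball 0 (K + R)) (shift_pattern x T) S"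
      using hull_agrees_with_shift[OF S] by blast
    have "y \<in> hits S F \<longleftrightarrow> y \<in> translate x (hits T F)" if y: "y \<in> ?E" for y
    proof -
      have "norm y < K" using K y by auto
      then have "translate y (ball 0 R) \<subseteq> ball 0 (K + R)"
        by (simp add: translate_ball ball_subset_ball_iff)
      then have "agree_on (ball 0 R) (shift_pattern (- y) (shift_pattern x T)) (shift_pattern (- y) S)"
        unfolding agree_on_shift minus_minus by (rule agree_on_subset[OF x])
      then have "shift_pattern (- y + x) T \<in> F \<longleftrightarrow> shift_pattern (- y) S \<in> F"
        using R S T_in_hull unfolding local_on_def by simp
      then show ?thesis by (simp add: hits_def mem_translate)
    qed
    then have "hits S F \<inter> ?E = translate x (hits T F) \<inter> ?E" by blast
    also have "\<dots> = translate x (hits T F \<inter> translate (- x) ?E)"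
      by (simp add: translate_Int translate_translate)
    finally have v: "vol (hits S F \<inter> ?E) = vol (hits T F \<inter> translate (- x) ?E)" by simp
    obtain z where z: "- x = \<psi> j z" using bij[of j] by (metis bij_pointE)
    show ?thesis using j[of z] v z by (simp add: image_translate_linear[OF lin])
  qed
  then show ?thesis by blast
qed

text \<open>Fubini's theorem is applied to the pairs \<open>(S, y)\<close> with \<open>y\<close> in
  a cell and \<open>S\<close> seen from \<open>y\<close> in \<open>F\<close>. The fibre over
  \<open>S\<close> has volume close to \<open>dens F * V j\<close>; by invariance the fibre over
  each \<open>y\<close> of the cell has measure \<open>M F\<close>.\<close>

lemma invariant_measure_of_event:
  assumes M: "prob_space M" "sets M = sets HM" "\<And>x. distr M M (shift_pattern x) = M"
    and F: "F \<in> local_events"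
  shows "emeasure M F = ennreal (dens F)"
proof -
  interpret prob_space M by fact
  interpret pair_sigma_finite M lborel by unfold_locales
  have spM: "space M = X" using sets_eq_imp_space_eq[OF M(2)] by simp
  have FM: "F \<in> sets M" using F M(2) by (simp add: local_events_sets)
  have close: "\<bar>measure M F - dens F\<bar> \<le> e" if e: "0 < e" for e
  proof -
    obtain j where j: "\<And>S. S \<in> X \<Longrightarrow> \<bar>vol (hits S F \<inter> \<psi> j ` Q) - dens F * V j\<bar> \<le> e * V j"
      using hull_cells_uniform[OF F e] by blast
    let ?E = "\<psi> j ` Q"
    have E: "bborel ?E" by (intro bborel_linear_image lin bij bborel_cube)
    define A where "A = {(S, y). S \<in> X \<and> y \<in> ?E \<and> shift_pattern (- y) S \<in> F}"
    have "(\<lambda>(S, y). shift_pattern (- y) S) -` F \<inter> space (HM \<Otimes>\<^sub>M borel) \<in> sets (HM \<Otimes>\<^sub>M borel)"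
      by (rule measurable_sets[OF joint_shift_measurable local_events_sets[OF F]])
    moreover have "X \<times> ?E \<in> sets (HM \<Otimes>\<^sub>M borel)"
      using E sets.top[of HM] by (intro pair_measureI) (auto simp: bborel_def)
    ultimately have m: "(\<lambda>(S, y). shift_pattern (- y) S) -` F \<inter> space (HM \<Otimes>\<^sub>M borel) \<inter> (X \<times> ?E) \<in> sets (HM \<Otimes>\<^sub>M borel)"
      by (rule sets.Int)
    have eqA: "(\<lambda>(S, y). shift_pattern (- y) S) -` F \<inter> space (HM \<Otimes>\<^sub>M borel) \<inter> (X \<times> ?E) = A"
      by (auto simp: A_def space_pair_measure)
    have seq: "sets (HM \<Otimes>\<^sub>M borel) = sets (M \<Otimes>\<^sub>M lborel)"
      by (rule sets_pair_measure_cong) (simp_all add: M(2))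
    have A: "A \<in> sets (M \<Otimes>\<^sub>M lborel)" using m unfolding eqA seq .
    have fib1: "emeasure lborel (Pair S -` A) = ennreal (vol (hits S F \<inter> ?E))" if S: "S \<in> space M" for S
    proof -
      have eq: "Pair S -` A = hits S F \<inter> ?E" using S spM by (auto simp: A_def hits_def)
      have b: "hits S F \<inter> ?E \<in> sets borel"
        using S spM hits_borel[OF _ local_events_sets[OF F]] E by (auto simp: bborel_def)
      have "bmeas (hits S F \<inter> ?E)"
        using S spM bmeas_hits[OF _ local_events_sets[OF F] bborel_bmeas[OF E]] by simp
      then have "emeasure lebesgue (hits S F \<inter> ?E) \<noteq> \<infinity>"
        unfolding bmeas_def by (metis fmeasurableD2 infinity_ennreal_def)
      then have "emeasure lebesgue (hits S F \<inter> ?E) = ennreal (vol (hits S F \<inter> ?E))"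
        by (simp add: emeasure_eq_ennreal_measure)
      then show ?thesis using b unfolding eq by simp
    qed
    have fib2: "emeasure M ((\<lambda>S. (S, y)) -` A) = emeasure M F * indicator ?E y" for y
    proof (cases "y \<in> ?E")
      case True
      have "(\<lambda>S. (S, y)) -` A = shift_pattern (- y) -` F \<inter> space M"
        using True spM by (auto simp: A_def)
      moreover have "shift_pattern (- y) \<in> measurable M M"
        using shift_measurable measurable_cong_sets[OF M(2) M(2)] by blast
      then have "emeasure (distr M M (shift_pattern (- y))) F = emeasure M (shift_pattern (- y) -` F \<inter> space M)"
        using FM by (rule emeasure_distr)
      ultimately show ?thesis using True M(3) by simp
    next
      case False
      then have "(\<lambda>S. (S, y)) -` A = {}" by (auto simp: A_def)
      with False show ?thesis by simp
    qed
    have "(\<integral>\<^sup>+S. ennreal (vol (hits S F \<inter> ?E)) \<partial>M) = emeasure (M \<Otimes>\<^sub>M lborel) A"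
      unfolding lborel.emeasure_pair_measure_alt[OF A] by (rule nn_integral_cong) (rule fib1[symmetric])
    also have "\<dots> = (\<integral>\<^sup>+y. emeasure M F * indicator ?E y \<partial>lborel)"
      unfolding emeasure_pair_measure_alt2[OF A] fib2 ..
    also have "\<dots> = emeasure M F * emeasure lborel ?E"
      using E by (intro nn_integral_cmult_indicator) (simp add: bborel_def)
    also have "emeasure lborel ?E = ennreal (V j)"
    proof -
      have "emeasure lebesgue ?E = ennreal (vol ?E)"
        using bborel_bmeas[OF E] unfolding bmeas_def
        by (intro emeasure_eq_ennreal_measure) (metis fmeasurableD2 infinity_ennreal_def)
      then show ?thesis using E by (simp add: V_def bborel_def)
    qed
    also have "emeasure M F * ennreal (V j) = ennreal (measure M F * V j)"
      by (simp add: emeasure_eq_measure ennreal_mult'' V_pos less_imp_le)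
    finally have int: "(\<integral>\<^sup>+S. ennreal (vol (hits S F \<inter> ?E)) \<partial>M) = ennreal (measure M F * V j)" .
    have "(\<integral>\<^sup>+S. ennreal (vol (hits S F \<inter> ?E)) \<partial>M) \<le> (\<integral>\<^sup>+S. ennreal ((dens F + e) * V j) \<partial>M)"
    proof (rule nn_integral_mono, rule ennreal_leI)
      fix S assume "S \<in> space M"
      then show "vol (hits S F \<inter> ?E) \<le> (dens F + e) * V j"
        using j[of S] spM by (simp add: distrib_right abs_le_iff)
    qed
    then have "ennreal (measure M F * V j) \<le> ennreal ((dens F + e) * V j)"
      unfolding int by (simp add: emeasure_space_1)
    moreover have "0 \<le> (dens F + e) * V j" using dens_nonneg[OF F] e V_pos[of j] by simp
    ultimately have u: "measure M F * V j \<le> (dens F + e) * V j" by (simp add: ennreal_le_iff)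
    have "(\<integral>\<^sup>+S. ennreal ((dens F - e) * V j) \<partial>M) \<le> (\<integral>\<^sup>+S. ennreal (vol (hits S F \<inter> ?E)) \<partial>M)"
    proof (rule nn_integral_mono, rule ennreal_leI)
      fix S assume "S \<in> space M"
      then show "(dens F - e) * V j \<le> vol (hits S F \<inter> ?E)"
        using j[of S] spM by (simp add: left_diff_distrib abs_le_iff)
    qed
    then have "ennreal ((dens F - e) * V j) \<le> ennreal (measure M F * V j)"
      unfolding int by (simp add: emeasure_space_1)
    moreover have "0 \<le> measure M F * V j" using V_pos[of j] by simp
    ultimately have l: "(dens F - e) * V j \<le> measure M F * V j" by (simp add: ennreal_le_iff)
    have "measure M F \<le> dens F + e" "dens F - e \<le> measure M F"
      using u l V_pos[of j] by (simp_all add: mult_le_cancel_right)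
    then show ?thesis by (simp add: abs_le_iff)
  qed
  have "\<bar>measure M F - dens F\<bar> \<le> 0"
    by (rule field_le_epsilon) (use close in simp)
  then have "measure M F = dens F" by simp
  then show ?thesis by (simp add: emeasure_eq_measure)
qed

section \<open>Cylinders as local events\<close>

lemma cyl_local:
  assumes F: "F \<in> pieces" and Z: "bounded Z"
  shows "\<exists>R. local_on R (cyl F Z)"
proof -
  obtain R where R: "support F \<subseteq> ball 0 R" using piece_bounded[OF F] .
  obtain K where K: "\<And>z. z \<in> Z \<Longrightarrow> norm z \<le> K" using Z by (auto simp: bounded_iff)
  have *: "S' \<in> cyl F Z" if S: "S' \<in> X" "agree_on (ball 0 (R + K)) S S'" "S \<in> cyl F Z" for S S'
  proof -
    obtain v where v: "v \<in> Z" "shift_pattern v F \<subseteq> S" using S(3) by (auto simp: cyl_def)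
    have "shift_pattern v F \<subseteq> S'"
      by (rule piece_transfer[OF F ball_translate_bound[OF R K[OF v(1)]] S(2) v(2)])
    then show ?thesis using S(1) v(1) by (auto simp: cyl_def)
  qed
  have "local_on (R + K) (cyl F Z)"
    unfolding local_on_def using * agree_on_sym by metis
  then show ?thesis ..
qed

lemma open_cyl_event: "F \<in> pieces \<Longrightarrow> open Z \<Longrightarrow> bounded Z \<Longrightarrow> cyl F Z \<in> local_events"
  using cyl_local open_in_sets_HM[OF openin_cyl] by (simp add: local_events_def)

lemma compact_cyl_event:
  assumes "F \<in> pieces" "compact Z" shows "cyl F Z \<in> local_events"
  using cyl_local[OF assms(1) compact_imp_bounded[OF assms(2)]]
    closed_in_sets_HM[OF closedin_cyl[OF assms]] by (simp add: local_events_def)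

text \<open>A hitting time \<open>y\<close> of the difference has the form \<open>u - v\<close> with
  \<open>u\<close> an occurrence of \<open>F\<close> in \<open>T\<close> and \<open>v\<close> in
  \<open>Z - K\<close>. In a cell of level 0 at most \<open>k\<close> such \<open>u\<close> matter,
  and each contributes a reflected translate of \<open>Z - K\<close>.\<close>

lemma dens_cyl_Diff_le:
  assumes F: "F \<in> pieces" and Z: "open Z" "bounded Z"
  obtains C where "0 \<le> C"
    "\<And>K. compact K \<Longrightarrow> K \<subseteq> Z \<Longrightarrow> dens (cyl F Z - cyl F K) \<le> C * vol (Z - K)"
proof -
  let ?Y = "{z. shift_pattern z F \<subseteq> T}"
  obtain r where r: "0 < r" "\<And>x y. x \<in> ?Y \<Longrightarrow> y \<in> ?Y \<Longrightarrow> x \<noteq> y \<Longrightarrow> r \<le> dist x y"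
    using piece_occurrences_separated[OF F T_in_hull] by auto
  \<comment> \<open>All sums of a point of the cell and an admissible position: occurrences of
    \<open>F\<close> relevant for the cell lie in the corresponding translate of
    \<open>B\<close>.\<close>
  define B where "B = (\<lambda>(x, y). x + y) ` (\<psi> 0 ` Q \<times> Z)"
  have bQ: "bounded (\<psi> 0 ` Q)" using bmeas_image[of Q 0] by (simp add: bmeas_def)
  have "bounded B" unfolding B_def by (rule bounded_plus[OF bQ Z(2)])
  then obtain k where k: "\<And>z. finite (?Y \<inter> translate z B) \<and> card (?Y \<inter> translate z B) \<le> k"
    using separated_set_count[of r ?Y B, OF r] by blast
  have le: "dens (cyl F Z - cyl F K) \<le> real k / V 0 * vol (Z - K)" if K: "compact K" "K \<subseteq> Z" for K
  proof -
    let ?D = "cyl F Z - cyl F K"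
    have D: "?D \<in> local_events" using F Z K by (intro local_events_Diff open_cyl_event compact_cyl_event)
    have refl: "bmeas ((\<lambda>x. z - x) ` (Z - K))" "vol ((\<lambda>x. z - x) ` (Z - K)) = vol (Z - K)" for z
    proof -
      have eq: "(\<lambda>x. z - x) ` (Z - K) = (\<lambda>x. z - x) -` (Z - K)"
      proof (intro equalityI subsetI)
        fix x assume "x \<in> (\<lambda>x. z - x) -` (Z - K)"
        then show "x \<in> (\<lambda>x. z - x) ` (Z - K)" by (intro image_eqI[of _ _ "z - x"]) simp_all
      qed auto
      have "(\<lambda>x. z - x) -` (Z - K) \<in> sets borel"
      proof -
        have "(\<lambda>x. z - x) -` (Z - K) \<inter> space borel \<in> sets borel"
          using Z(1) K(1) by (intro measurable_sets[of _ borel borel]) (auto simp: borel_compact)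
        then show ?thesis by simp
      qed
      moreover have "bounded ((\<lambda>x. z - x) ` (Z - K))"
        using bounded_minus_comp[of "\<lambda>x. z" "Z - K" "\<lambda>x. x"] Z(2) by (simp add: bounded_diff image_constant_conv)
      ultimately show "bmeas ((\<lambda>x. z - x) ` (Z - K))" unfolding eq bmeas_iff by simp
      show "vol ((\<lambda>x. z - x) ` (Z - K)) = vol (Z - K)"
        using measure_lebesgue_affine[of "- 1" z "Z - K"] by simp
    qed
    have "dens ?D \<le> real k * vol (Z - K) / V 0"
    proof (rule has_mean_le_if_cells[OF additive_hits[OF local_events_sets[OF D]] has_mean_dens[OF D], of _ 0])
      show "0 \<le> real k * vol (Z - K) / V 0" using V_pos[of 0] by simp
      fix z
      let ?I = "?Y \<inter> translate (\<psi> 0 z) B"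
      have "hits T ?D \<inter> \<psi> 0 ` translate z Q \<subseteq> (\<Union>u\<in>?I. (\<lambda>x. u - x) ` (Z - K))"
      proof
        fix y assume y: "y \<in> hits T ?D \<inter> \<psi> 0 ` translate z Q"
        then obtain v where v: "v \<in> Z" "shift_pattern v F \<subseteq> shift_pattern (- y) T" "v \<notin> K"
          by (auto simp: hits_def cyl_def)
        have s: "shift_pattern (v + y) F \<subseteq> T"
          using shift_pattern_mono[OF v(2), of y] by (simp add: add.commute)
        have "y - \<psi> 0 z \<in> \<psi> 0 ` Q" using y by (simp add: image_translate_linear[OF lin] mem_translate)
        then have "(v + y) - \<psi> 0 z \<in> B"
          unfolding B_def using v(1) by (intro image_eqI[of _ _ "(y - \<psi> 0 z, v)"]) auto
        then have "v + y \<in> ?I" using s by (simp add: mem_translate)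
        moreover have "y \<in> (\<lambda>x. (v + y) - x) ` (Z - K)" using v(1,3) by (intro image_eqI[of _ _ v]) auto
        ultimately show "y \<in> (\<Union>u\<in>?I. (\<lambda>x. u - x) ` (Z - K))" by blast
      qed
      then have "vol (hits T ?D \<inter> \<psi> 0 ` translate z Q) \<le> vol (\<Union>u\<in>?I. (\<lambda>x. u - x) ` (Z - K))"
        using k[of "\<psi> 0 z"]
        by (intro vol_mono bmeas_hits[OF T_in_hull local_events_sets[OF D]] bmeas_UN refl bmeas_image bborel_translate bborel_cube)
          auto
      also have "\<dots> \<le> (\<Sum>u\<in>?I. vol ((\<lambda>x. u - x) ` (Z - K)))"
        using k[of "\<psi> 0 z"] refl(1) by (intro measure_UNION_le) (auto simp: bmeas_iff)
      also have "\<dots> = real (card ?I) * vol (Z - K)" by (simp add: refl(2))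
      also have "\<dots> \<le> real k * vol (Z - K)" using k[of "\<psi> 0 z"] by (intro mult_right_mono) auto
      also have "\<dots> = real k * vol (Z - K) / V 0 * V 0" using V_pos[of 0] by simp
      finally show "vol (hits T ?D \<inter> \<psi> 0 ` translate z Q) \<le> real k * vol (Z - K) / V 0 * V 0" .
    qed
    then show ?thesis by simp
  qed
  show thesis
    by (rule that[of "real k / V 0"]) (use V_pos[of 0] le in auto)
qed

lemma sets_HM_events: "sets HM = sigma_sets X local_events"
proof
  show "sets HM \<subseteq> sigma_sets X local_events"
    unfolding sets_HM_cyls
  proof (rule sigma_sets_mono, rule subsetI)
    fix W assume "W \<in> open_cyls"
    then have "W \<in> local_events" by (auto simp: open_cyls_def intro: open_cyl_event)
    then show "W \<in> sigma_sets X local_events" by (rule sigma_sets.Basic)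
  qed
  show "sigma_sets X local_events \<subseteq> sets HM"
    using sets.sigma_sets_subset[of local_events HM] local_events_sets by auto
qed

text \<open>Local events are closed under intersection and generate the Borel sets, and invariance
  has fixed the values on them.\<close>

lemma invariant_measure_unique:
  assumes M: "prob_space M" "sets M = sets HM" "\<And>x. distr M M (shift_pattern x) = M"
    and N: "prob_space N" "sets N = sets HM" "\<And>x. distr N N (shift_pattern x) = N"
  shows "M = N"
proof (rule measure_eqI_generator_eq[where \<Omega> = X and E = local_events and A = "\<lambda>_. X"])
  show "Int_stable local_events" by (auto simp: Int_stable_def local_events_Int)
  show "local_events \<subseteq> Pow X" using local_events_subset by auto
  show "emeasure M F = emeasure N F" if "F \<in> local_events" for F
    using invariant_measure_of_event[OF M that] invariant_measure_of_event[OF N that] by simp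
  show "sets M = sigma_sets X local_events" "sets N = sigma_sets X local_events"
    using M(2) N(2) by (simp_all add: sets_HM_events)
  show "range (\<lambda>_. X) \<subseteq> local_events" using X_in_events by auto
  show "emeasure M X \<noteq> \<infinity>" for i :: nat
    using invariant_measure_of_event[OF M X_in_events] by simp
qed simp

end

section \<open>Tightness, compactness and existence\<close>

context supertiles
begin

section \<open>Tight sets\<close>

definition base :: "real ^ 'n" where "base = (SOME x. x \<in> \<Lambda>)"

lemma base: "base \<in> \<Lambda>"
  unfolding base_def using hit by (metis someI)

text \<open>The copy of \<open>P j\<close> at \<open>base\<close> lies in \<open>T\<close>, which
  makes it available as a piece for cylinders.\<close>

definition super_piece :: "nat \<Rightarrow> (real ^ 'n, 'l) tile set" where
  "super_piece j = shift_pattern (\<psi> j base) (P j)"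

text \<open>The displacement \<open>v = - y - \<psi> j base\<close> turns
  \<open>super_piece j\<close> into \<open>P j\<close> seen from \<open>y\<close>. Hence the window
  lists the positions for which the origin falls into the marked part of the supertile.\<close>

definition super_window :: "nat \<Rightarrow> (real ^ 'n) set" where
  "super_window j = (\<lambda>y. - y - \<psi> j base) ` (\<psi> j ` q)"

lemma compact_super_window: "compact (super_window j)"
proof -
  have "compact (\<psi> j ` q)"
    by (rule compact_continuous_image[OF linear_continuous_on q_compact]) (simp add: linear_linear lin)
  then show ?thesis
    unfolding super_window_def by (rule compact_continuous_image[rotated]) (intro continuous_intros)
qed

lemma super_piece_shift: "shift_pattern (- y - \<psi> j base) (super_piece j) = shift_pattern (- y) (P j)"
  by (simp add: super_piece_def)

lemma super_cyl_hits:
  assumes "x \<in> \<Lambda>" "y \<in> \<psi> j ` translate x q"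
  shows "shift_pattern (- y) T \<in> cyl (super_piece j) (super_window j)"
proof -
  have y: "y - \<psi> j x \<in> \<psi> j ` q" using assms(2) by (simp add: image_translate_linear[OF lin] mem_translate)
  have "shift_pattern (- (y - \<psi> j x)) (P j) \<subseteq> shift_pattern (- y) T"
    using shift_pattern_mono[OF super[OF assms(1), of j], of "- y"] by (simp add: algebra_simps)
  then have "shift_pattern (- (y - \<psi> j x) - \<psi> j base) (super_piece j) \<subseteq> shift_pattern (- y) T"
    by (simp only: super_piece_shift)
  moreover have "- (y - \<psi> j x) - \<psi> j base \<in> super_window j"
    unfolding super_window_def using y by (rule imageI)
  ultimately show ?thesis using T_in_hull by (auto simp: cyl_def)
qed

definition covering_level :: "real \<Rightarrow> nat \<Rightarrow> bool" where
  "covering_level l j \<longleftrightarrow> (\<forall>y\<in>\<psi> j ` q. ball y l \<subseteq> support (P j))"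

lemma covering_level_covers:
  assumes "covering_level l j" "v \<in> super_window j"
  shows "ball 0 l \<subseteq> support (shift_pattern v (super_piece j))"
proof -
  obtain y where y: "y \<in> \<psi> j ` q" "v = - y - \<psi> j base" using assms(2) by (auto simp: super_window_def)
  have "ball y l \<subseteq> support (P j)" using assms(1) y(1) unfolding covering_level_def by (rule bspec)
  then have "translate (- y) (ball y l) \<subseteq> translate (- y) (support (P j))"
    by (simp add: translate_def image_mono)
  then show ?thesis unfolding y(2) super_piece_shift by (simp add: translate_ball)
qed

lemma super_piece_in_pieces:
  assumes "covering_level l j" "0 < l" shows "super_piece j \<in> pieces"
proof -
  obtain z where "z \<in> q" using q(3) interior_subset by blast
  then have "- \<psi> j z - \<psi> j base \<in> super_window j" by (auto simp: super_window_def)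
  from covering_level_covers[OF assms(1) this]
  have "0 \<in> support (shift_pattern (- \<psi> j z - \<psi> j base) (super_piece j))" using assms(2) by auto
  then have "super_piece j \<noteq> {}" by (auto simp: support_def)
  moreover have "super_piece j \<subseteq> T" unfolding super_piece_def using super[OF base] .
  moreover have "finite (super_piece j)" using fin_P by (simp add: super_piece_def)
  ultimately show ?thesis by (simp add: pieces_def)
qed

text \<open>If every level in \<open>J\<close> is a covering level for \<open>l\<close>, these
  tilings contain a supertile of a level in \<open>J\<close> that covers the ball of radius
  \<open>l\<close> about the origin, at a position confined to a compact set.\<close>

definition tight_set :: "real \<Rightarrow> nat set \<Rightarrow> (real ^ 'n, 'l) tile set set" where
  "tight_set l J = (\<Union>j\<in>J. cyl (super_piece j) (super_window j))"

lemma tight_set_event: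
  assumes "finite J" "\<And>j. j \<in> J \<Longrightarrow> covering_level l j" "0 < l"
  shows "tight_set l J \<in> local_events"
  using assms unfolding tight_set_def
proof (induction J rule: finite_induct)
  case empty then show ?case by (simp add: empty_in_events)
next
  case (insert j J)
  have "cyl (super_piece j) (super_window j) \<in> local_events"
    by (rule compact_cyl_event[OF super_piece_in_pieces compact_super_window]) (use insert in auto)
  then show ?case using insert by (auto intro: local_events_Un)
qed

text \<open>The contraction behind tightness: inside every cell of a high level, a fixed proportion of the
  volume lies in supertiles of that level.\<close>

lemma bad_set_contraction:
  assumes J: "finite J" "\<And>j. j \<in> J \<Longrightarrow> covering_level l j" "0 < l"
    and cov: "eventually (covering_level l) sequentially" and \<epsilon>: "0 < \<epsilon>"
  shows "\<exists>n. covering_level l n \<and>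
    dens (X - tight_set l (insert n J)) \<le> dens (X - tight_set l J) * (1 - w) + \<epsilon>"
proof -
  let ?B = "X - tight_set l J"
  have B: "?B \<in> local_events" using J by (intro local_events_Diff X_in_events tight_set_event)
  have "0 < \<epsilon> / 2" using \<epsilon> by simp
  then obtain L C where L: "0 < L" "0 \<le> C" "\<And>E. bmeas E \<Longrightarrow> \<bar>vol (hits T ?B \<inter> E) - dens ?B * vol E\<bar>
      \<le> \<epsilon> / 2 * vol E + C * vol (thick_boundary L E)"
    using has_mean_dens[OF B] unfolding has_mean_def by meson
  have "0 < \<epsilon> / (2 * (C + 1))" using \<epsilon> L(2) by simp
  from eventually_happens'[OF sequentially_bot eventually_conj[OF cov small_boundary[OF this, of L]]]
  obtain n where n: "covering_level l n"
    "\<And>z x. vol (thick_boundary L (\<psi> n ` (translate z Q - translate x q))) \<le> \<epsilon> / (2 * (C + 1)) * V n"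
    by blast
  let ?B' = "X - tight_set l (insert n J)"
  have B': "?B' \<in> local_events"
    using J n(1) by (intro local_events_Diff X_in_events tight_set_event) auto
  have "dens ?B' \<le> dens ?B * (1 - w) + \<epsilon>"
  proof (rule has_mean_le_if_cells[OF additive_hits[OF local_events_sets[OF B']] has_mean_dens[OF B'], of _ n])
    show "0 \<le> dens ?B * (1 - w) + \<epsilon>" using dens_nonneg[OF B] w_le_1 \<epsilon> by simp
    fix z
    obtain x where x: "x \<in> \<Lambda>" "translate x q \<subseteq> translate z Q" using hit by blast
    let ?E = "\<psi> n ` (translate z Q - translate x q)"
    have e: "?E = \<psi> n ` translate z Q - \<psi> n ` translate x q"
      using bij by (intro image_set_diff bij_is_inj)
    have b: "bmeas (\<psi> n ` translate z Q)" "bmeas (\<psi> n ` translate x q)"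
      using q by (auto intro!: bmeas_image)
    have bE: "bmeas ?E" unfolding e using b by simp
    have vE: "vol ?E = (1 - w) * V n"
      unfolding e using additive_Diff[OF additive_on_bounded_vol b] x(2)
      by (simp add: vol_image_Q vol_image_q image_mono left_diff_distrib)
    \<comment> \<open>The marked part of the cell is good at level \<open>n\<close>, so the new bad
      set is confined to the rest, of proportion \<open>1 - w\<close>; there the old bad set has
      almost its mean density, as \<open>n\<close> is large.\<close>
    have sub: "hits T ?B' \<inter> \<psi> n ` translate z Q \<subseteq> hits T ?B \<inter> ?E"
    proof
      fix y assume y: "y \<in> hits T ?B' \<inter> \<psi> n ` translate z Q"
      then have "shift_pattern (- y) T \<notin> cyl (super_piece n) (super_window n)"
        by (auto simp: hits_def tight_set_def)
      then have "y \<notin> \<psi> n ` translate x q" using super_cyl_hits[OF x(1)] by blast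
      then show "y \<in> hits T ?B \<inter> ?E" using y unfolding e by (auto simp: hits_def tight_set_def)
    qed
    have "vol (hits T ?B' \<inter> \<psi> n ` translate z Q) \<le> vol (hits T ?B \<inter> ?E)"
      by (intro vol_mono[OF sub] bmeas_hits T_in_hull local_events_sets B B' b bE)
    also have "\<dots> \<le> dens ?B * vol ?E + \<epsilon> / 2 * vol ?E + C * vol (thick_boundary L ?E)"
      using L(3)[OF bE] by linarith
    also have "\<dots> \<le> dens ?B * vol ?E + \<epsilon> / 2 * V n + C * (\<epsilon> / (2 * (C + 1)) * V n)"
    proof (intro add_mono mult_left_mono order_refl)
      show "vol ?E \<le> V n" unfolding vE using w_pos V_pos[of n] by simp
    qed (use n(2) \<epsilon> L(2) dens_nonneg[OF B] in auto)
    also have "\<dots> \<le> dens ?B * vol ?E + \<epsilon> / 2 * V n + \<epsilon> / 2 * V n"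
    proof -
      have "C * (\<epsilon> / (2 * (C + 1))) \<le> \<epsilon> / 2" using L(2) \<epsilon> by (simp add: field_simps)
      then have "C * (\<epsilon> / (2 * (C + 1))) * V n \<le> \<epsilon> / 2 * V n" using V_pos[of n] by (intro mult_right_mono) auto
      then show ?thesis unfolding mult.assoc[of C] by (rule add_left_mono)
    qed
    also have "\<dots> = (dens ?B * (1 - w) + \<epsilon>) * V n" unfolding vE by (simp add: algebra_simps)
    finally show "vol (hits T ?B' \<inter> \<psi> n ` translate z Q) \<le> (dens ?B * (1 - w) + \<epsilon>) * V n" .
  qed
  with n(1) show ?thesis by blast
qed

text \<open>The infimum \<open>\<theta>\<close> of the attainable bad densities cannot be improved
  by a further level, so the contraction gives \<open>\<theta> * w \<le> \<epsilon>\<close> for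
  every positive \<open>\<epsilon>\<close>, and \<open>\<theta>\<close> is 0.\<close>

lemma tightness:
  assumes l: "0 < l" and e: "0 < e"
  shows "\<exists>J. finite J \<and> (\<forall>j\<in>J. covering_level l j) \<and> dens (X - tight_set l J) < e"
proof -
  define D where "D = {dens (X - tight_set l J) | J. finite J \<and> (\<forall>j\<in>J. covering_level l j)}"
  have cov: "eventually (covering_level l) sequentially" unfolding covering_level_def by (rule covers)
  have nonneg: "0 \<le> d" if "d \<in> D" for d
    using that l unfolding D_def by (auto intro!: dens_nonneg local_events_Diff X_in_events tight_set_event)
  have ne: "D \<noteq> {}" unfolding D_def by (auto intro: exI[where x = "{}"])
  have bdd: "bdd_below D" by (rule bdd_belowI) (rule nonneg)
  define \<theta> where "\<theta> = Inf D"
  have \<theta>0: "0 \<le> \<theta>" unfolding \<theta>_def using ne nonneg by (rule cInf_greatest)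
  have low: "\<theta> \<le> d" if "d \<in> D" for d unfolding \<theta>_def using that bdd by (rule cInf_lower)
  have approx: "\<exists>d\<in>D. d < \<theta> + \<epsilon>" if "0 < \<epsilon>" for \<epsilon>
    using cInf_lessD[OF ne, of "\<theta> + \<epsilon>"] that unfolding \<theta>_def by auto
  have step: "\<theta> \<le> d * (1 - w) + \<epsilon>" if d: "d \<in> D" and \<epsilon>: "0 < \<epsilon>" for d \<epsilon>
  proof -
    obtain J where J: "d = dens (X - tight_set l J)" "finite J" "\<forall>j\<in>J. covering_level l j"
      using d unfolding D_def by blast
    obtain n where n: "covering_level l n"
      "dens (X - tight_set l (insert n J)) \<le> dens (X - tight_set l J) * (1 - w) + \<epsilon>"
      using bad_set_contraction[OF J(2) _ l cov \<epsilon>] J(3) by blast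
    have "dens (X - tight_set l (insert n J)) \<in> D"
      unfolding D_def using J n(1) by (intro CollectI exI[where x = "insert n J"]) simp
    from low[OF this] n(2) J(1) show ?thesis by simp
  qed
  have "\<theta> * w \<le> 0 + \<epsilon>" if \<epsilon>: "0 < \<epsilon>" for \<epsilon>
  proof -
    obtain d where d: "d \<in> D" "d < \<theta> + \<epsilon> / 2" using approx[of "\<epsilon> / 2"] \<epsilon> by auto
    have "\<theta> \<le> d * (1 - w) + \<epsilon> / 2" using step[OF d(1), of "\<epsilon> / 2"] \<epsilon> by simp
    also have "d * (1 - w) \<le> (\<theta> + \<epsilon> / 2) * (1 - w)" using d(2) w_le_1 by (intro mult_right_mono) auto
    finally have "\<theta> * w \<le> \<epsilon> / 2 * (1 - w) + \<epsilon> / 2" by (simp add: algebra_simps)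
    also have "\<epsilon> / 2 * (1 - w) \<le> \<epsilon> / 2" using \<epsilon> w_pos by simp
    finally show ?thesis by simp
  qed
  then have "\<theta> * w \<le> 0" by (rule field_le_epsilon)
  then have "\<theta> = 0" using \<theta>0 w_pos by (simp add: mult_le_0_iff)
  then obtain d where "d \<in> D" "d < e" using approx[OF e] by auto
  then show ?thesis unfolding D_def by blast
qed

section \<open>Compactness on tight sets\<close>

lemma infinite_pigeonhole_subsequence:
  assumes "finite A" "\<And>i :: nat. i \<ge> N \<Longrightarrow> g i \<in> A"
  shows "\<exists>a\<in>A. \<exists>r :: nat \<Rightarrow> nat. strict_mono r \<and> (\<forall>i. g (r i) = a)"
proof -
  have "finite (g ` {N..})" using assms by (auto intro: finite_subset[of _ A])
  then obtain n where n: "n \<in> {N..}" "infinite {i \<in> {N..}. g i = g n}"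
    using pigeonhole_infinite[of "{N..}" g] by (auto simp: infinite_Ici)
  obtain r :: "nat \<Rightarrow> nat" where "strict_mono r" "\<And>i. r i \<in> {i \<in> {N..}. g i = g n}"
    using infinite_enumerate[OF n(2)] by blast
  then show ?thesis using n(1) assms(2) by (intro bexI[of _ "g n"] exI[of _ r]) auto
qed

text \<open>For each \<open>l\<close> the level comes from a finite set and the displacement from a
  compact window, so a subsequence has constant level and convergent displacement; a diagonal
  sequence achieves this for all \<open>l\<close> together.\<close>

lemma diagonal_limit:
  fixes J :: "nat \<Rightarrow> nat set" and S :: "nat \<Rightarrow> (real ^ 'n, 'l) tile set"
  assumes J: "\<And>l. finite (J l)" and S: "\<And>l i. l \<le> i \<Longrightarrow> S i \<in> tight_set (real (Suc l)) (J l)"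
  shows "\<exists>r j v u. strict_mono r \<and> (\<forall>l. j l \<in> J l \<and> v l \<in> super_window (j l) \<and> u l \<longlonglongrightarrow> v l \<and>
    eventually (\<lambda>i. shift_pattern (u l i) (super_piece (j l)) \<subseteq> S (r i)) sequentially)"
proof -
  have "\<exists>j\<in>J l. \<exists>u\<in>super_window j. shift_pattern u (super_piece j) \<subseteq> S i" if "l \<le> i" for l i
    using S[OF that] by (auto simp: tight_set_def cyl_def)
  then obtain g0 h0 where gh: "\<And>l i. l \<le> i \<Longrightarrow> g0 l i \<in> J l \<and> h0 l i \<in> super_window (g0 l i) \<and>
      shift_pattern (h0 l i) (super_piece (g0 l i)) \<subseteq> S i" by metis
  define R where "R l s \<longleftrightarrow> (\<exists>j\<in>J l. eventually (\<lambda>i. g0 l (s i) = j) sequentially \<and>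
    (\<exists>v\<in>super_window j. (\<lambda>i. h0 l (s i)) \<longlonglongrightarrow> v))" for l and s :: "nat \<Rightarrow> nat"
  interpret subseqs R
  proof
    fix l and s :: "nat \<Rightarrow> nat" assume s: "strict_mono s"
    have big: "l \<le> s i" if "l \<le> i" for i using seq_suble[OF s, of i] that by simp
    have mem: "g0 l (s i) \<in> J l" if "l \<le> i" for i using gh[OF big[OF that]] by simp
    obtain j and r :: "nat \<Rightarrow> nat" where j: "j \<in> J l" "strict_mono r" "\<And>i. g0 l (s (r i)) = j"
      using infinite_pigeonhole_subsequence[of "J l" l "\<lambda>i. g0 l (s i)", OF J mem] by blast
    \<comment> \<open>The offset \<open>l\<close> pushes the index past \<open>l\<close>, from where
      on membership in the tight set of index \<open>l\<close> is known.\<close>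
    define h where "h i = h0 l (s (r (i + l)))" for i
    have "h i \<in> super_window j" for i
    proof -
      have "i + l \<le> r (i + l)" using seq_suble[OF j(2)] .
      then have "l \<le> s (r (i + l))" using big[of "r (i + l)"] by simp
      from gh[OF this] show ?thesis by (simp add: h_def j(3))
    qed
    then obtain v r2 where v: "v \<in> super_window j" "strict_mono r2" "(h \<circ> r2) \<longlonglongrightarrow> v"
      using compact_super_window[of j] unfolding compact_def by metis
    let ?r' = "r \<circ> (\<lambda>i. r2 i + l)"
    have "strict_mono ?r'" using j(2) v(2) by (auto simp: strict_mono_def)
    moreover have "R l (s \<circ> ?r')"
      unfolding R_def
      using v j by (intro bexI[of _ j] conjI bexI[of _ v]) (simp_all add: h_def o_def)
    ultimately show "\<exists>r'. strict_mono r' \<and> R l (s \<circ> r')" by blast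
  qed
  have stable: "R l (s \<circ> r)" if r: "strict_mono r" and Rs: "R l s" for r s l
  proof -
    obtain j v where jv: "j \<in> J l" "eventually (\<lambda>i. g0 l (s i) = j) sequentially" "v \<in> super_window j"
        "(\<lambda>i. h0 l (s i)) \<longlonglongrightarrow> v" using Rs unfolding R_def by blast
    have "eventually (\<lambda>i. g0 l ((s \<circ> r) i) = j) sequentially"
      using eventually_subseq[OF r jv(2)] by simp
    moreover have "(\<lambda>i. h0 l ((s \<circ> r) i)) \<longlonglongrightarrow> v"
      using LIMSEQ_subseq_LIMSEQ[OF jv(4) r] by (simp add: o_def)
    ultimately show ?thesis unfolding R_def using jv(1,3) by blast
  qed
  have "\<exists>j v. j \<in> J l \<and> v \<in> super_window j \<and> eventually (\<lambda>i. g0 l (diagseq i) = j) sequentially \<and>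
      (\<lambda>i. h0 l (diagseq i)) \<longlonglongrightarrow> v" for l
  proof -
    \<comment> \<open>The diagonal sequence refines the choice for \<open>l\<close> only after its
      first \<open>Suc l\<close> terms; eventual constancy and limits are insensitive to
      those.\<close>
    have "R l (diagseq \<circ> ((+) (Suc l)))" by (rule diagseq_holds) (rule stable)
    then obtain j v where jv: "j \<in> J l" "v \<in> super_window j"
      "eventually (\<lambda>i. g0 l (diagseq (i + Suc l)) = j) sequentially"
      "(\<lambda>i. h0 l (diagseq (i + Suc l))) \<longlonglongrightarrow> v"
      unfolding R_def by (auto simp: add.commute)
    have "eventually (\<lambda>i. g0 l (diagseq i) = j) sequentially"
      using jv(3) eventually_sequentially_seg[of "\<lambda>i. g0 l (diagseq i) = j" "Suc l"] by blast
    moreover have "(\<lambda>i. h0 l (diagseq i)) \<longlonglongrightarrow> v"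
      using LIMSEQ_offset[of "\<lambda>i. h0 l (diagseq i)" "Suc l"] jv(4) by blast
    ultimately show ?thesis using jv(1,2) by blast
  qed
  then obtain j v where jv: "\<And>l. j l \<in> J l" "\<And>l. v l \<in> super_window (j l)"
    "\<And>l. eventually (\<lambda>i. g0 l (diagseq i) = j l) sequentially"
    "\<And>l. (\<lambda>i. h0 l (diagseq i)) \<longlonglongrightarrow> v l" by metis
  have "eventually (\<lambda>i. shift_pattern (h0 l (diagseq i)) (super_piece (j l)) \<subseteq> S (diagseq i)) sequentially" for l
    using jv(3)[of l] eventually_ge_at_top[of l]
  proof eventually_elim
    case (elim i)
    then have "l \<le> diagseq i" using seq_suble[OF subseq_diagseq, of i] by simp
    from gh[OF this] elim show ?case by simp
  qed
  then show ?thesis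
    using jv(1,2,4) subseq_diagseq
    by (intro exI[where x = diagseq] exI[where x = j] exI[where x = v] exI[where x = "\<lambda>l i. h0 l (diagseq i)"])
      simp
qed

text \<open>The limit tiling is the union over \<open>l\<close> of the limiting copies of finite
  supertile patches. These copies cover balls of growing radius; what has to be shown is that they
  fit together.\<close>

lemma compactness:
  assumes J: "\<And>l. finite (J l)" "\<And>l j. j \<in> J l \<Longrightarrow> covering_level (real (Suc l)) j"
    and S: "\<And>l i. l \<le> i \<Longrightarrow> S i \<in> tight_set (real (Suc l)) (J l)"
  shows "\<exists>S'\<in>X. \<exists>r. strict_mono r \<and>
    (\<forall>e>0. eventually (\<lambda>i. locally_close e S' (S (r i))) sequentially)"
proof -
  obtain r j v u where r: "strict_mono r" and j: "\<And>l. j l \<in> J l" and v: "\<And>l. v l \<in> super_window (j l)"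
    and u: "\<And>l. u l \<longlonglongrightarrow> v l"
    and sub: "\<And>l. eventually (\<lambda>i. shift_pattern (u l i) (super_piece (j l)) \<subseteq> S (r i)) sequentially"
  proof -
    obtain r j v u where *: "strict_mono r \<and> (\<forall>l. j l \<in> J l \<and> v l \<in> super_window (j l) \<and> u l \<longlonglongrightarrow> v l \<and>
        eventually (\<lambda>i. shift_pattern (u l i) (super_piece (j l)) \<subseteq> S (r i)) sequentially)"
    proof -
      have "\<exists>r j v u. strict_mono r \<and> (\<forall>l. j l \<in> J l \<and> v l \<in> super_window (j l) \<and> u l \<longlonglongrightarrow> v l \<and>
          eventually (\<lambda>i. shift_pattern (u l i) (super_piece (j l)) \<subseteq> S (r i)) sequentially)"
        by (rule diagonal_limit[OF J(1)]) (rule S)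
      then show thesis using that by (elim exE)
    qed
    show thesis by (rule that[of r j v u]) (use * in simp_all)
  qed
  have SX: "S i \<in> X" for i using S[of 0 i] by (auto simp: tight_set_def cyl_def)
  define F where "F l = super_piece (j l)" for l
  have F: "F l \<in> pieces" for l unfolding F_def using super_piece_in_pieces[OF J(2)[OF j]] by simp
  have cov: "ball 0 (real (Suc l)) \<subseteq> support (shift_pattern (v l) (F l))" for l
    unfolding F_def by (rule covering_level_covers[OF J(2)[OF j] v])
  define S' where "S' = (\<Union>l. shift_pattern (v l) (F l))"
  have tileF: "is_tile W" if "W \<in> F l" for W l
    using that F[of l] patch_T by (auto simp: pieces_def is_patch_def is_pattern_def)
  have near: "eventually (\<lambda>i. z \<in> interior (supp (shift_tile (u l i) W))) sequentially"
    if "z \<in> interior (supp (shift_tile (v l) W))" for z l W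
  proof -
    have z: "z - v l \<in> interior (supp W)" using that by (simp add: mem_translate)
    have "(\<lambda>i. z - u l i) \<longlonglongrightarrow> z - v l" by (intro tendsto_intros u)
    then have "eventually (\<lambda>i. z - u l i \<in> interior (supp W)) sequentially"
      using z by (rule topological_tendstoD[OF _ open_interior])
    then show ?thesis by (simp add: mem_translate)
  qed
  \<comment> \<open>If two limit tiles share an interior point, their approximants in
    \<open>S (r i)\<close> eventually share it too and are one tile. The absence of periods then
    makes the relative displacement eventually constant, so it equals its limit and the limit tiles
    coincide.\<close>
  have same: "shift_tile (v l) W = shift_tile (v l') W'"
    if W: "W \<in> F l" "W' \<in> F l'"
      and z: "z \<in> interior (supp (shift_tile (v l) W))" "z \<in> interior (supp (shift_tile (v l') W'))"
    for l l' W W' z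
  proof -
    have ev: "eventually (\<lambda>i. shift_tile (u l i) W = shift_tile (u l' i) W') sequentially"
      using near[OF z(1)] near[OF z(2)] sub[of l] sub[of l']
    proof eventually_elim
      case (elim i)
      have "shift_tile (u l i) W \<in> S (r i)" "shift_tile (u l' i) W' \<in> S (r i)"
        using elim(3,4) W by (auto simp: F_def shift_pattern_def)
      then show ?case using hull_patch[OF SX] elim(1,2) unfolding is_patch_def by blast
    qed
    then obtain i0 where "\<And>i. i \<ge> i0 \<Longrightarrow> shift_tile (u l i) W = shift_tile (u l' i) W'"
      by (auto simp: eventually_sequentially)
    then have eq: "W' = shift_tile (u l i - u l' i) W" if "i \<ge> i0" for i
    proof -
      have "shift_tile (- u l' i) (shift_tile (u l' i) W') = shift_tile (- u l' i) (shift_tile (u l i) W)"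
        using \<open>\<And>i. i \<ge> i0 \<Longrightarrow> shift_tile (u l i) W = shift_tile (u l' i) W'\<close>[OF that] by (simp only:)
      then show ?thesis by simp
    qed
    define a where "a = u l i0 - u l' i0"
    have const: "u l i - u l' i = a" if "i \<ge> i0" for i
    proof -
      have "shift_tile (- a) (shift_tile (u l i - u l' i) W) = shift_tile (- a) (shift_tile a W)"
        using eq[OF that] eq[of i0] unfolding a_def by (simp only: order_refl)
      then have "shift_tile (- a + (u l i - u l' i)) W = W" by simp
      from no_period[OF tileF[OF W(1)] this] show ?thesis by simp
    qed
    have "(\<lambda>i. u l i - u l' i) \<longlonglongrightarrow> v l - v l'" by (intro tendsto_intros u)
    moreover have "(\<lambda>i. u l i - u l' i) \<longlonglongrightarrow> a"
      by (rule tendsto_eventually) (use const in \<open>auto simp: eventually_sequentially\<close>)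
    ultimately have a: "v l - v l' = a" by (rule LIMSEQ_unique)
    have "shift_tile (v l') W' = shift_tile (v l') (shift_tile a W)"
      using eq[of i0] by (simp only: a_def order_refl)
    then show ?thesis by (simp flip: a)
  qed
  have patch: "is_patch S'"
    unfolding is_patch_def is_pattern_def
  proof (intro conjI ballI impI)
    show "is_tile U" if "U \<in> S'" for U
      using that tileF by (auto simp: S'_def shift_pattern_def)
    fix U U' assume U: "U \<in> S'" "U' \<in> S'" "U \<noteq> U'"
    obtain l W l' W' where "W \<in> F l" "W' \<in> F l'" "U = shift_tile (v l) W" "U' = shift_tile (v l') W'"
      using U(1,2) by (auto simp: S'_def shift_pattern_def)
    then show "interior (supp U) \<inter> interior (supp U') = {}" using same[of W l W' l'] U(3) by blast
  qed
  have sub': "shift_pattern (v l) (F l) \<subseteq> S'" for l by (auto simp: S'_def)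
  have "support S' = UNIV"
  proof (intro equalityI subsetI UNIV_I)
    fix z :: "real ^ 'n"
    obtain l where "norm z < real l" using reals_Archimedean2 by blast
    then have "z \<in> ball 0 (real (Suc l))" by simp
    then show "z \<in> support S'" using cov[of l] support_mono[OF sub'[of l]] by blast
  qed
  then have tilS: "is_tiling S'" using patch by (simp add: is_tiling_def)
  \<comment> \<open>The limit belongs to the hull because each of its shifted pieces is also part of
    a translate of \<open>T\<close> and covers the ball of radius \<open>Suc l\<close>.\<close>
  have "\<exists>x. agree_on (ball 0 \<rho>) (shift_pattern x T) S'" for \<rho>
  proof -
    obtain l where "\<rho> < real l" using reals_Archimedean2 by blast
    then have "ball 0 \<rho> \<subseteq> ball (0 :: real ^ 'n) (real (Suc l))" by (intro subset_ball) simp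
    also have "\<dots> \<subseteq> support (shift_pattern (v l) (F l))" by (rule cov)
    finally have c: "ball 0 \<rho> \<subseteq> support (shift_pattern (v l) (F l))" .
    have "shift_pattern (v l) (F l) \<subseteq> shift_pattern (v l) T"
      using F[of l] by (intro shift_pattern_mono) (auto simp: pieces_def)
    then have "agree_on (ball 0 \<rho>) (shift_pattern (v l) T) S'"
      using patch_T patch sub' c by (intro agree_on_if_common_cover[of _ _ "shift_pattern (v l) (F l)"]) auto
    then show ?thesis ..
  qed
  then have S'X: "S' \<in> X" using tilS by (simp add: hull_iff)
  have "eventually (\<lambda>i. locally_close e S' (S (r i))) sequentially" if e: "0 < e" for e
  proof -
    obtain l where l: "1 / e < real l" using reals_Archimedean2 by blast
    have "ball 0 (1 / e) \<subseteq> ball (0 :: real ^ 'n) (real (Suc l))" using l by (intro subset_ball) simp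
    also have "\<dots> \<subseteq> support (shift_pattern (v l) (F l))" by (rule cov)
    finally have c: "ball 0 (1 / e) \<subseteq> support (shift_pattern (v l) (F l))" .
    show ?thesis using sub[of l] tendstoD[OF u[of l] e]
    proof eventually_elim
      case (elim i)
      have "shift_pattern (v l - u l i) (shift_pattern (u l i) (F l)) \<subseteq> shift_pattern (v l - u l i) (S (r i))"
        using elim(1) unfolding F_def by (rule shift_pattern_mono)
      then have s: "shift_pattern (v l) (F l) \<subseteq> shift_pattern (v l - u l i) (S (r i))" by simp
      have "agree_on (ball 0 (1 / e)) S' (shift_pattern (v l - u l i) (S (r i)))"
        using patch hull_patch[OF SX] by (intro agree_on_if_common_cover[OF _ _ sub' s _ c]) auto
      moreover have "norm (v l - u l i) < e" using elim(2) by (simp add: dist_norm norm_minus_commute)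
      ultimately show ?case unfolding locally_close_def by blast
    qed
  qed
  then show ?thesis using S'X r by blast
qed

section \<open>Closed sets, continuity of translation and inner regularity\<close>

lemma closed_contains_limit:
  assumes K: "closedin HT K" and S: "S \<in> X" and app: "\<And>e. 0 < e \<Longrightarrow> \<exists>S'\<in>K. locally_close e S S'"
  shows "S \<in> K"
proof (rule ccontr)
  assume "S \<notin> K"
  have KX: "K \<subseteq> X" using closedin_subset[OF K] by simp
  have "openin HT (X - K)" using K by (simp add: closedin_def)
  then obtain G where G: "openin local_topology G" "X - K = G \<inter> X"
    unfolding HT_def openin_subtopology by blast
  then have "S \<in> G" using S \<open>S \<notin> K\<close> by blast
  then obtain e where e: "0 < e" "\<And>Q. is_tiling Q \<Longrightarrow> locally_close e S Q \<Longrightarrow> Q \<in> G"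
    using G(1) unfolding openin_local_topology by blast
  obtain S' where S': "S' \<in> K" "locally_close e S S'" using app[OF e(1)] by blast
  then have "S' \<in> G \<inter> X" using e(2) KX hull_tiling by blast
  then show False using G(2) S'(1) by blast
qed

lemma continuous_map_shift: "continuous_map HT HT (shift_pattern x)"
  unfolding continuous_map
proof (intro conjI allI impI)
  show "shift_pattern x ` topspace HT \<subseteq> topspace HT" by auto
  fix W assume W: "openin HT W"
  obtain \<C> where \<C>: "\<C> \<subseteq> open_cyls" "W = \<Union>\<C>"
    using open_is_countable_union_of_cyls[OF W] by blast
  have "openin HT {S \<in> X. shift_pattern x S \<in> C}" if C: "C \<in> \<C>" for C
  proof -
    obtain F Z where FZ: "C = cyl F Z" "F \<in> pieces" "open Z" using C \<C>(1) by (auto simp: open_cyls_def)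
    have "{S \<in> X. shift_pattern x S \<in> cyl F Z} = cyl F (translate (- x) Z)"
    proof -
      have "(\<exists>v\<in>Z. shift_pattern v F \<subseteq> shift_pattern x S) \<longleftrightarrow> (\<exists>v\<in>translate (- x) Z. shift_pattern v F \<subseteq> S)" for S
      proof
        assume "\<exists>v\<in>Z. shift_pattern v F \<subseteq> shift_pattern x S"
        then obtain v where v: "v \<in> Z" "shift_pattern v F \<subseteq> shift_pattern x S" by blast
        from shift_pattern_mono[OF v(2), of "- x"] v(1)
        show "\<exists>v\<in>translate (- x) Z. shift_pattern v F \<subseteq> S"
          by (intro bexI[of _ "- x + v"]) (simp_all add: mem_translate)
      next
        assume "\<exists>v\<in>translate (- x) Z. shift_pattern v F \<subseteq> S"
        then obtain v where v: "v + x \<in> Z" "shift_pattern v F \<subseteq> S" by (auto simp: mem_translate)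
        from shift_pattern_mono[OF v(2), of x] v(1)
        show "\<exists>v\<in>Z. shift_pattern v F \<subseteq> shift_pattern x S"
          by (intro bexI[of _ "v + x"]) (simp_all add: add.commute)
      qed
      then show ?thesis by (auto simp: cyl_def)
    qed
    moreover have "open (translate (- x) Z)"
      unfolding translate_eq_plus_image using FZ(3) by (rule open_translation)
    ultimately show ?thesis using openin_cyl[OF FZ(2)] FZ(1) by simp
  qed
  then have "openin HT (\<Union>C\<in>\<C>. {S \<in> X. shift_pattern x S \<in> C})" by (intro openin_Union) auto
  moreover have "(\<Union>C\<in>\<C>. {S \<in> X. shift_pattern x S \<in> C}) = {S \<in> topspace HT. shift_pattern x S \<in> W}"
    using \<C>(2) by auto
  ultimately show "openin HT {S \<in> topspace HT. shift_pattern x S \<in> W}" by simp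
qed

text \<open>Approximation is by closed local events instead of compact sets; the missing compactness
  is supplied later by intersecting with tight sets.\<close>

definition inner_regular :: "(real ^ 'n, 'l) tile set set \<Rightarrow> bool" where
  "inner_regular F \<longleftrightarrow> (\<forall>e>0. \<exists>K. K \<subseteq> F \<and> K \<in> local_events \<and> closedin HT K \<and> dens (F - K) < e)"

text \<open>Regularity is also asked of the complement, so that complements come for free and a
  union is handled through the intersection of the complements.\<close>

definition regular_events :: "(real ^ 'n, 'l) tile set set set" where
  "regular_events = {F \<in> local_events. inner_regular F \<and> inner_regular (X - F)}"

lemma inner_regular_closed: "F \<in> local_events \<Longrightarrow> closedin HT F \<Longrightarrow> inner_regular F"
  unfolding inner_regular_def by (auto intro!: exI[of _ F] simp: dens_empty)

lemma inner_regular_Un_Int: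
  assumes F: "F \<in> local_events" "inner_regular F" and G: "G \<in> local_events" "inner_regular G"
  shows "inner_regular (F \<union> G)" "inner_regular (F \<inter> G)"
proof -
  have *: "\<exists>K K'. K \<subseteq> F \<and> K' \<subseteq> G \<and> K \<in> local_events \<and> K' \<in> local_events \<and> closedin HT K \<and> closedin HT K' \<and>
      dens ((F - K) \<union> (G - K')) < e" if "0 < e" for e
  proof -
    have h: "0 < e / 2" using that by simp
    obtain K where K: "K \<subseteq> F" "K \<in> local_events" "closedin HT K" "dens (F - K) < e / 2"
      using F(2) h unfolding inner_regular_def by blast
    obtain K' where K': "K' \<subseteq> G" "K' \<in> local_events" "closedin HT K'" "dens (G - K') < e / 2"
      using G(2) h unfolding inner_regular_def by blast
    have "dens ((F - K) \<union> (G - K')) \<le> dens (F - K) + dens (G - K')"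
      by (intro dens_Un_le local_events_Diff F G K K')
    then have "dens ((F - K) \<union> (G - K')) < e" using K(4) K'(4) by simp
    with K K' show ?thesis by blast
  qed
  show "inner_regular (F \<union> G)" unfolding inner_regular_def
  proof (intro allI impI)
    fix e :: real assume "0 < e"
    from *[OF this] obtain K K' where K: "K \<subseteq> F" "K' \<subseteq> G" "K \<in> local_events" "K' \<in> local_events"
      "closedin HT K" "closedin HT K'" "dens ((F - K) \<union> (G - K')) < e" by blast
    have "dens ((F \<union> G) - (K \<union> K')) \<le> dens ((F - K) \<union> (G - K'))"
      using F(1) G(1) K(3,4) by (intro dens_mono local_events_Diff local_events_Un) auto
    then show "\<exists>K. K \<subseteq> F \<union> G \<and> K \<in> local_events \<and> closedin HT K \<and> dens (F \<union> G - K) < e"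
      using K by (intro exI[of _ "K \<union> K'"] conjI local_events_Un closedin_Un) auto
  qed
  show "inner_regular (F \<inter> G)" unfolding inner_regular_def
  proof (intro allI impI)
    fix e :: real assume "0 < e"
    from *[OF this] obtain K K' where K: "K \<subseteq> F" "K' \<subseteq> G" "K \<in> local_events" "K' \<in> local_events"
      "closedin HT K" "closedin HT K'" "dens ((F - K) \<union> (G - K')) < e" by blast
    have "dens ((F \<inter> G) - (K \<inter> K')) \<le> dens ((F - K) \<union> (G - K'))"
      using F(1) G(1) K(3,4) by (intro dens_mono local_events_Diff local_events_Un local_events_Int) auto
    then show "\<exists>K. K \<subseteq> F \<inter> G \<and> K \<in> local_events \<and> closedin HT K \<and> dens (F \<inter> G - K) < e"
      using K by (intro exI[of _ "K \<inter> K'"] conjI local_events_Int closedin_Int) auto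
  qed
qed

lemma algebra_regular_events: "algebra X regular_events"
  unfolding algebra_iff_Un
proof (intro conjI ballI)
  show "regular_events \<subseteq> Pow X" using local_events_subset by (auto simp: regular_events_def)
  have "closedin HT X" using closedin_topspace[of HT] by simp
  then show "{} \<in> regular_events"
    unfolding regular_events_def using inner_regular_closed
    by (simp add: empty_in_events X_in_events)
next
  fix F assume F: "F \<in> regular_events"
  have "X - (X - F) = F" using F local_events_subset by (auto simp: regular_events_def)
  then show "X - F \<in> regular_events"
    using F by (simp add: regular_events_def local_events_Diff X_in_events)
next
  fix F G assume FG: "F \<in> regular_events" "G \<in> regular_events"
  have "inner_regular ((X - F) \<inter> (X - G))"
    using FG by (intro inner_regular_Un_Int) (auto simp: regular_events_def intro: local_events_Diff X_in_events)
  moreover have "(X - F) \<inter> (X - G) = X - (F \<union> G)" by blast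
  ultimately show "F \<union> G \<in> regular_events"
    using FG by (auto simp: regular_events_def intro: local_events_Un inner_regular_Un_Int)
qed

text \<open>The complement is closed. The cylinder itself is exhausted by the closed cylinders over
  compact \<open>K\<close> inside \<open>Z\<close>, and the density of the difference is controlled
  by \<open>vol (Z - K)\<close>.\<close>

lemma open_cyl_regular:
  assumes F: "F \<in> pieces" and Z: "open Z" "bounded Z"
  shows "cyl F Z \<in> regular_events"
proof -
  have ev: "cyl F Z \<in> local_events" using F Z by (rule open_cyl_event)
  have "closedin HT (X - cyl F Z)"
    using openin_cyl[OF F Z(1)] by (simp add: closedin_def double_diff cyl_subset)
  then have "inner_regular (X - cyl F Z)"
    by (intro inner_regular_closed local_events_Diff X_in_events ev)
  moreover have "inner_regular (cyl F Z)"
    unfolding inner_regular_def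
  proof (intro allI impI)
    fix e :: real assume e: "0 < e"
    obtain C where C: "0 \<le> C"
      "\<And>K. compact K \<Longrightarrow> K \<subseteq> Z \<Longrightarrow> dens (cyl F Z - cyl F K) \<le> C * vol (Z - K)"
      using dens_cyl_Diff_le[OF F Z] by metis
    have "Z \<in> sets lebesgue" using Z(1) by auto
    moreover have d: "0 < e / (C + 1)" using e C(1) by simp
    ultimately obtain K where K: "closed K" "K \<subseteq> Z" "Z - K \<in> lmeasurable"
        "emeasure lebesgue (Z - K) < ennreal (e / (C + 1))"
      by (rule sets_lebesgue_inner_closed)
    have cK: "compact K" using K(1,2) Z(2) bounded_subset by (auto simp: compact_eq_bounded_closed)
    have "ennreal (vol (Z - K)) < ennreal (e / (C + 1))"
      using K(3,4) by (simp add: emeasure_eq_measure2)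
    then have "vol (Z - K) < e / (C + 1)" using d by (simp add: ennreal_less_iff)
    then have "C * vol (Z - K) \<le> C * (e / (C + 1))" using C(1) by (intro mult_left_mono) auto
    also have "\<dots> < e" using C(1) e by (simp add: field_simps)
    finally have "dens (cyl F Z - cyl F K) < e" using C(2)[OF cK K(2)] by linarith
    moreover have "cyl F K \<subseteq> cyl F Z" using K(2) by (auto simp: cyl_def)
    ultimately show "\<exists>K. K \<subseteq> cyl F Z \<and> K \<in> local_events \<and> closedin HT K \<and> dens (cyl F Z - K) < e"
      using compact_cyl_event[OF F cK] closedin_cyl[OF F cK] by blast
  qed
  ultimately show ?thesis using ev by (simp add: regular_events_def)
qed

lemma sets_HM_regular: "sets HM = sigma_sets X regular_events"
proof
  show "sets HM \<subseteq> sigma_sets X regular_events"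
    unfolding sets_HM_cyls
  proof (rule sigma_sets_mono, rule subsetI)
    fix W assume "W \<in> open_cyls"
    then have "W \<in> regular_events" by (auto simp: open_cyls_def intro: open_cyl_regular)
    then show "W \<in> sigma_sets X regular_events" by (rule sigma_sets.Basic)
  qed
  have "regular_events \<subseteq> sets HM" using local_events_sets by (auto simp: regular_events_def)
  then show "sigma_sets X regular_events \<subseteq> sets HM"
    using sets.sigma_sets_subset[of regular_events HM] by simp
qed

text \<open>Discarding from \<open>A i\<close> the errors of the closed approximations
  \<open>K l\<close> and of the tight sets \<open>G l\<close> with \<open>l \<le> i\<close> costs
  density less than \<open>e\<close>, so some \<open>S i\<close> remains. It lies in
  \<open>K l\<close> and \<open>G l\<close> for all these \<open>l\<close>; a limit tiling exists by
  tightness and belongs to every closed \<open>K l\<close>.\<close>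

lemma decreasing_events_nonempty:
  assumes A: "\<And>i. A i \<in> regular_events" "decseq A" and e: "0 < e" "\<And>i. e \<le> dens (A i)"
  shows "(\<Inter>i. A i) \<noteq> {}"
proof -
  have evA: "A i \<in> local_events" for i using A(1) by (auto simp: regular_events_def)
  \<comment> \<open>A geometric series with sum \<open>e / 2\<close>, strictly within the allowance
    \<open>e\<close>; each term is shared equally between the closed approximation and the tight
    set.\<close>
  define \<eta> where "\<eta> i = e / 2 * (1 / 2) ^ Suc i" for i
  have \<eta>: "0 < \<eta> i" for i using e(1) by (simp add: \<eta>_def)
  have "\<exists>K. K \<subseteq> A i \<and> K \<in> local_events \<and> closedin HT K \<and> dens (A i - K) < \<eta> i / 2" for i
  proof -
    have "inner_regular (A i)" using A(1)[of i] by (simp add: regular_events_def)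
    moreover have "0 < \<eta> i / 2" using \<eta>[of i] by simp
    ultimately show ?thesis unfolding inner_regular_def by blast
  qed
  then obtain K where K: "\<And>i. K i \<subseteq> A i" "\<And>i. K i \<in> local_events" "\<And>i. closedin HT (K i)"
      "\<And>i. dens (A i - K i) < \<eta> i / 2" by metis
  have "\<exists>J. finite J \<and> (\<forall>j\<in>J. covering_level (real (Suc l)) j) \<and> dens (X - tight_set (real (Suc l)) J) < \<eta> l / 2" for l
    using \<eta>[of l] by (intro tightness) auto
  then obtain J where J: "\<And>l. finite (J l)" "\<And>l j. j \<in> J l \<Longrightarrow> covering_level (real (Suc l)) j"
      "\<And>l. dens (X - tight_set (real (Suc l)) (J l)) < \<eta> l / 2" by metis
  define G where "G l = tight_set (real (Suc l)) (J l)" for l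
  have G: "G l \<in> local_events" for l unfolding G_def using J(1,2) by (intro tight_set_event) auto
  define H where "H i = A i - (\<Union>l\<le>i. (A l - K l) \<union> (X - G l))" for i
  have bad: "(\<Union>l\<le>i. (A l - K l) \<union> (X - G l)) \<in> local_events \<and>
      dens (\<Union>l\<le>i. (A l - K l) \<union> (X - G l)) \<le> (\<Sum>l\<le>i. \<eta> l)" for i
  proof (induction i)
    have one: "(A l - K l) \<union> (X - G l) \<in> local_events" "dens ((A l - K l) \<union> (X - G l)) \<le> \<eta> l" for l
    proof -
      have m: "A l - K l \<in> local_events" "X - G l \<in> local_events"
        by (intro local_events_Diff evA K X_in_events G)+
      then show "(A l - K l) \<union> (X - G l) \<in> local_events" by (rule local_events_Un)
      show "dens ((A l - K l) \<union> (X - G l)) \<le> \<eta> l"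
        using dens_Un_le[OF m] K(4)[of l] J(3)[of l] unfolding G_def by linarith
    qed
    case 0
    show ?case using one[of 0] by simp
    case (Suc i)
    let ?U = "\<Union>l\<le>i. (A l - K l) \<union> (X - G l)"
    have eq: "(\<Union>l\<le>Suc i. (A l - K l) \<union> (X - G l)) = ?U \<union> ((A (Suc i) - K (Suc i)) \<union> (X - G (Suc i)))"
      by (simp add: atMost_Suc Un_commute)
    have "?U \<union> ((A (Suc i) - K (Suc i)) \<union> (X - G (Suc i))) \<in> local_events"
      using Suc one(1) by (intro local_events_Un[of ?U]) auto
    moreover have "dens (?U \<union> ((A (Suc i) - K (Suc i)) \<union> (X - G (Suc i)))) \<le> (\<Sum>l\<le>Suc i. \<eta> l)"
      using dens_Un_le[of ?U "(A (Suc i) - K (Suc i)) \<union> (X - G (Suc i))"] Suc one[of "Suc i"] by simp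
    ultimately show ?case unfolding eq by blast
  qed
  have geo: "(\<Sum>l\<le>i. \<eta> l) < e" for i
  proof -
    have "(\<Sum>l\<le>i. \<eta> l) = e / 2 * (1 - (1 / 2) ^ Suc i)"
      by (induction i) (simp_all add: \<eta>_def field_simps)
    also have "\<dots> \<le> e / 2 * 1" using e(1) by (intro mult_left_mono) auto
    also have "\<dots> < e" using e(1) by simp
    finally show ?thesis .
  qed
  have "H i \<noteq> {}" for i
  proof
    assume "H i = {}"
    then have "A i \<subseteq> (\<Union>l\<le>i. (A l - K l) \<union> (X - G l))" unfolding H_def by blast
    then have "dens (A i) \<le> dens (\<Union>l\<le>i. (A l - K l) \<union> (X - G l))"
      using bad[of i] by (intro dens_mono evA) auto
    then show False using bad[of i] geo[of i] e(2)[of i] by linarith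
  qed
  note Hne = this
  define S where "S i = (SOME x. x \<in> H i)" for i
  have S: "S i \<in> H i" for i unfolding S_def some_in_eq by (rule Hne)
  have SK: "S i \<in> K l" and SG: "S i \<in> G l" if "l \<le> i" for l i
  proof -
    have "S i \<in> A i" using S[of i] by (simp add: H_def)
    then have "S i \<in> A l" "S i \<in> X" using decseqD[OF A(2) that] local_events_subset[OF evA[of i]] by auto
    moreover have "S i \<notin> (A l - K l) \<union> (X - G l)" using S[of i] that by (auto simp: H_def)
    ultimately show "S i \<in> K l" "S i \<in> G l" by auto
  qed
  have "\<exists>S'\<in>X. \<exists>r. strict_mono r \<and>
      (\<forall>e>0. eventually (\<lambda>i. locally_close e S' (S (r i))) sequentially)"
    by (rule compactness[OF J(1,2)]) (assumption | rule SG[unfolded G_def])+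
  then obtain S' r where S': "S' \<in> X" "strict_mono r"
    "\<And>e. 0 < e \<Longrightarrow> eventually (\<lambda>i. locally_close e S' (S (r i))) sequentially"
    by blast
  have "S' \<in> K l" for l
  proof (rule closed_contains_limit[OF K(3) S'(1)])
    fix e :: real assume "0 < e"
    obtain i where i: "locally_close e S' (S (r i))" "l \<le> i"
      using eventually_happens'[OF sequentially_bot
          eventually_conj[OF S'(3)[OF \<open>0 < e\<close>] eventually_ge_at_top[of l]]] by blast
    have "S (r i) \<in> K l" using SK[of l "r i"] seq_suble[OF S'(2), of i] i(2) by simp
    with i(1) show "\<exists>S''\<in>K l. locally_close e S' S''" by blast
  qed
  then show ?thesis using K(1) by blast
qed

section \<open>Extension of the density to an invariant measure\<close>

lemma invariant_measure_exists:
  "\<exists>M. prob_space M \<and> sets M = sets HM \<and> (\<forall>x. distr M M (shift_pattern x) = M)"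
proof -
  interpret algebra X regular_events by (rule algebra_regular_events)
  have ev: "F \<in> local_events" if "F \<in> regular_events" for F using that by (simp add: regular_events_def)
  define f where "f F = ennreal (dens F)" for F
  have "\<exists>\<mu>. (\<forall>F\<in>regular_events. \<mu> F = f F) \<and> measure_space X (sigma_sets X regular_events) \<mu>"
  proof (rule caratheodory_empty_continuous)
    show "positive regular_events f" by (simp add: positive_def f_def dens_empty)
    show "additive regular_events f"
      unfolding additive_def f_def
      by (intro ballI impI) (simp add: dens_Un ev dens_nonneg ennreal_plus)
    show "f A \<noteq> \<infinity>" for A by (simp add: f_def)
    fix A :: "nat \<Rightarrow> _" assume A: "range A \<subseteq> regular_events" "decseq A" "(\<Inter>i. A i) = {}"
    have AR: "A i \<in> regular_events" for i using A(1) by blast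
    have dec: "dens (A j) \<le> dens (A i)" if "i \<le> j" for i j
      using decseqD[OF A(2) that] AR by (intro dens_mono ev) auto
    have "(\<lambda>i. dens (A i)) \<longlonglongrightarrow> 0"
    proof (rule LIMSEQ_I)
      fix e :: real assume e: "0 < e"
      have "\<exists>i. dens (A i) < e"
      proof (rule ccontr)
        assume "\<not> ?thesis"
        then have "\<And>i. e \<le> dens (A i)" by (simp add: not_less)
        from decreasing_events_nonempty[OF AR A(2) e this] A(3) show False by simp
      qed
      then obtain i where "dens (A i) < e" ..
      then have "dens (A j) < e" if "i \<le> j" for j using dec[OF that] by simp
      then show "\<exists>no. \<forall>n\<ge>no. norm (dens (A n) - 0) < e" using dens_nonneg[OF ev[OF AR]] by auto
    qed
    then show "(\<lambda>i. f (A i)) \<longlonglongrightarrow> 0"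
      unfolding f_def using tendsto_ennrealI by fastforce
  qed
  then obtain \<mu> where \<mu>: "\<And>F. F \<in> regular_events \<Longrightarrow> \<mu> F = f F"
      "measure_space X (sigma_sets X regular_events) \<mu>" by blast
  define M where "M = measure_of X (sigma_sets X regular_events) \<mu>"
  have sub: "sigma_sets X regular_events \<subseteq> Pow X" using sigma_sets_into_sp[OF space_closed] by blast
  have spM: "space M = X" unfolding M_def using sub by (simp add: space_measure_of_conv)
  have setsM: "sets M = sets HM"
    unfolding M_def sets_HM_regular using sub by (simp add: sets_measure_of sigma_sets_sigma_sets_eq[OF space_closed])
  have emM: "emeasure M F = ennreal (dens F)" if "F \<in> regular_events" for F
  proof -
    have "emeasure M F = \<mu> F"
      unfolding M_def using \<mu>(2) that
      by (intro emeasure_measure_of_sigma) (auto simp: measure_space_def intro: sigma_sets.Basic)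
    then show ?thesis using \<mu>(1)[OF that] by (simp add: f_def)
  qed
  have XR: "X \<in> regular_events" by (rule top)
  have prob: "prob_space M"
    by (rule prob_spaceI) (simp add: spM emM[OF XR] dens_X)
  have inv: "distr M M (shift_pattern x) = M" for x
  proof (rule measure_eqI_generator_eq[where \<Omega> = X and E = regular_events and A = "\<lambda>_. X"])
    show "Int_stable regular_events" by (auto simp: Int_stable_def)
    show "regular_events \<subseteq> Pow X" by (rule space_closed)
    have meas: "shift_pattern x \<in> measurable M M"
      using shift_measurable measurable_cong_sets[OF setsM setsM] by blast
    show "emeasure (distr M M (shift_pattern x)) F = emeasure M F" if F: "F \<in> regular_events" for F
    proof -
      let ?F' = "shift_pattern x -` F \<inter> X"
      \<comment> \<open>The values of \<open>M\<close> are known on regular events only, so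
        preimages under translation have to be regular too: continuity keeps the approximants
        closed, and the density does not change under translation.\<close>
      have inner: "inner_regular (shift_pattern x -` G \<inter> X)" if G: "G \<in> local_events" "inner_regular G" for G
        unfolding inner_regular_def
      proof (intro allI impI)
        fix e :: real assume "0 < e"
        then obtain K where K: "K \<subseteq> G" "K \<in> local_events" "closedin HT K" "dens (G - K) < e"
          using G(2) unfolding inner_regular_def by blast
        let ?K' = "shift_pattern x -` K \<inter> X"
        have "?K' = {S \<in> topspace HT. shift_pattern x S \<in> K}" by auto
        then have "closedin HT ?K'"
          using closedin_continuous_map_preimage[OF continuous_map_shift K(3), of x] by simp
        moreover have "dens (shift_pattern x -` G \<inter> X - ?K') = dens (G - K)"
        proof -
          have "shift_pattern x -` G \<inter> X - ?K' = shift_pattern x -` (G - K) \<inter> X" by blast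
          then show ?thesis using shift_event(2)[OF local_events_Diff[OF G(1) K(2)], of x] by simp
        qed
        ultimately show "\<exists>K. K \<subseteq> shift_pattern x -` G \<inter> X \<and> K \<in> local_events \<and> closedin HT K \<and>
            dens (shift_pattern x -` G \<inter> X - K) < e"
          using K shift_event(1)[OF K(2), of x] by (intro exI[of _ ?K']) auto
      qed
      have "X - ?F' = shift_pattern x -` (X - F) \<inter> X" by auto
      then have "inner_regular (X - ?F')"
        using inner[of "X - F"] F by (simp add: regular_events_def local_events_Diff X_in_events)
      then have F': "?F' \<in> regular_events"
        using F inner[of F] shift_event(1)[OF ev[OF F], of x] by (simp add: regular_events_def)
      have "emeasure (distr M M (shift_pattern x)) F = emeasure M ?F'"
        using meas F ev local_events_sets by (subst emeasure_distr) (auto simp: setsM spM)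
      also have "\<dots> = ennreal (dens F)" using emM[OF F'] shift_event(2)[OF ev[OF F], of x] by simp
      finally show ?thesis using emM[OF F] by simp
    qed
    show "sets (distr M M (shift_pattern x)) = sigma_sets X regular_events" "sets M = sigma_sets X regular_events"
      using setsM by (simp_all add: sets_HM_regular)
    show "range (\<lambda>_. X) \<subseteq> regular_events" using XR by auto
    show "emeasure (distr M M (shift_pattern x)) X \<noteq> \<infinity>" for i :: nat
      using prob_space.emeasure_space_1[OF prob_space.prob_space_distr[OF prob meas]] by (simp add: spM)
  qed simp
  show ?thesis using prob setsM inv by blast
qed

theorem hull_uniquely_ergodic: "uniquely_ergodic_hull T"
  unfolding uniquely_ergodic_hull_def HT_def[symmetric] HM_def[symmetric]
proof (rule ex_ex1I)
  show "\<exists>M. prob_space M \<and> sets M = sets HM \<and> (\<forall>x. distr M M (shift_pattern x) = M)"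
    by (rule invariant_measure_exists)
qed (auto intro: invariant_measure_unique)

end

theorem theorem2p9:
  fixes B :: "(real ^ 'n, 'l::finite) tile set"
    and \<phi> :: "real ^ 'n \<Rightarrow> real ^ 'n"
    and \<rho> :: "(real ^ 'n, 'l) tile \<Rightarrow> (real ^ 'n, 'l) tile set"
    and \<T> :: "(real ^ 'n, 'l) tile set"
    and k :: nat
  assumes "overlapping_substitution B \<phi> \<rho>"
    and "expanding B \<phi> \<rho>"
    and "is_tiling \<T>"
    and "\<T> \<subseteq> translates B"
    and "k > 0"
    and "(subst B \<phi> \<rho> ^^ k) \<T> = \<T>"
    and "repetitive \<T>"
  shows "(\<forall>P :: (real ^ 'n, 'l) tile set. is_patch P \<and> finite P \<and> P \<noteq> {} \<longrightarrow>
           (\<exists>c :: real. \<forall>A :: nat \<Rightarrow> (real ^ 'n) set. van_hove A \<longrightarrow>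
              (\<forall>n x. finite {y \<in> (\<lambda>a. a + x) ` A n. shift_pattern y P \<subseteq> \<T>}) \<and>
              (\<forall>x :: nat \<Rightarrow> real ^ 'n.
                 (\<lambda>n. real (card {y \<in> (\<lambda>a. a + x n) ` A n. shift_pattern y P \<subseteq> \<T>})
                        / measure lebesgue (A n)) \<longlonglongrightarrow> c) \<and>
              uniform_limit UNIV
                (\<lambda>n x. real (card {y \<in> (\<lambda>a. a + x) ` A n. shift_pattern y P \<subseteq> \<T>})
                        / measure lebesgue (A n)) (\<lambda>x. c) sequentially))
         \<and> uniquely_ergodic_hull \<T>"
proof -
  obtain \<psi> \<Lambda> s q P where "supertiles \<psi> \<Lambda> s q \<T> P"
    by (rule fixed_point_supertiles[OF assms])
  then interpret supertiles \<psi> \<Lambda> s q \<T> P .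
  show ?thesis
  proof (intro conjI allI impI hull_uniquely_ergodic, elim conjE)
    fix F :: "(real ^ 'n, 'l) tile set"
    assume "is_patch F" "finite F" "F \<noteq> {}"
    then show "\<exists>c :: real. \<forall>A :: nat \<Rightarrow> (real ^ 'n) set. van_hove A \<longrightarrow>
        (\<forall>n x. finite {y \<in> (\<lambda>a. a + x) ` A n. shift_pattern y F \<subseteq> \<T>}) \<and>
        (\<forall>x :: nat \<Rightarrow> real ^ 'n.
           (\<lambda>n. real (card {y \<in> (\<lambda>a. a + x n) ` A n. shift_pattern y F \<subseteq> \<T>})
                  / measure lebesgue (A n)) \<longlonglongrightarrow> c) \<and>
        uniform_limit UNIV
          (\<lambda>n x. real (card {y \<in> (\<lambda>a. a + x) ` A n. shift_pattern y F \<subseteq> \<T>})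
                  / measure lebesgue (A n)) (\<lambda>x. c) sequentially"
      by (rule uniform_patch_frequency)
  qed
qed

end
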